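(* Let $d\ge2$ and $\tau_1,\ldots,\tau_d>0$. Let $e_1,\ldots,e_d$ be the standard orthonormal basis of $\mathbb R^d$, consider the simplex $S=[0,e_1/\tau_1,\ldots,e_d/\tau_d]$, and let $k\in\{0,\ldots,d-1\}$. (i) The internal and external angles of $S$ at its $k$-dimensional face $F=[0,e_1/\tau_1,\ldots,e_k/\tau_k]$ are $\beta(F,S)=1/2^{d-k}=\gamma(F,S)$. (ii) The internal and external angles of $S$ at its $k$-dimensional face $F=[e_1/\tau_1,\ldots,e_{k+1}/\tau_{k+1}]$ are $$\beta(F,S)=\lim_{\lambda_1\to\pm\infty}\mathbf g_{d-k}\bigl(-(\tau_1^2+\cdots+\tau_d^2)-\lambda_1;\ \lambda_1,\tau_{k+2}^2,\ldots,\tau_d^2;\ \operatorname{sgn}(\lambda_1),1,\ldots,1\bigr)$$ $$=\frac1{2^{d-k}}+\frac1\pi\int_0^\infty\frac{e^{-(\tau_1^2+\cdots+\tau_d^2)y^2/2}}{y}\operatorname{Im}\Bigl(\prod_{j=k+2}^d\Phi(-i\tau_jy)\Bigr)dy,$$ $$\gamma(F,S)=\lim_{\lambda_1\to\pm\infty}\mathbf g_{d-k}\bigl(\tau_1^2+\cdots+\tau_{k+1}^2;\ \lambda_1,\tau_{k+2}^2,\ldots,\tau_d^2;\ 1,\ldots,1\bigr)$$ $$=\frac1{\sqrt{2\pi}}\int_0^\infty\prod_{j=k+2}^d\Phi\Bigl(\frac{\tau_j}{\sqrt{\tau_1^2+\cdots+\tau_{k+1}^2}}\,x\Bigr)e^{-x^2/2}\,dx.$$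 Here the limits are valid both as $\lambda_1\to+\infty$ and as $\lambda_1\to-\infty$.
   Context: $[\ldots]$ denotes the convex hull, $i=\sqrt{-1}$, and $\Phi:\mathbb C\to\mathbb C$, $\Phi(z)=\frac12+\frac1{\sqrt{2\pi}}\int_0^ze^{-x^2/2}\,dx$ (along any contour from $0$ to $z$). Empty products equal $1$. Angles: the solid angle of a polyhedral cone $C$ is $\alpha(C)=\mathbb P[\xi\in C]$ with $\xi$ a standard Gaussian vector on the linear hull of $C$. For a face $F$ of a polytope $P\subseteq\mathbb R^N$ and $x_0$ in the relative interior of $F$, the tangent cone is $T(F,P)=\{v\in\mathbb R^N: x_0+\varepsilon v\in P\text{ for some }\varepsilon>0\}$ and the normal cone is its polar $N(F,P)=\{v\in\mathbb R^N:\langle v,z-x_0\rangle\le0\text{ for all }z\in P\}$; $\beta(F,P):=\alpha(T(F,P))$ and $\gamma(F,P):=\alpha(N(F,P))$ are the internal and external angles. Function $\mathbf g_\ell$: for $\ell\in\mathbb N$, nonzero real $\lambda_0,\ldots,\lambda_\ell$ such that either (A) all are positive, or (B) exactly one is negative, all others are positive and $\lambda_0+\cdots+\lambda_\ell<0$, and for $\varepsilon_1,\ldots,\varepsilon_\ell\in\{\pm1\}$, $\mathbf g_\ell(\lambda_0;\lambda_1,\ldots,\lambda_\ell;\varepsilon_1,\ldots,\varepsilon_\ell):=\mathbb P[\varepsilon_1\eta_1\le0,\ldots,\varepsilon_\ell\eta_\ell\le0]$, where $(\eta_1,\ldots,\eta_\ell)$ is centered Gaussian with covariance matrix $\bigl(\frac1{\lambda_0}+\frac{\delta_{ij}}{\lambda_i}\bigr)_{i,j=1}^\ell$.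 In the limits above, $\mathbf g_{d-k}$ is well-defined once $|\lambda_1|$ is sufficiently large. *)

theory Defs
  imports "HOL-Probability.Probability" "HOL-Complex_Analysis.Complex_Analysis"
begin

text \<open>The integrand is entire, so the integral does not depend on the contour from \<open>0\<close> to \<open>z\<close>.\<close>

definition Phi :: "complex \<Rightarrow> complex" where
  "Phi z = 1/2 + 1 / complex_of_real (sqrt (2 * pi)) *
             contour_integral (linepath 0 z) (\<lambda>x. exp (- (x\<^sup>2) / 2))"


text \<open>The law of a standard Gaussian vector on a linear subspace \<open>L\<close>: the coordinates in an
  orthonormal basis of \<open>L\<close> are independent standard normal variables. The law does not depend on
  the basis.\<close>

definition orthonormal_basis_of :: "'a::euclidean_space set \<Rightarrow> 'a set \<Rightarrow> bool" where
  "orthonormal_basis_of L B \<longleftrightarrow>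
     B \<subseteq> L \<and> pairwise orthogonal B \<and> (\<forall>b\<in>B. norm b = 1) \<and> span B = L"

definition standard_gaussian_on :: "'a::euclidean_space set \<Rightarrow> 'a measure" where
  "standard_gaussian_on L =
     (let B = (SOME B. orthonormal_basis_of L B) in
        distr (\<Pi>\<^sub>M b\<in>B. density lborel std_normal_density) borel (\<lambda>x. \<Sum>b\<in>B. x b *\<^sub>R b))"

definition solid_angle :: "'a::euclidean_space set \<Rightarrow> real" where
  "solid_angle C = measure (standard_gaussian_on (span C)) C"


text \<open>The tangent and normal cones at a face do not depend on the choice of the relative interior
  point.\<close>

definition face_point :: "'a::euclidean_space set \<Rightarrow> 'a" where
  "face_point F = (SOME x. x \<in> rel_interior F)"

definition tangent_cone :: "'a::euclidean_space set \<Rightarrow> 'a set \<Rightarrow> 'a set" where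
  "tangent_cone F P = {v. \<exists>\<epsilon>>0. face_point F + \<epsilon> *\<^sub>R v \<in> P}"

definition normal_cone :: "'a::euclidean_space set \<Rightarrow> 'a set \<Rightarrow> 'a set" where
  "normal_cone F P = {v. \<forall>z\<in>P. v \<bullet> (z - face_point F) \<le> 0}"

definition internal_angle :: "'a::euclidean_space set \<Rightarrow> 'a set \<Rightarrow> real" where
  "internal_angle F P = solid_angle (tangent_cone F P)"

definition external_angle :: "'a::euclidean_space set \<Rightarrow> 'a set \<Rightarrow> real" where
  "external_angle F P = solid_angle (normal_cone F P)"


text \<open>The centered Gaussian law on \<open>\<real>\<^sup>I\<close> with covariance matrix \<open>\<Sigma>\<close>: the image of the standard
  Gaussian law under a matrix \<open>A\<close> with \<open>A A\<^sup>T = \<Sigma>\<close>. Such an \<open>A\<close> exists iff \<open>\<Sigma>\<close> is symmetric and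
  positive semidefinite, and the law then depends on \<open>\<Sigma>\<close> only.\<close>

definition is_centered_gaussian ::
  "'i set \<Rightarrow> ('i \<Rightarrow> 'i \<Rightarrow> real) \<Rightarrow> ('i \<Rightarrow> real) measure \<Rightarrow> bool" where
  "is_centered_gaussian I \<Sigma> N \<longleftrightarrow>
     (\<exists>A. (\<forall>i\<in>I. \<forall>j\<in>I. (\<Sum>m\<in>I. A i m * A j m) = \<Sigma> i j) \<and>
          N = distr (\<Pi>\<^sub>M i\<in>I. density lborel std_normal_density) (\<Pi>\<^sub>M i\<in>I. borel)
                (\<lambda>z. \<lambda>i\<in>I. \<Sum>m\<in>I. A i m * z m))"

definition centered_gaussian ::
  "'i set \<Rightarrow> ('i \<Rightarrow> 'i \<Rightarrow> real) \<Rightarrow> ('i \<Rightarrow> real) measure" where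
  "centered_gaussian I \<Sigma> = (THE N. is_centered_gaussian I \<Sigma> N)"


text \<open>The parameters \<open>\<lambda>\<^sub>0, \<dots>, \<lambda>\<^sub>\<ell>\<close> are the values of \<open>lam\<close> on \<open>{0..l}\<close> and the signs
  \<open>\<epsilon>\<^sub>1, \<dots>, \<epsilon>\<^sub>\<ell>\<close> those of \<open>eps\<close> on \<open>{1..l}\<close>; other values are irrelevant. Outside its domain the
  function \<open>gfun\<close> is left unspecified.\<close>

definition g_params :: "nat \<Rightarrow> (nat \<Rightarrow> real) \<Rightarrow> (nat \<Rightarrow> real) \<Rightarrow> bool" where
  "g_params l lam eps \<longleftrightarrow>
     ((\<forall>j\<in>{0..l}. lam j > 0) \<or>
      (\<exists>m\<in>{0..l}. lam m < 0 \<and> (\<forall>j\<in>{0..l} - {m}. lam j > 0)) \<and> (\<Sum>j=0..l. lam j) < 0) \<and>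
     (\<forall>j\<in>{1..l}. eps j \<in> {1, -1})"

definition g_cov :: "(nat \<Rightarrow> real) \<Rightarrow> nat \<Rightarrow> nat \<Rightarrow> real" where
  "g_cov lam i j = 1 / lam 0 + (if i = j then 1 / lam i else 0)"

definition gfun :: "nat \<Rightarrow> (nat \<Rightarrow> real) \<Rightarrow> (nat \<Rightarrow> real) \<Rightarrow> real" where
  "gfun l lam eps =
     (if g_params l lam eps then
        measure (centered_gaussian {1..l} (g_cov lam))
          {\<eta> \<in> space (centered_gaussian {1..l} (g_cov lam)). \<forall>j\<in>{1..l}. eps j * \<eta> j \<le> 0}
      else undefined)"

end

theory Submission
  imports Defs "HOL-Real_Asymp.Real_Asymp"
begin

text \<open>
  All angles and all values of \<open>gfun\<close> in the statement have the form
  \<open>P[(A z)\<^sub>i \<le> 0 for all i]\<close> with a standard Gaussian vector \<open>z\<close>, and such a probability depends on the Gram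
  matrix \<open>A A\<^sup>T\<close> only, because a law on \<open>\<real>\<^sup>I\<close> is determined by its characteristic function. This makes the
  choices of bases and of square roots of covariance matrices irrelevant, and each quantity can be
  computed with a convenient \<open>A\<close>.

  For the limits, one Cholesky step turns the covariance matrix of \<open>gfun\<close> into a rank-one perturbation of a
  positive diagonal matrix with parameter \<open>1 / (\<lambda>\<^sub>0 + \<lambda>\<^sub>1)\<close>, which has an explicit square root; after
  rescaling the first row, the root converges to a root of the Gram matrix of the cone.

  For the integrals, \<open>A\<close> is chosen such that only one coordinate of \<open>z\<close> interacts with the others. The external
  angle is then immediate by conditioning on that coordinate. For the internal angle, the remaining
  half-line probability is written as \<open>1/2 + 1/\<pi> \<integral> exp (- s\<^sup>2 t\<^sup>2 / 2) sin (t y) / t dt\<close>, and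
  Fubini's theorem with \<open>E[exp (i a z); z \<le> 0] = exp (- a\<^sup>2 / 2) \<Phi>(- i a)\<close> gives the product formula.
\<close>

section \<open>Laws of linear images of Gaussian vectors\<close>

text \<open>The parameter \<open>1 / (lam 0 + lam 1)\<close> is the Schur complement 1/lambda_0 -
  (1/lambda_0)^2 / (1/lambda_0 + 1/lambda_1), and it governs both limits. For the internal angle
  lambda_0 + lambda_1 = -(tau_1^2 + ... + tau_d^2) stays fixed while the variance of eta_1 tends to
  0; without the rescaling the limit matrix would have a zero row, where orthant probabilities need
  not be continuous. After it only the entry coupling the first row to the others moves, and
  sgn(lambda_1) compensates the sign of lambda_0, so that both limits agree. For the external angle
  |lambda_0 + lambda_1| tends to infinity and the perturbation disappears.

  The coordinate singled out for the integrals is the component along (tau_1, ..., tau_{k+1}, 0,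
  ..., 0): the first k+1 coordinates enter the cone constraints only through it. Sines are used
  because the probability of a half-line ending at a sum Y does not factor over the summands,
  whereas the exponentials inside sin (t Y) do.\<close>

lemma borel_measurable_cis [measurable]: "cis \<in> borel_measurable borel"
  by (intro borel_measurable_continuous_onI continuous_on_cis continuous_on_id)

text \<open>Dividing the weights by their common total mass turns them into probability densities.
  The laws of \<open>X\<close> and \<open>Y\<close> under these densities have equal characteristic
  functions, so Levy uniqueness on the line applies.\<close>

lemma transform_eq_imp_weighted_eq:
  fixes f :: "'a \<Rightarrow> real" and g :: "'b \<Rightarrow> real" and X :: "'a \<Rightarrow> real" and Y :: "'b \<Rightarrow> real"
  assumes M: "prob_space M" and N: "prob_space N"
    and [measurable]: "f \<in> borel_measurable M" "g \<in> borel_measurable N"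
      "X \<in> borel_measurable M" "Y \<in> borel_measurable N"
    and f0: "\<And>x. 0 \<le> f x" "\<And>x. f x \<le> C" and g0: "\<And>x. 0 \<le> g x" "\<And>x. g x \<le> C"
    and eq: "\<And>s. (\<integral>x. f x *\<^sub>R cis (s * X x) \<partial>M) = (\<integral>x. g x *\<^sub>R cis (s * Y x) \<partial>N)"
    and B [measurable]: "B \<in> sets borel"
  shows "(\<integral>x. f x * indicator B (X x) \<partial>M) = (\<integral>x. g x * indicator B (Y x) \<partial>N)"
proof -
  interpret M: prob_space M by fact
  interpret N: prob_space N by fact
  have intf: "integrable M f" by (rule M.integrable_const_bound[of _ C]) (use f0 in auto)
  have intg: "integrable N g" by (rule N.integrable_const_bound[of _ C]) (use g0 in auto)
  define c where "c = (\<integral>x. f x \<partial>M)"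
  have "of_real (\<integral>x. f x \<partial>M) = (of_real (\<integral>x. g x \<partial>N) :: complex)"
    using eq[of 0] by (simp add: scaleR_conv_of_real)
  then have c2: "c = (\<integral>x. g x \<partial>N)" unfolding c_def using of_real_eq_iff by blast
  have c0: "c \<ge> 0" unfolding c_def by (intro integral_nonneg_AE) (simp add: f0)
  \<comment> \<open>Stated over a fresh type, because it is instantiated with both sides, which live
    on different spaces.\<close>
  have key: "real_distribution (distr (density M (\<lambda>x. f x / c)) borel X) \<and>
        (\<forall>s. char (distr (density M (\<lambda>x. f x / c)) borel X) s = (\<integral>x. f x *\<^sub>R cis (s * X x) \<partial>M) / c) \<and>
        measure (distr (density M (\<lambda>x. f x / c)) borel X) B = (\<integral>x. f x * indicator B (X x) \<partial>M) / c"
    if "prob_space M" and [measurable]: "f \<in> borel_measurable M" "X \<in> borel_measurable M"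
      and "\<And>x. 0 \<le> f x" "integrable M f" "c = (\<integral>x. f x \<partial>M)" "c > 0"
    for M :: "'c measure" and f X :: "'c \<Rightarrow> real"
  proof -
    have p: "prob_space (density M (\<lambda>x. f x / c))"
    proof (rule prob_spaceI)
      have "emeasure (density M (\<lambda>x. f x / c)) (space (density M (\<lambda>x. f x / c))) = (\<integral>\<^sup>+x. f x / c \<partial>M)"
        by (auto simp: emeasure_density intro!: nn_integral_cong)
      also have "\<dots> = ennreal (\<integral>x. f x / c \<partial>M)"
        by (intro nn_integral_eq_integral) (use that in auto)
      finally show "emeasure (density M (\<lambda>x. f x / c)) (space (density M (\<lambda>x. f x / c))) = 1"
        using that by simp
    qed
    have 1: "real_distribution (distr (density M (\<lambda>x. f x / c)) borel X)"
      by (intro prob_space.real_distribution_distr p) simp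
    have 2: "char (distr (density M (\<lambda>x. f x / c)) borel X) s = (\<integral>x. f x *\<^sub>R cis (s * X x) \<partial>M) / c" for s
    proof -
      have "char (distr (density M (\<lambda>x. f x / c)) borel X) s = (\<integral>x. (f x / c) *\<^sub>R cis (s * X x) \<partial>M)"
        unfolding char_def using that
        by (subst integral_distr) (auto simp: integral_density cis_conv_exp)
      also have "\<dots> = (\<integral>x. (f x *\<^sub>R cis (s * X x)) / of_real c \<partial>M)"
        by (simp add: scaleR_conv_of_real)
      finally show ?thesis by simp
    qed
    have "measure (distr (density M (\<lambda>x. f x / c)) borel X) B
        = (\<integral>x. indicator B x \<partial>(distr (density M (\<lambda>x. f x / c)) borel X))" by simp
    also have "\<dots> = (\<integral>x. (f x / c) *\<^sub>R indicator B (X x) \<partial>M)"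
      using that by (subst integral_distr) (auto simp: integral_density)
    also have "\<dots> = (\<integral>x. f x * indicator B (X x) \<partial>M) / c"
      by simp
    finally show ?thesis using 1 2 by auto
  qed
  show ?thesis
  proof (cases "c = 0")
    case True
    then have "AE x in M. f x = 0" using integral_nonneg_eq_0_iff_AE[OF intf] f0 c_def by auto
    then have 1: "(\<integral>x. f x * indicator B (X x) \<partial>M) = 0"
      by (intro integral_eq_zero_AE) auto
    have "AE x in N. g x = 0" using integral_nonneg_eq_0_iff_AE[OF intg] g0 c2 True by auto
    then have "(\<integral>x. g x * indicator B (Y x) \<partial>N) = 0"
      by (intro integral_eq_zero_AE) auto
    with 1 show ?thesis by simp
  next
    case False
    then have cp: "c > 0" using c0 by simp
    note k1 = key[of M f X, OF M _ _ f0(1) intf c_def cp]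
    note k2 = key[of N g Y, OF N _ _ g0(1) intg c2 cp]
    have "distr (density M (\<lambda>x. f x / c)) borel X = distr (density N (\<lambda>x. g x / c)) borel Y"
      by (rule Levy_uniqueness) (use k1 k2 eq in \<open>auto simp: fun_eq_iff\<close>)
    then show ?thesis using k1 k2 cp by simp
  qed
qed

text \<open>One character is exchanged for an indicator while the other is kept: cos Y and sin Y are
  combinations of \<open>cis (Y x)\<close> and \<open>cis (- Y x)\<close>, so both can be moved into
  the weight, and then s is the only free parameter and uniqueness on the line takes over.\<close>

lemma joint_char_step:
  fixes h :: "('i \<Rightarrow> real) \<Rightarrow> real"
  assumes M: "prob_space M" and N: "prob_space N"
    and [measurable]: "h \<in> borel_measurable M" "X \<in> borel_measurable M" "Y \<in> borel_measurable M"
      "h \<in> borel_measurable N" "X \<in> borel_measurable N" "Y \<in> borel_measurable N"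
    and h: "\<And>x. 0 \<le> h x" "\<And>x. h x \<le> 1"
    and eq: "\<And>s t. (\<integral>x. h x *\<^sub>R cis (s * X x + t * Y x) \<partial>M) = (\<integral>x. h x *\<^sub>R cis (s * X x + t * Y x) \<partial>N)"
    and B [measurable]: "B \<in> sets borel"
  shows "(\<integral>x. (h x * indicator B (X x)) *\<^sub>R cis (Y x) \<partial>M) = (\<integral>x. (h x * indicator B (X x)) *\<^sub>R cis (Y x) \<partial>N)"
proof -
  interpret M: prob_space M by fact
  interpret N: prob_space N by fact
  have intM: "integrable M (\<lambda>x. h x *\<^sub>R cis (s * X x + t * Y x))" for s t
    by (rule M.integrable_const_bound[of _ 1]) (use h in auto)
  have intN: "integrable N (\<lambda>x. h x *\<^sub>R cis (s * X x + t * Y x))" for s t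
    by (rule N.integrable_const_bound[of _ 1]) (use h in auto)
  have base: "(\<integral>x. h x *\<^sub>R cis (s * X x) \<partial>M) = (\<integral>x. h x *\<^sub>R cis (s * X x) \<partial>N)" for s
    using eq[of s 0] by simp
  have e1: "(\<integral>x. (h x * cos (Y x)) *\<^sub>R cis (s * X x) \<partial>M) = (\<integral>x. (h x * cos (Y x)) *\<^sub>R cis (s * X x) \<partial>N)" for s
  proof -
    have *: "(h x * cos (Y x)) *\<^sub>R cis (s * X x) = (h x *\<^sub>R cis (s * X x + 1 * Y x) + h x *\<^sub>R cis (s * X x + (-1) * Y x)) / 2" for x
      by (simp add: complex_eq_iff cos_add cos_diff sin_add sin_diff field_simps)
    show ?thesis unfolding * using eq[of s 1] eq[of s "-1"] intM[of s 1] intM[of s "-1"] intN[of s 1] intN[of s "-1"]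
      by simp
  qed
  have e2: "(\<integral>x. (h x * sin (Y x)) *\<^sub>R cis (s * X x) \<partial>M) = (\<integral>x. (h x * sin (Y x)) *\<^sub>R cis (s * X x) \<partial>N)" for s
  proof -
    have *: "(h x * sin (Y x)) *\<^sub>R cis (s * X x) = (- \<i> / 2) * (h x *\<^sub>R cis (s * X x + 1 * Y x) - h x *\<^sub>R cis (s * X x + (-1) * Y x))" for x
      by (simp add: complex_eq_iff cos_add cos_diff sin_add sin_diff field_simps)
    show ?thesis unfolding * using eq[of s 1] eq[of s "-1"] intM[of s 1] intM[of s "-1"] intN[of s 1] intN[of s "-1"]
      by simp
  qed
  have aux: "(\<integral>x. (h x * p (Y x)) * indicator B (X x) \<partial>M) = (\<integral>x. (h x * p (Y x)) * indicator B (X x) \<partial>N)"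
    if e: "\<And>s. (\<integral>x. (h x * p (Y x)) *\<^sub>R cis (s * X x) \<partial>M) = (\<integral>x. (h x * p (Y x)) *\<^sub>R cis (s * X x) \<partial>N)"
      and p: "\<And>y. \<bar>p y\<bar> \<le> 1" and [measurable]: "p \<in> borel_measurable borel" for p :: "real \<Rightarrow> real"
  proof -
    have hp: "\<bar>h x * p (Y x)\<bar> \<le> 1" for x
      using h[of x] p[of "Y x"] by (simp add: abs_mult mult_le_one)
    have iM: "integrable M (\<lambda>x. (h x * p (Y x)) *\<^sub>R cis (s * X x))" for s
      by (rule M.integrable_const_bound[of _ 1]) (use hp in auto)
    have iN: "integrable N (\<lambda>x. (h x * p (Y x)) *\<^sub>R cis (s * X x))" for s
      by (rule N.integrable_const_bound[of _ 1]) (use hp in auto)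
    \<comment> \<open>The shift by 1 makes the weight nonnegative, as the uniqueness theorem for laws requires.\<close>
    have a0: "0 \<le> h x * (1 + p (Y x))" for x using h(1)[of x] p[of "Y x"] by (intro mult_nonneg_nonneg) auto
    have a1: "h x * (1 + p (Y x)) \<le> 2" for x
      using hp[of x] h[of x] by (simp add: algebra_simps)
    have 1: "(\<integral>x. (h x * (1 + p (Y x))) * indicator B (X x) \<partial>M) = (\<integral>x. (h x * (1 + p (Y x))) * indicator B (X x) \<partial>N)"
      by (rule transform_eq_imp_weighted_eq[OF M N, where C=2])
         (use a0 a1 base e intM[of _ 0] intN[of _ 0] iM iN in \<open>auto simp: distrib_left scaleR_left_distrib\<close>)
    have 2: "(\<integral>x. h x * indicator B (X x) \<partial>M) = (\<integral>x. h x * indicator B (X x) \<partial>N)"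
      by (rule transform_eq_imp_weighted_eq[OF M N, where C=1]) (use h base in auto)
    have jM: "integrable M (\<lambda>x. h x * p (Y x) * indicator B (X x))" "integrable M (\<lambda>x. h x * indicator B (X x))"
      by (rule M.integrable_const_bound[of _ 1], use hp h in \<open>auto simp: indicator_def\<close>)+
    have jN: "integrable N (\<lambda>x. h x * p (Y x) * indicator B (X x))" "integrable N (\<lambda>x. h x * indicator B (X x))"
      by (rule N.integrable_const_bound[of _ 1], use hp h in \<open>auto simp: indicator_def\<close>)+
    show ?thesis using 1 2 jM jN by (simp add: distrib_left distrib_right)
  qed
  have c: "(\<integral>x. (h x * cos (Y x)) * indicator B (X x) \<partial>M) = (\<integral>x. (h x * cos (Y x)) * indicator B (X x) \<partial>N)"
    by (rule aux[OF e1]) auto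
  have s: "(\<integral>x. (h x * sin (Y x)) * indicator B (X x) \<partial>M) = (\<integral>x. (h x * sin (Y x)) * indicator B (X x) \<partial>N)"
    by (rule aux[OF e2]) auto
  have iM: "integrable M (\<lambda>x. (h x * indicator B (X x)) *\<^sub>R cis (Y x))"
    by (rule M.integrable_const_bound[of _ 1]) (use h in \<open>auto simp: indicator_def\<close>)
  have iN: "integrable N (\<lambda>x. (h x * indicator B (X x)) *\<^sub>R cis (Y x))"
    by (rule N.integrable_const_bound[of _ 1]) (use h in \<open>auto simp: indicator_def\<close>)
  show ?thesis
    by (rule complex_eqI) (use c s iM iN in \<open>simp_all add: integral_Re[symmetric] integral_Im[symmetric] mult_ac del: integral_Re integral_Im\<close>)
qed

text \<open>Once every coordinate carries an indicator instead of a character, the two integrals are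
  the measures of a box, and boxes generate the product sigma-algebra.\<close>

proposition joint_law_eqI:
  fixes M N :: "('i \<Rightarrow> real) measure"
  assumes I: "finite I" and M: "prob_space M" and N: "prob_space N"
    and sets: "sets M = sets (\<Pi>\<^sub>M i\<in>I. borel)" "sets N = sets (\<Pi>\<^sub>M i\<in>I. borel)"
    and eq: "\<And>t. (\<integral>x. cis (\<Sum>i\<in>I. t i * x i) \<partial>M) = (\<integral>x. cis (\<Sum>i\<in>I. t i * x i) \<partial>N)"
  shows "M = N"
proof -
  interpret M: prob_space M by fact
  interpret N: prob_space N by fact
  have meas: "f \<in> borel_measurable M" "f \<in> borel_measurable N"
    if "f \<in> borel_measurable (\<Pi>\<^sub>M i\<in>I. borel)" for f :: "('i \<Rightarrow> real) \<Rightarrow> 'b::{real_normed_vector,second_countable_topology}"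
    using that sets by (simp_all cong: measurable_cong_sets)
  have space: "space M = (\<Pi>\<^sub>E i\<in>I. UNIV)" "space N = (\<Pi>\<^sub>E i\<in>I. UNIV)"
    using sets[THEN sets_eq_imp_space_eq] by (simp_all add: space_PiM)
  \<comment> \<open>The characters are replaced by indicators one coordinate at a time.\<close>
  have main: "(\<integral>x. (\<Prod>i\<in>J. indicator (B i) (x i)) *\<^sub>R cis (\<Sum>i\<in>I-J. t i * x i) \<partial>M)
      = (\<integral>x. (\<Prod>i\<in>J. indicator (B i) (x i)) *\<^sub>R cis (\<Sum>i\<in>I-J. t i * x i) \<partial>N)"
    if J: "finite J" "J \<subseteq> I" "\<And>i. B i \<in> sets borel" for J t and B :: "'i \<Rightarrow> real set"
    using J
  proof (induction J arbitrary: t rule: finite_induct)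
    case empty
    then show ?case by (simp add: eq)
  next
    case (insert k J)
    note [measurable] = insert.prems(2)
    have ins: "I - J = insert k (I - insert k J)" using insert by auto
    have kI: "k \<in> I" using insert by auto
    have JI: "i \<in> J \<Longrightarrow> i \<in> I" for i using insert.prems by auto
    define Y where "Y x = (\<Sum>i\<in>I - insert k J. t i * x i)" for x :: "'i \<Rightarrow> real"
    have prod01: "0 \<le> (\<Prod>i\<in>J. indicator (B i) (x i) :: real)" "(\<Prod>i\<in>J. indicator (B i) (x i) :: real) \<le> 1" for x :: "'i \<Rightarrow> real"
      by (auto intro!: prod_nonneg prod_le_1 simp: indicator_def)
    have "(\<integral>x. ((\<Prod>i\<in>J. indicator (B i) (x i)) * indicator (B k) (x k)) *\<^sub>R cis (Y x) \<partial>M)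
        = (\<integral>x. ((\<Prod>i\<in>J. indicator (B i) (x i)) * indicator (B k) (x k)) *\<^sub>R cis (Y x) \<partial>N)"
    proof (rule joint_char_step[OF M N])
      show "(\<lambda>x. \<Prod>i\<in>J. indicat_real (B i) (x i)) \<in> borel_measurable M" "(\<lambda>x. \<Prod>i\<in>J. indicat_real (B i) (x i)) \<in> borel_measurable N"
        "(\<lambda>x. x k) \<in> borel_measurable M" "(\<lambda>x. x k) \<in> borel_measurable N" "Y \<in> borel_measurable M" "Y \<in> borel_measurable N"
        unfolding Y_def[abs_def] by (intro meas; use kI JI in measurable)+
      fix s u
      \<comment> \<open>The induction hypothesis holds for every coefficient vector, in particular
        for the one with s at \<open>k\<close> and \<open>u * t i\<close> elsewhere; this supplies
        the two-parameter family that \<open>joint_char_step\<close> asks for.\<close>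
      have *: "s * x k + u * Y x = (\<Sum>i\<in>I - J. (if i = k then s else u * t i) * x i)" for x
        unfolding ins using insert I by (simp add: Y_def sum_distrib_left mult.assoc)
      show "(\<integral>x. (\<Prod>i\<in>J. indicat_real (B i) (x i)) *\<^sub>R cis (s * x k + u * Y x) \<partial>M)
        = (\<integral>x. (\<Prod>i\<in>J. indicat_real (B i) (x i)) *\<^sub>R cis (s * x k + u * Y x) \<partial>N)"
        unfolding * using insert by auto
    qed (use prod01 in auto)
    then show ?case unfolding Y_def using insert by (simp add: mult.commute)
  qed
  show ?thesis
  proof (rule measure_eqI_PiM_finite[OF I sets])
    fix A :: "'i \<Rightarrow> real set" assume A: "\<And>i. i \<in> I \<Longrightarrow> A i \<in> sets borel"
    \<comment> \<open>\<open>main\<close> wants a Borel set at every index, hence the default value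
      off \<open>I\<close>.\<close>
    define B where "B i = (if i \<in> I then A i else {})" for i
    have B: "B i \<in> sets borel" for i using A by (auto simp: B_def)
    have prod: "(\<Prod>i\<in>I. indicator (B i) (x i)) = (indicator (Pi\<^sub>E I A) x :: real)" if "x \<in> Pi\<^sub>E I (\<lambda>_. UNIV)" for x
      using that I by (auto simp: indicator_def B_def PiE_iff prod_eq_1_iff cong: prod.cong) 
    have PA: "Pi\<^sub>E I A \<in> sets (\<Pi>\<^sub>M i\<in>I. borel)" using A I by (intro sets_PiM_I_finite) auto
    have "(\<integral>x. (\<Prod>i\<in>I. indicator (B i) (x i)) *\<^sub>R cis (\<Sum>i\<in>I-I. 0 * x i) \<partial>M)
      = (\<integral>x. (\<Prod>i\<in>I. indicator (B i) (x i)) *\<^sub>R cis (\<Sum>i\<in>I-I. 0 * x i) \<partial>N)"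
      by (rule main) (use I B in auto)
    moreover have "(\<integral>x. (\<Prod>i\<in>I. indicator (B i) (x i)) *\<^sub>R cis (\<Sum>i\<in>I-I. 0 * x i) \<partial>K) = complex_of_real (measure K (Pi\<^sub>E I A))"
      if "space K = (\<Pi>\<^sub>E i\<in>I. UNIV)" "sets K = sets (\<Pi>\<^sub>M i\<in>I. borel)" "prob_space K" for K
    proof -
      have "(\<integral>x. (\<Prod>i\<in>I. indicator (B i) (x i)) *\<^sub>R cis (\<Sum>i\<in>I-I. 0 * x i) \<partial>K) = (\<integral>x. complex_of_real (indicator (Pi\<^sub>E I A) x) \<partial>K)"
        by (intro Bochner_Integration.integral_cong) (auto simp: prod that scaleR_conv_of_real)
      also have "\<dots> = complex_of_real (\<integral>x. indicator (Pi\<^sub>E I A) x \<partial>K)" by simp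
      also have "\<dots> = complex_of_real (measure K (Pi\<^sub>E I A))"
        using PA that Int_absorb2[of "Pi\<^sub>E I A" "Pi\<^sub>E I (\<lambda>_. UNIV)"] by (auto simp: PiE_mono)
      finally show ?thesis .
    qed
    ultimately have "measure M (Pi\<^sub>E I A) = measure N (Pi\<^sub>E I A)" using space sets M N by auto
    then show "emeasure M (Pi\<^sub>E I A) = emeasure N (Pi\<^sub>E I A)"
      by (simp add: M.emeasure_eq_measure N.emeasure_eq_measure)
  next
    show "range (\<lambda>_::nat. \<Pi>\<^sub>E i\<in>I. UNIV) \<subseteq> prod_algebra I (\<lambda>_. borel)"
      using I by (auto intro!: prod_algebraI_finite)
    show "(\<Union>i::nat. \<Pi>\<^sub>E i\<in>I. UNIV) = space (\<Pi>\<^sub>M i\<in>I. (borel :: real measure))" by (simp add: space_PiM)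
  qed auto
qed

abbreviation gauss_space :: "'m set \<Rightarrow> ('m \<Rightarrow> real) measure" where
  "gauss_space M \<equiv> \<Pi>\<^sub>M m\<in>M. std_normal_distribution"

interpretation std_normal: prob_space std_normal_distribution
  by (rule prob_space_normal_density) simp

interpretation std_normal_product: product_sigma_finite "\<lambda>_. std_normal_distribution"
  by standard

lemma prob_space_gauss_space: "prob_space (gauss_space M)"
  by (intro prob_space_PiM std_normal.prob_space_axioms)

text \<open>The characteristic function of A z at t is exp (- |A^T t|^2 / 2), and |A^T t|^2 is the
  quadratic form of the Gram matrix. The two index sets of Gaussian coordinates may differ, so a law
  can be computed with whatever number of coordinates is convenient.\<close>

lemma gauss_linear_law_eq:
  fixes A :: "'i \<Rightarrow> 'm \<Rightarrow> real" and B :: "'i \<Rightarrow> 'n \<Rightarrow> real"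
  assumes I: "finite I" "finite M" "finite N"
    and gram: "\<And>i j. i \<in> I \<Longrightarrow> j \<in> I \<Longrightarrow> (\<Sum>m\<in>M. A i m * A j m) = (\<Sum>m\<in>N. B i m * B j m)"
  shows "distr (gauss_space M) (\<Pi>\<^sub>M i\<in>I. borel) (\<lambda>z. \<lambda>i\<in>I. \<Sum>m\<in>M. A i m * z m)
       = distr (gauss_space N) (\<Pi>\<^sub>M i\<in>I. borel) (\<lambda>z. \<lambda>i\<in>I. \<Sum>m\<in>N. B i m * z m)"
proof -
  have char: "(\<integral>x. cis (\<Sum>i\<in>I. t i * x i) \<partial>distr (gauss_space M) (\<Pi>\<^sub>M i\<in>I. borel) (\<lambda>z. \<lambda>i\<in>I. \<Sum>m\<in>M. A i m * z m))
     = exp (- (\<Sum>i\<in>I. \<Sum>j\<in>I. t i * t j * (\<Sum>m\<in>M. A i m * A j m)) / 2)" if M: "finite M" for M and A :: "'i \<Rightarrow> 'k \<Rightarrow> real" and t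
  proof -
    define c where "c m = (\<Sum>i\<in>I. t i * A i m)" for m
    have "(\<integral>x. cis (\<Sum>i\<in>I. t i * x i) \<partial>distr (gauss_space M) (\<Pi>\<^sub>M i\<in>I. borel) (\<lambda>z. \<lambda>i\<in>I. \<Sum>m\<in>M. A i m * z m))
       = (\<integral>z. cis (\<Sum>i\<in>I. t i * (\<Sum>m\<in>M. A i m * z m)) \<partial>gauss_space M)"
      by (subst integral_distr) (auto intro!: measurable_restrict)
    also have "\<dots> = (\<integral>z. (\<Prod>m\<in>M. cis (c m * z m)) \<partial>gauss_space M)"
    proof (intro Bochner_Integration.integral_cong refl)
      fix z
      have "(\<Sum>i\<in>I. t i * (\<Sum>m\<in>M. A i m * z m)) = (\<Sum>m\<in>M. c m * z m)"
        unfolding c_def sum_distrib_left sum_distrib_right by (subst sum.swap) (simp add: mult.assoc)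
      then show "cis (\<Sum>i\<in>I. t i * (\<Sum>m\<in>M. A i m * z m)) = (\<Prod>m\<in>M. cis (c m * z m))"
        using M by (simp add: cis_conv_exp exp_sum sum_distrib_left)
    qed
    also have "\<dots> = (\<Prod>m\<in>M. \<integral>z. cis (c m * z) \<partial>std_normal_distribution)"
      by (rule std_normal_product.product_integral_prod)
         (auto intro!: std_normal.integrable_const_bound[of _ 1] M)
    also have "\<dots> = (\<Prod>m\<in>M. complex_of_real (exp (- (c m)\<^sup>2 / 2)))"
      using char_std_normal_distribution by (simp add: char_def fun_eq_iff cis_conv_exp)
    also have "\<dots> = exp (- (\<Sum>m\<in>M. (c m)\<^sup>2) / 2)"
      using M by (simp add: exp_sum[symmetric] of_real_prod[symmetric] sum_negf sum_divide_distrib del: of_real_prod)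
    also have "(\<Sum>m\<in>M. (c m)\<^sup>2) = (\<Sum>i\<in>I. \<Sum>j\<in>I. t i * t j * (\<Sum>m\<in>M. A i m * A j m))"
      unfolding c_def power2_eq_square sum_product unfolding sum_distrib_left
      by (subst sum.swap, intro sum.cong refl, subst sum.swap) (simp add: mult_ac)
    finally show ?thesis .
  qed
  show ?thesis
  proof (rule joint_law_eqI[OF I(1)])
    fix t :: "'i \<Rightarrow> real"
    show "(\<integral>x. cis (\<Sum>i\<in>I. t i * x i) \<partial>distr (gauss_space M) (\<Pi>\<^sub>M i\<in>I. borel) (\<lambda>z. \<lambda>i\<in>I. \<Sum>m\<in>M. A i m * z m))
      = (\<integral>x. cis (\<Sum>i\<in>I. t i * x i) \<partial>distr (gauss_space N) (\<Pi>\<^sub>M i\<in>I. borel) (\<lambda>z. \<lambda>i\<in>I. \<Sum>m\<in>N. B i m * z m))"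
      unfolding char[OF I(2)] char[OF I(3)] using gram by (simp cong: sum.cong)
  qed (auto intro!: prob_space.prob_space_distr prob_space_gauss_space measurable_restrict)
qed

definition orthant_prob :: "'i set \<Rightarrow> 'm set \<Rightarrow> ('i \<Rightarrow> 'm \<Rightarrow> real) \<Rightarrow> real" where
  "orthant_prob I M A = measure (gauss_space M) {z \<in> space (gauss_space M). \<forall>i\<in>I. (\<Sum>m\<in>M. A i m * z m) \<le> 0}"

text \<open>The sets \<open>C i\<close> are kept general for three uses: \<open>{..0}\<close> for
  orthants, the signed half-lines of \<open>gfun\<close>, and \<open>{0}\<close> for the null sets
  behind the continuity of orthant probabilities.\<close>

lemma measure_linear_law:
  assumes "finite I" "\<And>i. i \<in> I \<Longrightarrow> C i \<in> sets borel"
  shows "measure (distr (gauss_space M) (\<Pi>\<^sub>M i\<in>I. borel) (\<lambda>z. \<lambda>i\<in>I. \<Sum>m\<in>M. A i m * z m)) {x \<in> space (\<Pi>\<^sub>M i\<in>I. borel). \<forall>i\<in>I. x i \<in> C i}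
    = measure (gauss_space M) {z \<in> space (gauss_space M). \<forall>i\<in>I. (\<Sum>m\<in>M. A i m * z m) \<in> C i}"
proof (subst measure_distr)
  have "{x \<in> space (\<Pi>\<^sub>M i\<in>I. borel). \<forall>i\<in>I. x i \<in> C i} = (\<Pi>\<^sub>E i\<in>I. C i)"
    by (auto simp: space_PiM PiE_iff extensional_def)
  then show "{x \<in> space (\<Pi>\<^sub>M i\<in>I. borel). \<forall>i\<in>I. x i \<in> C i} \<in> sets (\<Pi>\<^sub>M i\<in>I. borel)"
    using assms by (auto intro!: sets_PiM_I_finite)
qed (auto intro!: measurable_restrict arg_cong[where f="measure _"] simp: space_PiM)

lemma orthant_prob_eq:
  fixes A :: "'i \<Rightarrow> 'm \<Rightarrow> real" and B :: "'i \<Rightarrow> 'n \<Rightarrow> real"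
  assumes I: "finite I" "finite M" "finite N"
    and gram: "\<And>i j. i \<in> I \<Longrightarrow> j \<in> I \<Longrightarrow> (\<Sum>m\<in>M. A i m * A j m) = (\<Sum>m\<in>N. B i m * B j m)"
  shows "orthant_prob I M A = orthant_prob I N B"
  using measure_linear_law[OF I(1), of "\<lambda>_. {..0}" M A] measure_linear_law[OF I(1), of "\<lambda>_. {..0}" N B]
    gauss_linear_law_eq[OF assms] by (simp add: orthant_prob_def)

section \<open>Orthant probabilities\<close>

text \<open>The definite description in \<open>centered_gaussian\<close> denotes something only
  because all roots of \<Sigma> yield the same law; any root may then be used to compute it.\<close>

lemma centered_gaussian_eq:
  assumes I: "finite I" and A: "\<And>i j. i \<in> I \<Longrightarrow> j \<in> I \<Longrightarrow> (\<Sum>m\<in>I. A i m * A j m) = \<Sigma> i j"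
  shows "centered_gaussian I \<Sigma> = distr (gauss_space I) (\<Pi>\<^sub>M i\<in>I. borel) (\<lambda>z. \<lambda>i\<in>I. \<Sum>m\<in>I. A i m * z m)"
  unfolding centered_gaussian_def
proof (rule the_equality)
  show "is_centered_gaussian I \<Sigma> (distr (gauss_space I) (\<Pi>\<^sub>M i\<in>I. borel) (\<lambda>z. \<lambda>i\<in>I. \<Sum>m\<in>I. A i m * z m))"
    unfolding is_centered_gaussian_def using A by blast
  fix N assume "is_centered_gaussian I \<Sigma> N"
  then obtain B where B: "\<And>i j. i \<in> I \<Longrightarrow> j \<in> I \<Longrightarrow> (\<Sum>m\<in>I. B i m * B j m) = \<Sigma> i j"
    and N: "N = distr (gauss_space I) (\<Pi>\<^sub>M i\<in>I. borel) (\<lambda>z. \<lambda>i\<in>I. \<Sum>m\<in>I. B i m * z m)"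
    unfolding is_centered_gaussian_def by blast
  show "N = distr (gauss_space I) (\<Pi>\<^sub>M i\<in>I. borel) (\<lambda>z. \<lambda>i\<in>I. \<Sum>m\<in>I. A i m * z m)"
    unfolding N by (rule gauss_linear_law_eq) (simp_all add: I A B)
qed

lemma gfun_eq_orthant_prob:
  assumes "g_params l lam eps"
    and A: "\<And>i j. i \<in> {1..l} \<Longrightarrow> j \<in> {1..l} \<Longrightarrow> (\<Sum>m=1..l. A i m * A j m) = g_cov lam i j"
  shows "gfun l lam eps = orthant_prob {1..l} {1..l} (\<lambda>i m. eps i * A i m)"
proof -
  define C where "C i = {x. eps i * x \<le> (0::real)}" for i
  have C: "C i \<in> sets borel" for i unfolding C_def by measurable
  have cg: "centered_gaussian {1..l} (g_cov lam)
      = distr (gauss_space {1..l}) (\<Pi>\<^sub>M i\<in>{1..l}. borel) (\<lambda>z. \<lambda>i\<in>{1..l}. \<Sum>m=1..l. A i m * z m)"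
    by (rule centered_gaussian_eq) (use A in auto)
  show ?thesis
    using assms(1) measure_linear_law[of "{1..l}" C "{1..l}" A] C
    unfolding gfun_def orthant_prob_def cg by (simp add: C_def sum_distrib_left mult.assoc)
qed

section \<open>Solid angles of polyhedral cones as orthant probabilities\<close>

lemma orthonormal_basis_of_SOME:
  assumes "subspace L"
  shows "orthonormal_basis_of L (SOME B. orthonormal_basis_of L B)"
proof -
  obtain B where "B \<subseteq> L" "pairwise orthogonal B" "\<And>x. x \<in> B \<Longrightarrow> norm x = 1" "span B = L"
    using orthonormal_basis_subspace[OF assms] by metis
  then have "orthonormal_basis_of L B" by (auto simp: orthonormal_basis_of_def)
  then show ?thesis by (rule someI)
qed

lemma finite_orthonormal_basis_of:
  assumes "orthonormal_basis_of L B"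
  shows "finite B"
proof -
  have "0 \<notin> B" "pairwise orthogonal B" using assms by (auto simp: orthonormal_basis_of_def)
  then show ?thesis using pairwise_orthogonal_independent independent_imp_finite by blast
qed

lemma orthonormal_basis_of_inner:
  assumes B: "orthonormal_basis_of L B" and v: "v \<in> L"
  shows "(\<Sum>b\<in>B. (b \<bullet> v) * (b \<bullet> w)) = v \<bullet> w"
proof -
  have "(\<Sum>b\<in>B. (v \<bullet> b) *\<^sub>R b) = v"
    by (rule orthonormal_basis_expand) (use B v finite_orthonormal_basis_of[OF B] in \<open>auto simp: orthonormal_basis_of_def\<close>)
  then have "v \<bullet> w = (\<Sum>b\<in>B. (v \<bullet> b) *\<^sub>R b) \<bullet> w" by simp
  also have "\<dots> = (\<Sum>b\<in>B. (b \<bullet> v) * (b \<bullet> w))" by (simp add: inner_sum_left inner_commute[of v])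
  finally show ?thesis by simp
qed

text \<open>\<open>solid_angle\<close> uses the Gaussian law on the span of the cone, so this span
  has to be identified. A strictly feasible direction r suffices: v + t r lies in the cone for large
  t, and v = (v + t r) - t r.\<close>

lemma span_polyhedral_cone:
  fixes L :: "'a::euclidean_space set"
  assumes L: "subspace L" and I: "finite I" and r: "r \<in> L" "\<And>i. i \<in> I \<Longrightarrow> r \<bullet> w i < 0"
  shows "span {v \<in> L. \<forall>i\<in>I. v \<bullet> w i \<le> 0} = L" (is "span ?C = L")
proof
  show "span ?C \<subseteq> L" by (rule span_minimal) (use L in auto)
  show "L \<subseteq> span ?C"
  proof
    fix v assume v: "v \<in> L"
    \<comment> \<open>A sum of nonnegative terms bounds each of them, so one t serves all
      constraints.\<close>
    define t where "t = (\<Sum>i\<in>I. \<bar>v \<bullet> w i\<bar> / - (r \<bullet> w i))"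
    have "(v + t *\<^sub>R r) \<bullet> w i \<le> 0" if i: "i \<in> I" for i
    proof -
      have "\<bar>v \<bullet> w i\<bar> / - (r \<bullet> w i) \<le> t"
        unfolding t_def by (rule member_le_sum) (use I i r in \<open>auto intro!: divide_nonneg_pos simp del: divide_minus_right\<close>)
      then have "\<bar>v \<bullet> w i\<bar> \<le> t * - (r \<bullet> w i)" using r(2)[OF i] by (simp add: pos_divide_le_eq del: divide_minus_right mult_minus_right)
      then show ?thesis by (simp add: inner_add_left)
    qed
    then have "v + t *\<^sub>R r \<in> ?C" using v r L by (auto intro: subspace_add subspace_mul)
    moreover have "r \<in> ?C" using r by (auto intro: less_imp_le)
    ultimately have "(v + t *\<^sub>R r) - t *\<^sub>R r \<in> span ?C" by (intro span_diff span_mul span_base)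
    then show "v \<in> span ?C" by simp
  qed
qed

text \<open>In an orthonormal basis B of L the constraints read
  \<open>(\<Sum>b\<in>B. (b \<bullet> w i) * z b) \<le> 0\<close>. Since the w_i lie in L, Parseval
  shows that this matrix has the Gram matrix of the w_i, whatever basis was chosen, and it can be
  replaced by any \<open>A\<close> with the same Gram matrix.\<close>

lemma solid_angle_polyhedral_cone:
  fixes L :: "'a::euclidean_space set"
  assumes L: "subspace L" and I: "finite I" "finite M" and w: "\<And>i. i \<in> I \<Longrightarrow> w i \<in> L"
    and r: "r \<in> L" "\<And>i. i \<in> I \<Longrightarrow> r \<bullet> w i < 0"
    and A: "\<And>i j. i \<in> I \<Longrightarrow> j \<in> I \<Longrightarrow> (\<Sum>m\<in>M. A i m * A j m) = w i \<bullet> w j"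
  shows "solid_angle {v \<in> L. \<forall>i\<in>I. v \<bullet> w i \<le> 0} = orthant_prob I M A"
proof -
  let ?C = "{v \<in> L. \<forall>i\<in>I. v \<bullet> w i \<le> 0}"
  define B where "B = (SOME B. orthonormal_basis_of L B)"
  have B: "orthonormal_basis_of L B" unfolding B_def by (rule orthonormal_basis_of_SOME[OF L])
  have finB: "finite B" using finite_orthonormal_basis_of[OF B] .
  have BL: "(\<Sum>b\<in>B. x b *\<^sub>R b) \<in> L" for x
    using B L by (intro subspace_sum subspace_mul) (auto simp: orthonormal_basis_of_def)
  have "?C = L \<inter> (\<Inter>i\<in>I. {v. w i \<bullet> v \<le> 0})" by (auto simp: inner_commute)
  then have "closed ?C" using closed_subspace[OF L] by (auto intro!: closed_Int closed_INT closed_halfspace_le)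
  then have C: "?C \<in> sets borel" by auto
  have span: "span ?C = L" by (rule span_polyhedral_cone[OF L I(1) r])
  have "solid_angle ?C = measure (distr (gauss_space B) borel (\<lambda>x. \<Sum>b\<in>B. x b *\<^sub>R b)) ?C"
    unfolding solid_angle_def span standard_gaussian_on_def Let_def B_def ..
  also have "\<dots> = measure (gauss_space B) ((\<lambda>x. \<Sum>b\<in>B. x b *\<^sub>R b) -` ?C \<inter> space (gauss_space B))"
    using C by (intro measure_distr) auto
  also have "(\<lambda>x. \<Sum>b\<in>B. x b *\<^sub>R b) -` ?C \<inter> space (gauss_space B)
     = {z \<in> space (gauss_space B). \<forall>i\<in>I. (\<Sum>b\<in>B. (b \<bullet> w i) * z b) \<le> 0}"
    using BL by (auto simp: inner_sum_left mult.commute)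
  also have "measure (gauss_space B) \<dots> = orthant_prob I B (\<lambda>i b. b \<bullet> w i)" by (simp add: orthant_prob_def)
  also have "\<dots> = orthant_prob I M A"
    by (rule orthant_prob_eq) (use I finB A orthonormal_basis_of_inner[OF B w] in auto)
  finally show ?thesis .
qed

section \<open>Continuity of orthant probabilities in the matrix\<close>

text \<open>A nonzero linear form of the Gaussian vector has the law of q times one standard normal
  variable with q^2 = sum of a_m^2 > 0, and such a law has no atoms.\<close>

lemma AE_gauss_linear_neq_0:
  assumes M: "finite M" and m: "m0 \<in> M" "a m0 \<noteq> (0::real)"
  shows "AE z in gauss_space M. (\<Sum>m\<in>M. a m * z m) \<noteq> 0"
proof -
  interpret prob_space "gauss_space M" by (rule prob_space_gauss_space)
  define q where "q = sqrt (\<Sum>m\<in>M. (a m)\<^sup>2)"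
  have "(\<Sum>m\<in>M. (a m)\<^sup>2) \<noteq> 0" using M m by (auto simp: sum_nonneg_eq_0_iff)
  then have q: "q \<noteq> 0" and q2: "q * q = (\<Sum>m\<in>M. a m * a m)"
    by (auto simp: q_def power2_eq_square sum_nonneg)
  \<comment> \<open>The scalar case is run through the joint-law lemma with the one-element index
    set \<open>{()}\<close>.\<close>
  have law: "distr (gauss_space M) (\<Pi>\<^sub>M i\<in>{()}. borel) (\<lambda>z. \<lambda>i\<in>{()}. \<Sum>m\<in>M. a m * z m)
     = distr (gauss_space {()}) (\<Pi>\<^sub>M i\<in>{()}. borel) (\<lambda>z. \<lambda>i\<in>{()}. \<Sum>m\<in>{()}. q * z m)"
    by (rule gauss_linear_law_eq) (use M q2 in auto)
  have "{z \<in> space (gauss_space {()}). z () = 0} = (\<Pi>\<^sub>E i\<in>{()}. {0})"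
    by (auto simp: space_PiM PiE_iff)
  then have "emeasure (gauss_space {()}) {z \<in> space (gauss_space {()}). z () = 0} = (\<Prod>i\<in>{()}. emeasure std_normal_distribution {0})"
    by (simp only:) (rule std_normal_product.emeasure_PiM, auto)
  also have "\<dots> = 0" by (simp add: emeasure_density nn_integral_indicator_singleton)
  finally have 0: "measure (gauss_space {()}) {z \<in> space (gauss_space {()}). z () = 0} = 0"
    by (simp add: measure_def)
  have "prob {z \<in> space (gauss_space M). (\<Sum>m\<in>M. a m * z m) = 0} = 0"
    using measure_linear_law[of "{()}" "\<lambda>_. {0}" M "\<lambda>_. a"] measure_linear_law[of "{()}" "\<lambda>_. {0}" "{()}" "\<lambda>_ _. q"] law 0 q
    by simp
  then have "AE z in gauss_space M. z \<notin> {z \<in> space (gauss_space M). (\<Sum>m\<in>M. a m * z m) = 0}"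
    by (subst (asm) prob_eq_0) auto
  then show ?thesis using AE_space by eventually_elim auto
qed

text \<open>For fixed z the indicator of the event is locally constant in the matrix unless some row
  sum vanishes. Rows of \<open>A\<close> are nonzero, so this exception is a null set, and dominated
  convergence gives the limit.\<close>

lemma orthant_prob_LIMSEQ:
  fixes A :: "'i \<Rightarrow> 'm \<Rightarrow> real"
  assumes I: "finite I" "finite M" and lim: "\<And>i m. i \<in> I \<Longrightarrow> m \<in> M \<Longrightarrow> (\<lambda>n. F n i m) \<longlonglongrightarrow> A i m"
    and A: "\<And>i. i \<in> I \<Longrightarrow> \<exists>m\<in>M. A i m \<noteq> 0"
  shows "(\<lambda>n. orthant_prob I M (F n)) \<longlonglongrightarrow> orthant_prob I M A"
proof -
  interpret prob_space "gauss_space M" by (rule prob_space_gauss_space)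
  define E where "E B = {z \<in> space (gauss_space M). \<forall>i\<in>I. (\<Sum>m\<in>M. B i m * z m) \<le> 0}" for B :: "'i \<Rightarrow> 'm \<Rightarrow> real"
  have E: "E B \<in> sets (gauss_space M)" for B unfolding E_def using I by measurable
  have int: "orthant_prob I M B = (\<integral>z. indicat_real (E B) z \<partial>gauss_space M)" for B
    using E[of B] by (simp add: orthant_prob_def E_def)
  have "AE z in gauss_space M. \<forall>i\<in>I. (\<Sum>m\<in>M. A i m * z m) \<noteq> 0"
    using I A AE_gauss_linear_neq_0[OF I(2)] by (intro AE_finite_allI) blast+
  then have ae: "AE z in gauss_space M. (\<lambda>n. indicat_real (E (F n)) z) \<longlonglongrightarrow> indicat_real (E A) z"
  proof eventually_elim
    case (elim z)
    have conv: "(\<lambda>n. \<Sum>m\<in>M. F n i m * z m) \<longlonglongrightarrow> (\<Sum>m\<in>M. A i m * z m)" if "i \<in> I" for i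
      using lim that by (intro tendsto_sum tendsto_mult tendsto_const) auto
    have "eventually (\<lambda>n. ((\<Sum>m\<in>M. F n i m * z m) \<le> 0) = ((\<Sum>m\<in>M. A i m * z m) \<le> 0)) sequentially" if i: "i \<in> I" for i
    proof (cases "(\<Sum>m\<in>M. A i m * z m) < 0")
      case True
      then show ?thesis using order_tendstoD(2)[OF conv[OF i] True] by (auto elim!: eventually_mono)
    next
      case False
      then have "(\<Sum>m\<in>M. A i m * z m) > 0" using elim i by force
      then show ?thesis using order_tendstoD(1)[OF conv[OF i], of 0] by (auto elim!: eventually_mono)
    qed
    then have "eventually (\<lambda>n. \<forall>i\<in>I. ((\<Sum>m\<in>M. F n i m * z m) \<le> 0) = ((\<Sum>m\<in>M. A i m * z m) \<le> 0)) sequentially"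
      using I by (simp add: eventually_ball_finite)
    then have "eventually (\<lambda>n. indicat_real (E (F n)) z = indicat_real (E A) z) sequentially"
      by eventually_elim (auto simp: E_def indicator_def)
    then show ?case by (rule tendsto_eventually)
  qed
  show ?thesis unfolding int
    by (rule integral_dominated_convergence[where w="\<lambda>_. 1"]) (use E ae in auto)
qed

section \<open>An explicit root of the covariance matrix of \<open>gfun\<close>\<close>

lemma orthant_prob_cong:
  assumes "\<And>i m. i \<in> I \<Longrightarrow> m \<in> M \<Longrightarrow> A i m = B i m"
  shows "orthant_prob I M A = orthant_prob I M B"
proof -
  have "(\<Sum>m\<in>M. A i m * z m) = (\<Sum>m\<in>M. B i m * z m)" if "i \<in> I" for i z
    using assms that by (intro sum.cong) auto
  then show ?thesis unfolding orthant_prob_def by (intro arg_cong[where f="measure _"]) auto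
qed

lemma orthant_prob_scale:
  assumes "\<And>i. i \<in> I \<Longrightarrow> c i > 0"
  shows "orthant_prob I M (\<lambda>i m. c i * A i m) = orthant_prob I M A"
proof -
  have "(\<Sum>m\<in>M. c i * A i m * z m) \<le> 0 \<longleftrightarrow> (\<Sum>m\<in>M. A i m * z m) \<le> 0" if "i \<in> I" for i z
    using assms[OF that] by (simp add: mult.assoc sum_distrib_left[symmetric] mult_le_0_iff)
  then show ?thesis unfolding orthant_prob_def by (intro arg_cong[where f="measure _"]) auto
qed

text \<open>For \<open>i, m \<ge> 2\<close> the matrix with entries \<open>\<delta>\<^sub>i\<^sub>m / t\<^sub>i + c t\<^sub>m\<close> is \<open>D (1 + c t t\<^sup>T)\<close> with \<open>D = diag (1 / t\<^sub>i)\<close>; since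
  \<open>(1 + c t t\<^sup>T)\<^sup>2 = 1 + (2 c + c\<^sup>2 |t|\<^sup>2) t t\<^sup>T\<close>, it is an explicit square root of a rank-one perturbation
  of \<open>D\<^sup>2\<close>. The first row and column perform one Cholesky step.\<close>

definition rank_one_root :: "(nat \<Rightarrow> real) \<Rightarrow> real \<Rightarrow> real \<Rightarrow> nat \<Rightarrow> nat \<Rightarrow> real" where
  "rank_one_root t b c i m =
     (if i = 1 then (if m = 1 then 1 else 0)
      else if m = 1 then b else (if i = m then 1 / t i else 0) + c * t m)"

lemma rank_one_root_gram:
  assumes t: "\<And>i. i \<in> {2..l} \<Longrightarrow> t i \<noteq> 0" and ij: "i \<in> {1..l}" "j \<in> {1..l}"
  shows "(\<Sum>m=1..l. rank_one_root t b c i m * rank_one_root t b c j m) =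
    (if i = 1 then (if j = 1 then 1 else b) else if j = 1 then b
     else b\<^sup>2 + (2 * c + c\<^sup>2 * (\<Sum>m=2..l. (t m)\<^sup>2)) + (if i = j then 1 / (t i)\<^sup>2 else 0))"
proof -
  have split: "(\<Sum>m=1..l. f m) = f 1 + (\<Sum>m=2..l. f m)" for f :: "nat \<Rightarrow> real"
    using ij sum.atLeast_Suc_atMost[of 1 l f] by (simp add: numeral_2_eq_2)
  consider "i = 1" | "i \<noteq> 1" "j = 1" | "i \<in> {2..l}" "j \<in> {2..l}" using ij by force
  then show ?thesis
  proof cases
    case 1
    then show ?thesis unfolding split by (auto simp: rank_one_root_def intro!: sum.neutral)
  next
    case 2
    then show ?thesis unfolding split by (auto simp: rank_one_root_def intro!: sum.neutral)
  next
    case 3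
    \<comment> \<open>The product splits into a diagonal term, two cross terms and a quadratic term;
      each cross term is picked up at one index, where it equals c t_i / t_i = c. This is the source
      of 2 c.\<close>
    have "(\<Sum>m=2..l. rank_one_root t b c i m * rank_one_root t b c j m)
      = (\<Sum>m=2..l. (if m = i then (if i = j then 1 / (t i)\<^sup>2 else 0) else 0) + (if m = i then c * t m / t i else 0)
          + (if m = j then c * t m / t j else 0) + c\<^sup>2 * (t m)\<^sup>2)"
      using 3 by (intro sum.cong) (auto simp: rank_one_root_def power2_eq_square algebra_simps)
    also have "\<dots> = (if i = j then 1 / (t i)\<^sup>2 else 0) + c + c + c\<^sup>2 * (\<Sum>m=2..l. (t m)\<^sup>2)"
      using 3 t by (simp add: sum.distrib sum.delta sum_distrib_left)
    finally show ?thesis using 3 unfolding split by (auto simp: rank_one_root_def power2_eq_square)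
  qed
qed

text \<open>This is the root (sqrt (1 + U/x) - 1) / U of the quadratic equation U c^2 + 2 c = 1/x,
  rationalised so that U = 0 is covered. That case occurs for k = d - 1, when the block of rows with
  index at least 2 is empty.\<close>

lemma rank_one_coefficient:
  fixes U x :: real
  assumes "1 + U / x \<ge> 0"
  shows "2 * (1 / x / (1 + sqrt (1 + U / x))) + (1 / x / (1 + sqrt (1 + U / x)))\<^sup>2 * U = 1 / x"
proof -
  define q where "q = 1 / x"
  define r where "r = sqrt (1 + U / x)"
  have r: "r \<ge> 0" "U * q = r\<^sup>2 - 1" using assms by (auto simp: r_def q_def)
  have "2 * (q / (1 + r)) = 2 * q * (1 + r) / (1 + r)\<^sup>2"
    using r(1) by (simp add: power2_eq_square)
  moreover have "(q / (1 + r))\<^sup>2 * U = q * (U * q) / (1 + r)\<^sup>2"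
    by (simp add: power_divide power2_eq_square)
  ultimately have "2 * (q / (1 + r)) + (q / (1 + r))\<^sup>2 * U = (2 * q * (1 + r) + q * (U * q)) / (1 + r)\<^sup>2"
    by (simp add: add_divide_distrib)
  also have "\<dots> = q * (1 + r)\<^sup>2 / (1 + r)\<^sup>2" unfolding r(2) by (simp add: power2_eq_square algebra_simps)
  also have "\<dots> = q" using r(1) by simp
  finally show ?thesis by (simp add: q_def r_def)
qed

text \<open>The number under the root is v = 1/lambda_0 + 1/lambda_1, the variance of eta_1.
  Dividing the first row by sqrt v leaves the orthant probability unchanged and gives that row unit
  length; the price is the entry b, whose size is 1 / (|lambda_0| sqrt v). The rest of the
  covariance is 1/(lambda_0 + lambda_1) plus the diagonal, which fixes c.\<close>

lemma gfun_eq_rank_one_root: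
  fixes t :: "nat \<Rightarrow> real"
  defines "U l \<equiv> (\<Sum>m=2..l. (t m)\<^sup>2)"
  assumes g: "g_params l lam eps"
    and t: "\<And>j. j \<in> {2..l} \<Longrightarrow> t j > 0 \<and> lam j = (t j)\<^sup>2 \<and> eps j = 1"
    and v: "lam 0 \<noteq> 0" "lam 1 \<noteq> 0" "(lam 0 + lam 1) / (lam 0 * lam 1) > 0"
    and U: "1 + U l / (lam 0 + lam 1) \<ge> 0" and l: "l \<ge> 1"
  shows "gfun l lam eps = orthant_prob {1..l} {1..l}
     (rank_one_root t (eps 1 / (lam 0 * sqrt ((lam 0 + lam 1) / (lam 0 * lam 1))))
        (1 / (lam 0 + lam 1) / (1 + sqrt (1 + U l / (lam 0 + lam 1)))))"
    (is "_ = orthant_prob _ _ (rank_one_root t ?b ?c)")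
proof -
  define v where "v = (lam 0 + lam 1) / (lam 0 * lam 1)"
  have v0: "v > 0" using v v_def by simp
  have s0: "lam 0 + lam 1 \<noteq> 0" using v by auto
  have eps: "eps 1 * eps 1 = 1"
  proof -
    have "eps 1 \<in> {1, -1}" using g l by (simp add: g_params_def)
    then show ?thesis by auto
  qed
  have c: "2 * ?c + ?c\<^sup>2 * U l = 1 / (lam 0 + lam 1)" by (rule rank_one_coefficient[OF U])
  have b: "?b = eps 1 / (lam 0 * sqrt v)" by (simp add: v_def)
  have b2: "?b\<^sup>2 = 1 / (lam 0 * lam 0 * v)"
    unfolding b using eps v0 by (simp add: power2_eq_square)
  \<comment> \<open>The Schur complement identity: b^2 is the part of 1/lambda_0 explained by eta_1,
    and 1/(lambda_0 + lambda_1) is what remains.\<close>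
  have b3: "?b\<^sup>2 + 1 / (lam 0 + lam 1) = 1 / lam 0"
  proof -
    have "?b\<^sup>2 + 1 / (lam 0 + lam 1) = lam 1 / (lam 0 * (lam 0 + lam 1)) + lam 0 / (lam 0 * (lam 0 + lam 1))"
      unfolding b2 v_def using v(1,2) by simp
    also have "\<dots> = (lam 0 + lam 1) / (lam 0 * (lam 0 + lam 1))"
      by (simp add: add_divide_distrib)
    finally show ?thesis using s0 by simp
  qed
  \<comment> \<open>The sign sits in the first row of this root of \<open>g_cov lam\<close>, so
    multiplying that row by \<open>eps 1\<close> cancels it there; what survives of the sign is its
    occurrence in b.\<close>
  define A where "A i m = (if i = 1 then eps 1 * sqrt v else 1) * rank_one_root t ?b ?c i m" for i m
  have gram: "(\<Sum>m=1..l. A i m * A j m) = g_cov lam i j" if ij: "i \<in> {1..l}" "j \<in> {1..l}" for i j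
  proof -
    let ?k = "\<lambda>i. if i = 1 then eps 1 * sqrt v else 1"
    have "(\<Sum>m=1..l. A i m * A j m) = ?k i * ?k j * (\<Sum>m=1..l. rank_one_root t ?b ?c i m * rank_one_root t ?b ?c j m)"
      unfolding A_def sum_distrib_left by (intro sum.cong) (simp_all add: mult_ac)
    also have "(\<Sum>m=1..l. rank_one_root t ?b ?c i m * rank_one_root t ?b ?c j m)
       = (if i = 1 then (if j = 1 then 1 else ?b) else if j = 1 then ?b
          else ?b\<^sup>2 + 1 / (lam 0 + lam 1) + (if i = j then 1 / (t i)\<^sup>2 else 0))"
      using rank_one_root_gram[where l=l and t=t and i=i and j=j and b="?b" and c="?c"] ij t c unfolding U_def by fastforce
    also have "?k i * ?k j * \<dots> = g_cov lam i j"
    proof -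
      have *: "(eps 1 * sqrt v) * (eps 1 * sqrt v) = 1 / lam 0 + 1 / lam 1"
      proof -
        have "(eps 1 * sqrt v) * (eps 1 * sqrt v) = v" using eps v0 by (simp add: algebra_simps flip: mult.assoc)
        also have "v = 1 / lam 0 + 1 / lam 1" unfolding v_def using v by (simp add: field_simps)
        finally show ?thesis .
      qed
      have **: "(eps 1 * sqrt v) * ?b = 1 / lam 0" unfolding b using eps v0 v by (simp add: field_simps)
      show ?thesis unfolding b3 using * ** t ij by (auto simp: g_cov_def)
    qed
    finally show ?thesis .
  qed
  have "gfun l lam eps = orthant_prob {1..l} {1..l} (\<lambda>i m. eps i * A i m)"
    by (rule gfun_eq_orthant_prob[OF g]) (use gram in auto)
  also have "\<dots> = orthant_prob {1..l} {1..l} (\<lambda>i m. (if i = 1 then sqrt v else 1) * rank_one_root t ?b ?c i m)"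
  proof -
    have "eps i * A i m = (if i = 1 then sqrt v else 1) * rank_one_root t ?b ?c i m" if "i \<in> {1..l}" for i m
      unfolding A_def using that t[of i] eps by (auto simp flip: mult.assoc)
    then show ?thesis by (rule orthant_prob_cong)
  qed
  also have "\<dots> = orthant_prob {1..l} {1..l} (rank_one_root t ?b ?c)"
    by (rule orthant_prob_scale) (use v0 in auto)
  finally show ?thesis .
qed

text \<open>With b nonzero the first column has no zero entry, so no row of the limit matrix
  vanishes. Continuity at (b, c) is tested on sequences and then transferred to an arbitrary
  filter.\<close>

lemma rank_one_root_tendsto:
  assumes b: "(f \<longlongrightarrow> b) F" and c: "(g \<longlongrightarrow> c) F" and b0: "b \<noteq> 0" and l: "l \<ge> 1"
  shows "((\<lambda>x. orthant_prob {1..l} {1..l} (rank_one_root t (f x) (g x)))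
           \<longlongrightarrow> orthant_prob {1..l} {1..l} (rank_one_root t b c)) F"
proof -
  let ?P = "\<lambda>p. orthant_prob {1..l} {1..l} (rank_one_root t (fst p) (snd p))"
  have "isCont ?P (b, c)"
    unfolding continuous_at_sequentially
  proof (intro allI impI)
    fix x assume x: "x \<longlonglongrightarrow> (b, c)"
    have "(\<lambda>n. orthant_prob {1..l} {1..l} (rank_one_root t (fst (x n)) (snd (x n)))) \<longlonglongrightarrow> orthant_prob {1..l} {1..l} (rank_one_root t b c)"
    proof (rule orthant_prob_LIMSEQ)
      fix i m
      have "(\<lambda>n. fst (x n)) \<longlonglongrightarrow> b" "(\<lambda>n. snd (x n)) \<longlonglongrightarrow> c" using tendsto_fst[OF x] tendsto_snd[OF x] by auto
      then show "(\<lambda>n. rank_one_root t (fst (x n)) (snd (x n)) i m) \<longlonglongrightarrow> rank_one_root t b c i m"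
        by (auto simp: rank_one_root_def intro!: tendsto_intros)
    next
      fix i assume "i \<in> {1..l}"
      then show "\<exists>m\<in>{1..l}. rank_one_root t b c i m \<noteq> 0"
        using b0 l by (intro bexI[of _ 1]) (auto simp: rank_one_root_def)
    qed auto
    then show "(?P \<circ> x) \<longlonglongrightarrow> ?P (b, c)" by (simp add: o_def)
  qed
  moreover have "((\<lambda>x. (f x, g x)) \<longlongrightarrow> (b, c)) F" using b c by (intro tendsto_Pair)
  ultimately show ?thesis using isCont_tendsto_compose by fastforce
qed

section \<open>The function Phi\<close>

lemma integral_even_half:
  fixes f :: "real \<Rightarrow> real"
  assumes f: "integrable lborel f" and even: "\<And>x. f (- x) = f x"
  shows "(\<integral>x. indicator {0<..} x * f x \<partial>lborel) = (\<integral>x. f x \<partial>lborel) / 2"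
    and "(\<integral>x. indicator {..0} x * f x \<partial>lborel) = (\<integral>x. f x \<partial>lborel) / 2"
proof -
  have [measurable]: "f \<in> borel_measurable borel" using f by auto
  have i: "integrable lborel (\<lambda>x. indicator A x * f x)" if "A \<in> sets borel" for A
    using integrable_mult_indicator[OF _ f, of A] that by simp
  have "(\<integral>x. indicator {0<..} x * f x \<partial>lborel) = (\<integral>x. indicator {0<..} (-x) * f (-x) \<partial>lborel)"
    using lborel_integral_real_affine[of "-1" "\<lambda>x. indicator {0<..} x * f x" 0] by simp
  also have "\<dots> = (\<integral>x. indicator {..0} x * f x \<partial>lborel)"
  proof (rule integral_cong_AE)
    show "AE x in lborel. indicator {0<..} (- x) * f (- x) = indicator {..0} x * f x"
      using AE_lborel_singleton[of 0] by eventually_elim (auto simp: even indicator_def)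
  qed auto
  finally have 1: "(\<integral>x. indicator {0<..} x * f x \<partial>lborel) = (\<integral>x. indicator {..0} x * f x \<partial>lborel)" .
  have "(\<integral>x. f x \<partial>lborel) = (\<integral>x. indicator {0<..} x * f x + indicator {..0} x * f x \<partial>lborel)"
    by (intro Bochner_Integration.integral_cong) (auto simp: indicator_def)
  also have "\<dots> = (\<integral>x. indicator {0<..} x * f x \<partial>lborel) + (\<integral>x. indicator {..0} x * f x \<partial>lborel)"
    by (intro Bochner_Integration.integral_add i) auto
  finally show "(\<integral>x. indicator {0<..} x * f x \<partial>lborel) = (\<integral>x. f x \<partial>lborel) / 2"
    and "(\<integral>x. indicator {..0} x * f x \<partial>lborel) = (\<integral>x. f x \<partial>lborel) / 2" using 1 by auto
qed

lemma integral_std_normal: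
  fixes f :: "real \<Rightarrow> 'a::{banach, second_countable_topology}"
  assumes "f \<in> borel_measurable borel"
  shows "(\<integral>x. f x \<partial>std_normal_distribution) = (\<integral>x. std_normal_density x *\<^sub>R f x \<partial>lborel)"
  using assms by (subst integral_density) auto

lemma integrable_std_normal_cis: "integrable lborel (\<lambda>x. std_normal_density x *\<^sub>R cis (a * x))"
  by (rule Bochner_Integration.integrable_bound[of _ "std_normal_density"])
     (use integrable_normal_density[of 1 0] in auto)

lemma integral_std_normal_cos: "(\<integral>x. std_normal_density x * cos (a * x) \<partial>lborel) = exp (- (a\<^sup>2) / 2)"
proof -
  have "(\<integral>x. std_normal_density x *\<^sub>R cis (a * x) \<partial>lborel) = complex_of_real (exp (- (a\<^sup>2) / 2))"
    using char_std_normal_distribution by (simp add: char_def integral_std_normal[symmetric] fun_eq_iff cis_conv_exp)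
  then have "Re (\<integral>x. std_normal_density x *\<^sub>R cis (a * x) \<partial>lborel) = exp (- (a\<^sup>2) / 2)" by simp
  then show ?thesis using integrable_std_normal_cis[of a] by (simp add: integral_Re[symmetric] del: integral_Re)
qed

lemma integrable_std_normal_cos: "integrable lborel (\<lambda>x. std_normal_density x * cos (a * x))"
  by (rule Bochner_Integration.integrable_bound[of _ "std_normal_density"])
     (use integrable_normal_density[of 1 0] in \<open>auto simp: abs_mult intro!: mult_left_le\<close>)

lemma Phi_0: "Phi 0 = 1 / 2"
  by (simp add: Phi_def)

text \<open>The entire integrand has a global primitive g, so the integral along every segment from
  0 is g z - g 0.\<close>

lemma Phi_has_field_derivative:
  "(Phi has_field_derivative exp (- (z\<^sup>2) / 2) / complex_of_real (sqrt (2 * pi))) (at z)"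
proof -
  have hol: "(\<lambda>x::complex. exp (- (x\<^sup>2) / 2)) holomorphic_on UNIV" by (intro holomorphic_intros) auto
  obtain g where "\<And>x::complex. x \<in> UNIV \<Longrightarrow> (g has_field_derivative exp (- (x\<^sup>2) / 2)) (at x within UNIV)"
    using holomorphic_convex_primitive'[OF _ _ hol] by auto
  then have g: "\<And>x. (g has_field_derivative exp (- (x\<^sup>2) / 2)) (at x)" by simp
  have "contour_integral (linepath 0 w) (\<lambda>x. exp (- (x\<^sup>2) / 2)) = g w - g 0" for w
    using contour_integral_primitive[of UNIV g "\<lambda>x. exp (- (x\<^sup>2) / 2)" "linepath 0 w"] g
    by (intro contour_integral_unique) auto
  then have "Phi = (\<lambda>z. 1/2 + 1 / complex_of_real (sqrt (2 * pi)) * (g z - g 0))"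
    by (simp add: Phi_def fun_eq_iff)
  moreover have "((\<lambda>z. 1/2 + 1 / complex_of_real (sqrt (2 * pi)) * (g z - g 0)) has_field_derivative
      exp (- (z\<^sup>2) / 2) / complex_of_real (sqrt (2 * pi))) (at z)"
    by (rule derivative_eq_intros g refl | simp)+
  ultimately show ?thesis by simp
qed

text \<open>On the horizontal line Im z = -a the exponent is -(x - i a)^2 / 2 = a^2/2 - x^2/2 + i a
  x, so the derivative of \<open>Phi\<close> along it is exp (a^2/2) times the normal density times
  \<open>cis (a * x)\<close>. The fundamental theorem is applied on [-n, r], and n tends to
  infinity.\<close>

lemma Phi_line_LIMSEQ:
  "(\<lambda>n. Phi (of_real r - \<i> * of_real a) - Phi (of_real (- real n) - \<i> * of_real a))
     \<longlonglongrightarrow> exp (a\<^sup>2 / 2) * (\<integral>x. indicator {..r} x *\<^sub>R (std_normal_density x *\<^sub>R cis (a * x)) \<partial>lborel)"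
proof -
  define G where "G x = Phi (of_real x - \<i> * of_real a)" for x :: real
  define g where "g x = complex_of_real (exp (a\<^sup>2 / 2)) * (std_normal_density x *\<^sub>R cis (a * x))" for x
  have G: "(G has_vector_derivative g x) (at x within S)" for x S
  proof -
    have "((\<lambda>x. complex_of_real x - \<i> * of_real a) has_vector_derivative 1) (at x within S)"
      by (auto intro!: derivative_eq_intros)
    from field_vector_diff_chain_within[OF this has_field_derivative_at_within[OF Phi_has_field_derivative]]
    have "(G has_vector_derivative 1 * (exp (- ((of_real x - \<i> * of_real a)\<^sup>2) / 2) / complex_of_real (sqrt (2 * pi)))) (at x within S)"
      unfolding o_def G_def[abs_def] .
    also have "- ((of_real x - \<i> * of_real a)\<^sup>2) / 2 = complex_of_real (a\<^sup>2 / 2) + complex_of_real (- x\<^sup>2 / 2) + \<i> * of_real (a * x)"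
      by (simp add: power2_eq_square algebra_simps add_divide_distrib diff_divide_distrib)
    also have "1 * (exp \<dots> / complex_of_real (sqrt (2 * pi))) = g x"
    proof -
      have "exp (complex_of_real (a\<^sup>2 / 2) + complex_of_real (- x\<^sup>2 / 2) + \<i> * of_real (a * x))
        = complex_of_real (exp (a\<^sup>2 / 2)) * complex_of_real (exp (- x\<^sup>2 / 2)) * cis (a * x)"
        by (simp only: exp_add exp_of_real cis_conv_exp)
      then show ?thesis
        unfolding g_def std_normal_density_def scaleR_conv_of_real
        by (simp only: of_real_mult of_real_divide of_real_1) (simp add: mult.assoc)
    qed
    finally show ?thesis .
  qed
  have contg: "continuous_on S g" for S
    unfolding g_def std_normal_density_def by (intro continuous_intros) auto
  have intg: "integrable lborel g" unfolding g_def by (intro integrable_mult_right integrable_std_normal_cis)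
  have [measurable]: "g \<in> borel_measurable borel" using intg by auto
  have "(\<lambda>n. \<integral>x. indicator {- real n..r} x *\<^sub>R g x \<partial>lborel) \<longlonglongrightarrow> (\<integral>x. indicator {..r} x *\<^sub>R g x \<partial>lborel)"
  proof (rule integral_dominated_convergence[where w="\<lambda>x. norm (g x)"])
    show "AE x in lborel. (\<lambda>n. indicat_real {- real n..r} x *\<^sub>R g x) \<longlonglongrightarrow> indicat_real {..r} x *\<^sub>R g x"
    proof (intro AE_I2 tendsto_eventually)
      fix x :: real
      obtain N where "- x \<le> real N" using real_arch_simple by blast
      then have "eventually (\<lambda>n. - x \<le> real n) sequentially"
        by (intro eventually_sequentiallyI[of N]) auto
      then show "eventually (\<lambda>n. indicat_real {- real n..r} x *\<^sub>R g x = indicat_real {..r} x *\<^sub>R g x) sequentially"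
        by eventually_elim (auto simp: indicator_def)
    qed
  qed (use intg in \<open>auto simp: indicator_def\<close>)
  moreover have "eventually (\<lambda>n. (\<integral>x. indicator {- real n..r} x *\<^sub>R g x \<partial>lborel) = G r - G (- real n)) sequentially"
  proof -
    obtain N where "- r \<le> real N" using real_arch_simple by blast
    then have "eventually (\<lambda>n. - r \<le> real n) sequentially"
      by (intro eventually_sequentiallyI[of N]) auto
    then show ?thesis
      by eventually_elim (intro integral_FTC_Icc G contg, auto)
  qed
  ultimately have "(\<lambda>n. G r - G (- real n)) \<longlonglongrightarrow> (\<integral>x. indicator {..r} x *\<^sub>R g x \<partial>lborel)"
    by (rule Lim_transform_eventually)
  also have "(\<integral>x. indicator {..r} x *\<^sub>R g x \<partial>lborel) = exp ((complex_of_real a)\<^sup>2 / 2) * (\<integral>x. indicator {..r} x *\<^sub>R (std_normal_density x *\<^sub>R cis (a * x)) \<partial>lborel)"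
    unfolding g_def by (simp flip: integral_mult_right_zero exp_of_real)
  finally show ?thesis unfolding G_def .
qed

text \<open>On the real axis this is the normalisation \<open>Phi 0 = 1/2\<close> together with the
  symmetry of the density. The line Im z = -a is reached along the vertical segment at Re z = -n,
  where the derivative of \<open>Phi\<close> is at most exp ((a^2 - n^2) / 2).\<close>

lemma Phi_at_left_LIMSEQ: "(\<lambda>n. Phi (of_real (- real n) - \<i> * of_real a)) \<longlonglongrightarrow> 0"
proof -
  have "(\<integral>x. indicator {..0} x *\<^sub>R (std_normal_density x *\<^sub>R cis (0 * x)) \<partial>lborel) = complex_of_real (\<integral>x. indicator {..0} x * std_normal_density x \<partial>lborel)"
    by (subst integral_complex_of_real[symmetric]) (simp add: scaleR_conv_of_real)
  also have "(\<integral>x. indicator {..0} x * std_normal_density x \<partial>lborel) = 1 / 2"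
    by (subst integral_even_half(2)) (auto simp: integral_normal_density normal_density_def)
  finally have half: "(\<integral>x. indicator {..0} x *\<^sub>R (std_normal_density x *\<^sub>R cis (0 * x)) \<partial>lborel) = 1 / 2" by simp
  have "(\<lambda>n. 1 / 2 - Phi (of_real (- real n))) \<longlonglongrightarrow> 1 / 2"
    using Phi_line_LIMSEQ[of 0 0] unfolding half by (simp add: Phi_0)
  from tendsto_diff[OF tendsto_const[of "1/2"] this] have 0: "(\<lambda>n. Phi (of_real (- real n))) \<longlonglongrightarrow> 0" by simp
  have bound: "norm (Phi (of_real (- real n) - \<i> * of_real a) - Phi (of_real (- real n))) \<le> exp ((a\<^sup>2 - (real n)\<^sup>2) / 2) * \<bar>a\<bar>" for n
  proof -
    let ?S = "closed_segment (of_real (- real n) - \<i> * of_real a) (complex_of_real (- real n))"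
    have "norm (exp (- (z\<^sup>2) / 2) / complex_of_real (sqrt (2 * pi))) \<le> exp ((a\<^sup>2 - (real n)\<^sup>2) / 2)" if "z \<in> ?S" for z
    proof -
      from that obtain u where u: "0 \<le> u" "u \<le> 1" and z: "z = (1 - u) *\<^sub>R (of_real (- real n) - \<i> * of_real a) + u *\<^sub>R complex_of_real (- real n)"
        by (auto simp: in_segment)
      have "Re z = - real n" "Im z = - (1 - u) * a" unfolding z by (simp_all add: algebra_simps)
      moreover have "((1 - u) * a)\<^sup>2 \<le> a\<^sup>2"
        unfolding power_mult_distrib using u by (intro mult_left_le_one_le) (auto simp: power_le_one)
      moreover have "Re (- (z\<^sup>2) / 2) = ((Im z)\<^sup>2 - (Re z)\<^sup>2) / 2" by (simp add: Re_power2 field_simps)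
      ultimately have 1: "norm (exp (- (z\<^sup>2) / 2)) \<le> exp ((a\<^sup>2 - (real n)\<^sup>2) / 2)"
        unfolding norm_exp_eq_Re by (simp add: power_mult_distrib power2_commute[of u 1])
      have 2: "norm (exp (- (z\<^sup>2) / 2)) / sqrt (2 * pi) \<le> norm (exp (- (z\<^sup>2) / 2)) / 1"
        using pi_gt3 by (intro divide_left_mono) auto
      show ?thesis using order_trans[OF 2[unfolded div_by_1] 1] by (simp add: norm_divide)
    qed
    then have "norm (Phi (of_real (- real n) - \<i> * of_real a) - Phi (of_real (- real n)))
       \<le> exp ((a\<^sup>2 - (real n)\<^sup>2) / 2) * norm ((of_real (- real n) - \<i> * of_real a) - complex_of_real (- real n))"
      by (intro field_differentiable_bound[where S="?S" and f=Phi])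
         (auto intro: has_field_derivative_at_within[OF Phi_has_field_derivative])
    then show ?thesis by (simp add: norm_mult)
  qed
  have "(\<lambda>n. exp (- ((real n)\<^sup>2) / 2)) \<longlonglongrightarrow> 0" by real_asymp
  moreover have split: "exp ((a\<^sup>2 - (real n)\<^sup>2) / 2) = exp (a\<^sup>2 / 2) * exp (- ((real n)\<^sup>2) / 2)" for n
    unfolding exp_add[symmetric] by (simp add: diff_divide_distrib)
  ultimately have "(\<lambda>n. exp (a\<^sup>2 / 2) * exp (- ((real n)\<^sup>2) / 2) * \<bar>a\<bar>) \<longlonglongrightarrow> exp (a\<^sup>2 / 2) * 0 * \<bar>a\<bar>"
    by (intro tendsto_intros)
  then have "(\<lambda>n. exp ((a\<^sup>2 - (real n)\<^sup>2) / 2) * \<bar>a\<bar>) \<longlonglongrightarrow> 0"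
    unfolding split by simp
  then have "(\<lambda>n. Phi (of_real (- real n) - \<i> * of_real a) - Phi (of_real (- real n))) \<longlonglongrightarrow> 0"
    by (rule Lim_null_comparison[rotated]) (use bound in auto)
  from tendsto_add[OF this 0] show ?thesis by simp
qed

text \<open>The source of both values of \<open>Phi\<close> needed later: a = 0 gives the
  distribution function on the real axis, r = 0 the half-line transform on the imaginary
  axis.\<close>

lemma Phi_eq_integral:
  "Phi (of_real r - \<i> * of_real a) = exp (a\<^sup>2 / 2) * (\<integral>x. indicator {..r} x *\<^sub>R cis (a * x) \<partial>std_normal_distribution)"
proof -
  have "(\<lambda>n. Phi (of_real r - \<i> * of_real a) - Phi (of_real (- real n) - \<i> * of_real a)) \<longlonglongrightarrow> Phi (of_real r - \<i> * of_real a) - 0"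
    by (intro tendsto_diff tendsto_const Phi_at_left_LIMSEQ)
  from LIMSEQ_unique[OF this Phi_line_LIMSEQ]
  show ?thesis by (simp add: integral_std_normal mult.commute)
qed

lemma Phi_of_real: "Phi (of_real r) = of_real (measure std_normal_distribution {..r})"
proof -
  have "Phi (of_real r) = (\<integral>x. complex_of_real (indicator {..r} x) \<partial>std_normal_distribution)"
    using Phi_eq_integral[of r 0] by (simp add: scaleR_conv_of_real)
  also have "\<dots> = of_real (measure std_normal_distribution {..r})" by simp
  finally show ?thesis .
qed

lemma Phi_imaginary:
  "(\<integral>x. indicator {..0} x *\<^sub>R cis (a * x) \<partial>std_normal_distribution) = exp (- (a\<^sup>2) / 2) * Phi (- \<i> * of_real a)"
proof -
  have "exp (- (complex_of_real a)\<^sup>2 / 2) * exp ((complex_of_real a)\<^sup>2 / 2) = 1"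
    unfolding exp_add[symmetric] by simp
  then show ?thesis using Phi_eq_integral[of 0 a] by (simp add: mult.assoc[symmetric])
qed

section \<open>Gaussian measures of two kinds of cones\<close>

text \<open>Justifies the two uses of Fubini below, for the sine formula and for the halfspace
  probability.\<close>

lemma (in pair_sigma_finite) integrable_pair_mult_bound:
  fixes F :: "'a \<Rightarrow> real" and G :: "'b \<Rightarrow> real" and f :: "'a \<times> 'b \<Rightarrow> 'c::{banach, second_countable_topology}"
  assumes F: "integrable M1 F" and G: "integrable M2 G" and f: "f \<in> borel_measurable (M1 \<Otimes>\<^sub>M M2)"
    and bound: "\<And>x y. norm (f (x, y)) \<le> \<bar>F x * G y\<bar>"
  shows "integrable (M1 \<Otimes>\<^sub>M M2) f"
proof (rule Bochner_Integration.integrable_bound)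
  have [measurable]: "F \<in> borel_measurable M1" "G \<in> borel_measurable M2" using F G by auto
  show "integrable (M1 \<Otimes>\<^sub>M M2) (\<lambda>p. F (fst p) * G (snd p))"
    by (rule Fubini_integrable) (use F G in \<open>auto simp: abs_mult\<close>)
qed (use f bound in auto)

lemma measure_std_normal: "A \<in> sets borel \<Longrightarrow> measure std_normal_distribution A = (\<integral>x. indicator A x * std_normal_density x \<partial>lborel)"
  using integral_std_normal[of "indicator A :: real \<Rightarrow> real"] by (simp add: mult.commute)

lemma std_normal_density_minus: "std_normal_density (- x) = std_normal_density x"
  by (simp add: normal_density_def)

lemma measure_std_normal_nonpos: "measure std_normal_distribution {..0} = 1 / 2"
  by (subst measure_std_normal, simp, subst integral_even_half(2)) (auto simp: std_normal_density_minus)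

lemma measure_std_normal_atMost_minus:
  assumes "\<rho> \<ge> 0"
  shows "measure std_normal_distribution {..-\<rho>} = 1 / 2 - (\<integral>u. indicator {0..\<rho>} u * std_normal_density u \<partial>lborel)"
proof -
  have "(\<integral>u. indicator {0..\<rho>} u * std_normal_density u \<partial>lborel) = (\<integral>u. indicator {0..\<rho>} (-u) * std_normal_density (-u) \<partial>lborel)"
    using lborel_integral_real_affine[of "-1" "\<lambda>u. indicator {0..\<rho>} u * std_normal_density u" 0] by simp
  also have "\<dots> = (\<integral>u. indicator {-\<rho><..0} u * std_normal_density u \<partial>lborel)"
  proof (rule integral_cong_AE)
    show "AE u in lborel. indicator {0..\<rho>} (-u) * std_normal_density (-u) = indicator {-\<rho><..0} u * std_normal_density u"
      using AE_lborel_singleton[of "-\<rho>"] by eventually_elim (auto simp: indicator_def std_normal_density_minus)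
  qed auto
  finally have 1: "(\<integral>u. indicator {0..\<rho>} u * std_normal_density u \<partial>lborel) = measure std_normal_distribution {-\<rho><..0}"
    by (simp add: measure_std_normal)
  have "{..0} = {..-\<rho>} \<union> {-\<rho><..0}" "{..-\<rho>} \<inter> {-\<rho><..0} = {}" using assms by auto
  then have "measure std_normal_distribution {..0} = measure std_normal_distribution {..-\<rho>} + measure std_normal_distribution {-\<rho><..0}"
    using std_normal.finite_measure_Union[of "{..-\<rho>}" "{-\<rho><..0}"] by auto
  then show ?thesis using 1 measure_std_normal_nonpos by simp
qed

lemma gauss_exp_eq: "exp (- (x\<^sup>2) / 2) = sqrt (2 * pi) * std_normal_density x"
  by (simp add: std_normal_density_def)

lemma abs_sin_le: "\<bar>sin x\<bar> \<le> \<bar>x::real\<bar>"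
  using abs_sin_x_le_abs_x by simp

text \<open>Writing sin (t \<rho>) / t as the integral of cos (u t) over u in [0, \<rho>] and
  exchanging integrals leaves half of the cosine transform of exp (- t^2 / 2), which is \<pi> times
  the normal density at u.\<close>

lemma gauss_sine_integral:
  assumes \<rho>: "\<rho> \<ge> 0"
  shows "(\<integral>t. indicator {0<..} t * (exp (- (t\<^sup>2) / 2) * sin (t * \<rho>) / t) \<partial>lborel)
    = pi * (\<integral>u. indicator {0..\<rho>} u * std_normal_density u \<partial>lborel)"
proof -
  define h where "h t u = indicator {0<..} t * exp (- (t\<^sup>2) / 2) * (indicator {0..\<rho>} u * cos (u * t))" for t u :: real
  have int: "integrable (lborel \<Otimes>\<^sub>M lborel) (case_prod h)"
  proof (rule lborel_pair.integrable_pair_mult_bound)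
    show "integrable lborel (\<lambda>t. sqrt (2 * pi) * std_normal_density t)" using integrable_normal_density[of 1 0] by auto
    show "integrable lborel (indicat_real {0..\<rho>})" using \<rho> by (intro integrable_real_indicator) auto
    show "norm (case (t, u) of (t, u) \<Rightarrow> h t u) \<le> \<bar>(sqrt (2 * pi) * std_normal_density t) * indicat_real {0..\<rho>} u\<bar>" for t u
      unfolding gauss_exp_eq[symmetric] h_def by (auto simp: abs_mult indicator_def)
    show "case_prod h \<in> borel_measurable (lborel \<Otimes>\<^sub>M lborel)" unfolding h_def by measurable
  qed
  have "(\<integral>u. h t u \<partial>lborel) = indicator {0<..} t * (exp (- (t\<^sup>2) / 2) * sin (t * \<rho>) / t)" for t
  proof (cases "t > 0")
    case True
    have "(\<integral>u. indicator {0..\<rho>} u *\<^sub>R cos (u * t) \<partial>lborel) = sin (\<rho> * t) / t - sin (0 * t) / t"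
      using True \<rho> by (intro integral_FTC_Icc)
       (auto intro!: derivative_eq_intros continuous_intros simp: has_real_derivative_iff_has_vector_derivative[symmetric])
    then show ?thesis by (simp add: h_def mult.commute)
  qed (simp add: h_def)
  then have "(\<integral>t. indicator {0<..} t * (exp (- (t\<^sup>2) / 2) * sin (t * \<rho>) / t) \<partial>lborel) = (\<integral>t. \<integral>u. h t u \<partial>lborel \<partial>lborel)"
    by simp
  also have "\<dots> = (\<integral>u. \<integral>t. h t u \<partial>lborel \<partial>lborel)" by (rule lborel_pair.Fubini_integral[OF int, symmetric])
  also have "(\<lambda>u. \<integral>t. h t u \<partial>lborel) = (\<lambda>u. pi * (indicator {0..\<rho>} u * std_normal_density u))"
  proof
    fix u
    have "(\<integral>t. h t u \<partial>lborel) = (\<integral>t. sqrt (2 * pi) * indicator {0..\<rho>} u * (indicator {0<..} t * (std_normal_density t * cos (u * t))) \<partial>lborel)"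
      unfolding h_def gauss_exp_eq by (simp add: mult_ac)
    also have "\<dots> = sqrt (2 * pi) * indicator {0..\<rho>} u * (exp (- (u\<^sup>2) / 2) / 2)"
      by (simp add: integral_even_half(1) integrable_std_normal_cos integral_std_normal_cos std_normal_density_minus)
    also have "\<dots> = (sqrt (2 * pi) * sqrt (2 * pi)) / 2 * (indicator {0..\<rho>} u * std_normal_density u)"
      unfolding gauss_exp_eq by simp
    finally show "(\<integral>t. h t u \<partial>lborel) = pi * (indicator {0..\<rho>} u * std_normal_density u)" by simp
  qed
  finally show ?thesis by simp
qed

text \<open>The substitution t = x / s reduces this to the previous integral with \<rho> = -y / s.
  The scale is kept in the exponent because s^2 is later added to the squares a_j^2.\<close>

lemma std_normal_cdf_sine_integral:
  assumes s: "s > 0" and y: "y \<le> 0"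
  shows "measure std_normal_distribution {..y / s}
    = 1 / 2 + 1 / pi * (\<integral>t. indicator {0<..} t * (exp (- (s\<^sup>2 * t\<^sup>2) / 2) * sin (t * y) / t) \<partial>lborel)"
proof -
  define \<rho> where "\<rho> = - (y / s)"
  have \<rho>: "\<rho> \<ge> 0" using s y by (simp add: \<rho>_def divide_nonpos_pos)
  have "(\<integral>t. indicator {0<..} t * (exp (- (s\<^sup>2 * t\<^sup>2) / 2) * sin (t * y) / t) \<partial>lborel)
     = (1 / s) * (\<integral>x. indicator {0<..} (x / s) * (exp (- (s\<^sup>2 * (x / s)\<^sup>2) / 2) * sin ((x / s) * y) / (x / s)) \<partial>lborel)"
    using lborel_integral_real_affine[of "1 / s" "\<lambda>t. indicator {0<..} t * (exp (- (s\<^sup>2 * t\<^sup>2) / 2) * sin (t * y) / t)" 0] s by simp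
  also have "\<dots> = (\<integral>x. (1 / s) * (indicator {0<..} (x / s) * (exp (- (s\<^sup>2 * (x / s)\<^sup>2) / 2) * sin ((x / s) * y) / (x / s))) \<partial>lborel)"
    by (rule integral_mult_right_zero[symmetric])
  also have "\<dots> = (\<integral>x. - (indicator {0<..} x * (exp (- (x\<^sup>2) / 2) * sin (x * \<rho>) / x)) \<partial>lborel)"
    using s by (intro Bochner_Integration.integral_cong) (auto simp: indicator_def \<rho>_def zero_less_divide_iff power_divide)
  also have "\<dots> = - (pi * (\<integral>u. indicator {0..\<rho>} u * std_normal_density u \<partial>lborel))"
    using gauss_sine_integral[OF \<rho>] by simp
  finally show ?thesis using measure_std_normal_atMost_minus[OF \<rho>] by (simp add: \<rho>_def)
qed

lemma integrable_gauss_component: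
  assumes "finite J" "j \<in> J"
  shows "integrable (gauss_space J) (\<lambda>z. z j)"
proof -
  have "integrable std_normal_distribution (\<lambda>x. x)"
    using integrable_std_normal_moment[of 1] by (subst integrable_density) auto
  then have "integrable (gauss_space J) (\<lambda>z. \<Prod>i\<in>J. (if i = j then (\<lambda>x. x) else (\<lambda>_. 1)) (z i))"
    by (intro std_normal_product.product_integrable_prod) (auto simp: assms)
  moreover have "(\<Prod>i\<in>J. (if i = j then (\<lambda>x. x) else (\<lambda>_. 1)) (z i)) = z j" for z :: "'a \<Rightarrow> real"
    using assms by (simp add: if_distrib[of "\<lambda>f. f _"] prod.delta)
  ultimately show ?thesis by simp
qed

text \<open>The integrand is the imaginary part of a product of functions of the single coordinates,
  so the expectation factors, and each factor is given by \<open>Phi_imaginary\<close> at a_j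
  t.\<close>

lemma integral_orthant_sin:
  assumes J: "finite J"
  shows "(\<integral>z. (\<Prod>j\<in>J. indicator {..0} (z j)) * sin (t * (\<Sum>j\<in>J. a j * z j)) \<partial>gauss_space J)
    = exp (- (\<Sum>j\<in>J. (a j)\<^sup>2) * t\<^sup>2 / 2) * Im (\<Prod>j\<in>J. Phi (- \<i> * complex_of_real (a j * t)))"
proof -
  let ?f = "\<lambda>z. \<Prod>j\<in>J. indicator {..0} (z j) *\<^sub>R cis ((a j * t) * z j)"
  have int1: "integrable std_normal_distribution (\<lambda>x. indicator {..0} x *\<^sub>R cis (c * x))" for c
    by (rule std_normal.integrable_const_bound[of _ 1]) (auto simp: indicator_def)
  have int: "integrable (gauss_space J) ?f"
    by (intro std_normal_product.product_integrable_prod int1 J)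
  have Im: "Im (?f z) = (\<Prod>j\<in>J. indicator {..0} (z j)) * sin (t * (\<Sum>j\<in>J. a j * z j))" for z
  proof -
    have "?f z = of_real (\<Prod>j\<in>J. indicator {..0} (z j)) * cis (\<Sum>j\<in>J. (a j * t) * z j)"
      using J by (simp add: scaleR_conv_of_real prod.distrib cis_conv_exp exp_sum sum_distrib_left)
    also have "(\<Sum>j\<in>J. (a j * t) * z j) = t * (\<Sum>j\<in>J. a j * z j)"
      by (simp add: sum_distrib_left mult_ac)
    finally show ?thesis by (simp del: of_real_prod)
  qed
  have "(\<integral>z. ?f z \<partial>gauss_space J) = (\<Prod>j\<in>J. \<integral>x. indicator {..0} x *\<^sub>R cis ((a j * t) * x) \<partial>std_normal_distribution)"
    by (rule std_normal_product.product_integral_prod) (use int1 J in auto)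
  also have "\<dots> = (\<Prod>j\<in>J. complex_of_real (exp (- (a j * t)\<^sup>2 / 2)) * Phi (- \<i> * complex_of_real (a j * t)))"
    by (intro prod.cong refl, subst Phi_imaginary) (simp flip: exp_of_real)
  also have "\<dots> = complex_of_real (\<Prod>j\<in>J. exp (- (a j * t)\<^sup>2 / 2)) * (\<Prod>j\<in>J. Phi (- \<i> * complex_of_real (a j * t)))"
    by (simp only: prod.distrib of_real_prod)
  also have "(\<Prod>j\<in>J. exp (- (a j * t)\<^sup>2 / 2)) = exp (- (\<Sum>j\<in>J. (a j)\<^sup>2) * t\<^sup>2 / 2)"
    using J by (simp add: exp_sum[symmetric] power_mult_distrib sum_negf sum_divide_distrib sum_distrib_right)
  finally have "Im (\<integral>z. ?f z \<partial>gauss_space J) = exp (- (\<Sum>j\<in>J. (a j)\<^sup>2) * t\<^sup>2 / 2) * Im (\<Prod>j\<in>J. Phi (- \<i> * complex_of_real (a j * t)))"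
    by (simp del: integral_Im)
  then show ?thesis using int by (simp add: integral_Im[symmetric] Im del: integral_Im)
qed

text \<open>Given the coordinates in J, the remaining constraint is z_{i0} \<le> Y / s with Y the
  sum of a_j z_j. As a_j > 0, Y is nonpositive on the negative orthant, which is the range of the
  sine formula. Its constant 1/2 contributes 1 / 2^(|J| + 1); in its sine part the z-integral is
  done first, for fixed t.\<close>

proposition gauss_negative_orthant_halfspace:
  fixes a :: "'i \<Rightarrow> real"
  assumes J: "finite J" "i0 \<notin> J" and s: "s > 0" and a: "\<And>j. j \<in> J \<Longrightarrow> a j > 0"
    and S: "S = s\<^sup>2 + (\<Sum>j\<in>J. (a j)\<^sup>2)"
  defines "f \<equiv> (\<lambda>t. exp (- S * t\<^sup>2 / 2) / t * Im (\<Prod>j\<in>J. Phi (- \<i> * complex_of_real (a j * t))))"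
  shows "set_integrable lborel {0<..} f"
    and "measure (gauss_space (insert i0 J))
       {z \<in> space (gauss_space (insert i0 J)). s * z i0 - (\<Sum>j\<in>J. a j * z j) \<le> 0 \<and> (\<forall>j\<in>J. z j \<le> 0)}
     = 1 / 2 ^ (card J + 1) + 1 / pi * (LINT t:{0<..}|lborel. f t)"
proof -
  interpret J: prob_space "gauss_space J" by (rule prob_space_gauss_space)
  interpret IJ: prob_space "gauss_space (insert i0 J)" by (rule prob_space_gauss_space)
  interpret P: pair_sigma_finite "gauss_space J" "lborel :: real measure" by standard
  define Y where "Y z = (\<Sum>j\<in>J. a j * z j)" for z :: "'i \<Rightarrow> real"
  define p where "p z = (\<Prod>j\<in>J. indicator {..0} (z j) :: real)" for z :: "'i \<Rightarrow> real"
  have [measurable]: "Y \<in> borel_measurable (gauss_space J)" unfolding Y_def[abs_def] by measurable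
  have [measurable]: "p \<in> borel_measurable (gauss_space J)" unfolding p_def[abs_def] by measurable
  have p01: "p z = 0 \<or> p z = 1" for z
  proof (cases "\<forall>j\<in>J. z j \<le> 0")
    case False
    then show ?thesis using J by (auto simp: p_def indicator_def prod_zero_iff)
  next
    case True
    then show ?thesis by (simp add: p_def)
  qed
  have p1: "p z = 1 \<longleftrightarrow> (\<forall>j\<in>J. z j \<le> 0)" for z
  proof (cases "\<forall>j\<in>J. z j \<le> 0")
    case False
    then have "p z = 0" using J by (auto simp: p_def indicator_def prod_zero_iff)
    then show ?thesis using False by simp
  next
    case True
    then show ?thesis by (simp add: p_def)
  qed
  have pbound: "\<bar>p z\<bar> \<le> 1" for z using p01[of z] by auto
  define K where "K z t = p z * (indicator {0<..} t * (exp (- (s\<^sup>2 * t\<^sup>2) / 2) * sin (t * Y z) / t))" for z t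
  have intK: "integrable (gauss_space J \<Otimes>\<^sub>M lborel) (case_prod K)"
  proof (rule P.integrable_pair_mult_bound)
    show "integrable (gauss_space J) Y"
      unfolding Y_def[abs_def] using J by (intro Bochner_Integration.integrable_sum integrable_mult_right integrable_gauss_component)
    show "integrable lborel (\<lambda>t. sqrt (2 * pi) * std_normal_density (s * t))"
      using integrable_normal_density[of 1 0] s lborel_integrable_real_affine[of std_normal_density s 0] by auto
    show "case_prod K \<in> borel_measurable (gauss_space J \<Otimes>\<^sub>M lborel)" unfolding K_def[abs_def] by measurable
    fix z t
    \<comment> \<open>|sin (t Y) / t| \<le> |Y| removes the singularity at t = 0, and s > 0 provides
      decay in t, so a product of integrable functions dominates the kernel.\<close>
    have "\<bar>K z t\<bar> \<le> \<bar>Y z\<bar> * exp (- ((s * t)\<^sup>2) / 2)"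
    proof (cases "t > 0")
      case True
      have "\<bar>K z t\<bar> = \<bar>p z\<bar> * (exp (- ((s * t)\<^sup>2) / 2) * (\<bar>sin (t * Y z)\<bar> / t))"
        using True by (simp add: K_def abs_mult power_mult_distrib)
      also have "\<dots> \<le> 1 * (exp (- ((s * t)\<^sup>2) / 2) * (\<bar>t * Y z\<bar> / t))"
        using True by (intro mult_mono mult_left_mono divide_right_mono pbound abs_sin_le) auto
      also have "\<dots> = \<bar>Y z\<bar> * exp (- ((s * t)\<^sup>2) / 2)" using True by (simp add: abs_mult)
      finally show ?thesis .
    qed (auto simp: K_def)
    then show "norm (case (z, t) of (z, t) \<Rightarrow> K z t) \<le> \<bar>Y z * (sqrt (2 * pi) * std_normal_density (s * t))\<bar>"
      unfolding gauss_exp_eq[symmetric] by (simp add: abs_mult)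
  qed
  have Kf: "(\<integral>z. K z t \<partial>gauss_space J) = indicator {0<..} t *\<^sub>R f t" for t
  proof -
    have "(\<integral>z. K z t \<partial>gauss_space J) = (\<integral>z. (indicator {0<..} t * exp (- (s\<^sup>2 * t\<^sup>2) / 2) / t) * (p z * sin (t * Y z)) \<partial>gauss_space J)"
      by (intro Bochner_Integration.integral_cong) (auto simp: K_def)
    also have "\<dots> = (indicator {0<..} t * exp (- (s\<^sup>2 * t\<^sup>2) / 2) / t) * (exp (- (\<Sum>j\<in>J. (a j)\<^sup>2) * t\<^sup>2 / 2) * Im (\<Prod>j\<in>J. Phi (- \<i> * complex_of_real (a j * t))))"
      unfolding p_def Y_def by (subst integral_mult_right_zero, subst integral_orthant_sin[OF J(1)]) (rule refl)
    also have "\<dots> = indicator {0<..} t * (exp (- (s\<^sup>2 * t\<^sup>2) / 2) * exp (- (\<Sum>j\<in>J. (a j)\<^sup>2) * t\<^sup>2 / 2)) / t * Im (\<Prod>j\<in>J. Phi (- \<i> * complex_of_real (a j * t)))"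
      by (simp add: mult_ac)
    also have "exp (- (s\<^sup>2 * t\<^sup>2) / 2) * exp (- (\<Sum>j\<in>J. (a j)\<^sup>2) * t\<^sup>2 / 2) = exp (- S * t\<^sup>2 / 2)"
      unfolding exp_add[symmetric] S by (intro arg_cong[where f=exp]) (simp add: field_simps)
    finally show ?thesis by (simp add: f_def)
  qed
  \<comment> \<open>Integrability of f is a by-product of Fubini, since f is the z-marginal of the
    integrable kernel.\<close>
  show "set_integrable lborel {0<..} f"
    unfolding set_integrable_def using P.integrable_snd[OF intK] by (simp add: Kf)
  define E where "E = {z \<in> space (gauss_space (insert i0 J)). s * z i0 - Y z \<le> 0 \<and> (\<forall>j\<in>J. z j \<le> 0)}"
  have [measurable]: "E \<in> sets (gauss_space (insert i0 J))"
    unfolding E_def Y_def using J by measurable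
  have "measure (gauss_space (insert i0 J)) E = (\<integral>z. indicator E z \<partial>gauss_space (insert i0 J))" by simp
  also have "\<dots> = (\<integral>z. \<integral>y. indicator E (z(i0 := y)) \<partial>std_normal_distribution \<partial>gauss_space J)"
    by (rule std_normal_product.product_integral_insert[OF J])
       (auto intro!: IJ.integrable_const_bound[of _ 1])
  also have "\<dots> = (\<integral>z. p z / 2 + 1 / pi * (\<integral>t. K z t \<partial>lborel) \<partial>gauss_space J)"
  proof (intro Bochner_Integration.integral_cong refl)
    fix z assume z: "z \<in> space (gauss_space J)"
    have Yz: "Y (z(i0 := y)) = Y z" for y unfolding Y_def using J by (intro sum.cong) auto
    have upd: "(\<forall>j\<in>J. (z(i0 := y)) j \<le> 0) \<longleftrightarrow> p z = 1" for y unfolding p1 using J by (intro ball_cong) auto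
    have sp: "z(i0 := y) \<in> space (gauss_space (insert i0 J))" for y
      using z by (auto simp: space_PiM PiE_iff extensional_def)
    have "indicator E (z(i0 := y)) = p z * indicator {..Y z / s} y" for y
      using p01[of z] s sp by (auto simp: E_def Yz upd indicator_def field_simps simp del: fun_upd_apply) (auto simp: field_simps)
    then have "(\<integral>y. indicator E (z(i0 := y)) \<partial>std_normal_distribution) = p z * measure std_normal_distribution {..Y z / s}" by simp
    also have "\<dots> = p z * (1 / 2 + 1 / pi * (\<integral>t. indicator {0<..} t * (exp (- (s\<^sup>2 * t\<^sup>2) / 2) * sin (t * Y z) / t) \<partial>lborel))"
    proof (cases "p z = 0")
      case False
      then have "\<forall>j\<in>J. z j \<le> 0" using p01 p1 by blast
      then have "Y z \<le> 0" unfolding Y_def using a by (intro sum_nonpos) (auto simp: mult_le_0_iff less_imp_le)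
      then show ?thesis using std_normal_cdf_sine_integral[OF s] by simp
    qed simp
    also have "\<dots> = p z / 2 + 1 / pi * (\<integral>t. K z t \<partial>lborel)"
      unfolding K_def integral_mult_right_zero by (simp add: algebra_simps)
    finally show "(\<integral>y. indicator E (z(i0 := y)) \<partial>std_normal_distribution) = p z / 2 + 1 / pi * (\<integral>t. K z t \<partial>lborel)" .
  qed
  also have "\<dots> = (\<integral>z. p z \<partial>gauss_space J) / 2 + 1 / pi * (\<integral>z. \<integral>t. K z t \<partial>lborel \<partial>gauss_space J)"
  proof -
    have "integrable (gauss_space J) p" by (rule J.integrable_const_bound[of _ 1]) (use pbound in auto)
    then show ?thesis using P.integrable_fst[OF intK] by simp
  qed
  also have "(\<integral>z. p z \<partial>gauss_space J) = (\<Prod>j\<in>J. \<integral>x. indicator {..0} x \<partial>std_normal_distribution)"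
    unfolding p_def by (rule std_normal_product.product_integral_prod) (auto simp: J intro!: std_normal.integrable_const_bound[of _ 1])
  also have "\<dots> = (1 / 2) ^ card J" by (simp add: measure_std_normal_nonpos)
  also have "(\<integral>z. \<integral>t. K z t \<partial>lborel \<partial>gauss_space J) = (\<integral>t. \<integral>z. K z t \<partial>gauss_space J \<partial>lborel)"
    by (rule P.Fubini_integral[OF intK, symmetric])
  also have "\<dots> = (LINT t:{0<..}|lborel. f t)"
    unfolding Kf set_lebesgue_integral_def ..
  finally show "measure (gauss_space (insert i0 J))
       {z \<in> space (gauss_space (insert i0 J)). s * z i0 - (\<Sum>j\<in>J. a j * z j) \<le> 0 \<and> (\<forall>j\<in>J. z j \<le> 0)}
     = 1 / 2 ^ (card J + 1) + 1 / pi * (LINT t:{0<..}|lborel. f t)"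
    unfolding E_def Y_def by (simp add: power_one_over)
qed

text \<open>The distribution function is the restriction of the continuous function
  \<open>Phi\<close> to the real axis.\<close>

lemma std_normal_cdf_measurable [measurable]: "(\<lambda>x. measure std_normal_distribution {..x}) \<in> borel_measurable borel"
proof -
  have Phi: "continuous_on UNIV Phi"
    by (rule DERIV_continuous_on[OF has_field_derivative_at_within[OF Phi_has_field_derivative]])
  have "continuous_on UNIV (\<lambda>x. Phi (complex_of_real x))"
    by (rule continuous_on_compose2[OF Phi]) (auto intro: continuous_on_of_real continuous_on_id)
  then have "continuous_on UNIV (\<lambda>x. Re (Phi (complex_of_real x)))" by (rule continuous_on_Re)
  then show ?thesis unfolding Phi_of_real by (auto intro: borel_measurable_continuous_onI)
qed

text \<open>Given z_{i0} = x \<ge> 0 the other constraints are independent, with probabilities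
  \<open>Phi (b j * x)\<close>. The formula is complex because \<open>Phi\<close> is
  complex-valued.\<close>

proposition gauss_wedge:
  fixes b :: "'i \<Rightarrow> real"
  assumes J: "finite J" "i0 \<notin> J"
  defines "f \<equiv> (\<lambda>x. (\<Prod>j\<in>J. Phi (of_real (b j * x))) * complex_of_real (exp (- (x\<^sup>2) / 2)))"
  shows "set_integrable lborel {0<..} f"
    and "complex_of_real (measure (gauss_space (insert i0 J))
       {z \<in> space (gauss_space (insert i0 J)). 0 \<le> z i0 \<and> (\<forall>j\<in>J. z j \<le> b j * z i0)})
     = 1 / complex_of_real (sqrt (2 * pi)) * (LINT x:{0<..}|lborel. f x)"
proof -
  interpret IJ: prob_space "gauss_space (insert i0 J)" by (rule prob_space_gauss_space)
  define q where "q x = indicator {0..} x * (\<Prod>j\<in>J. measure std_normal_distribution {..b j * x})" for x :: real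
  have q01: "0 \<le> q x" "q x \<le> 1" for x
    unfolding q_def by (auto intro!: mult_nonneg_nonneg prod_nonneg prod_le_1 mult_le_one std_normal.prob_le_1)
  have [measurable]: "q \<in> borel_measurable borel" unfolding q_def[abs_def] by measurable
  have intq: "integrable std_normal_distribution q" by (rule std_normal.integrable_const_bound[of _ 1]) (use q01 in auto)
  have intq': "integrable lborel (\<lambda>x. std_normal_density x * q x)"
    using intq by (subst (asm) integrable_density) auto
  \<comment> \<open>Only almost everywhere: the event allows x = 0, the integral runs over x >
    0.\<close>
  have fq: "AE x in lborel. indicator {0<..} x *\<^sub>R f x = complex_of_real (sqrt (2 * pi)) * complex_of_real (std_normal_density x * q x)"
    using AE_lborel_singleton[of 0]
  proof eventually_elim
    case (elim x)
    show ?case unfolding f_def gauss_exp_eq q_def Phi_of_real using elim by (auto simp: indicator_def)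
  qed
  have mf: "(\<lambda>x. indicator {0<..} x *\<^sub>R f x) \<in> borel_measurable lborel"
    unfolding f_def Phi_of_real by measurable
  have intg: "integrable lborel (\<lambda>x. complex_of_real (sqrt (2 * pi)) * complex_of_real (std_normal_density x * q x))"
    using intq' by (intro integrable_mult_right integrable_of_real)
  show "set_integrable lborel {0<..} f"
    unfolding set_integrable_def
    by (subst integrable_cong_AE[OF mf _ fq]) (use intg in auto)
  have If: "(LINT x:{0<..}|lborel. f x) = complex_of_real (sqrt (2 * pi)) * complex_of_real (\<integral>x. q x \<partial>std_normal_distribution)"
  proof -
    have "(LINT x:{0<..}|lborel. f x) = (\<integral>x. complex_of_real (sqrt (2 * pi)) * complex_of_real (std_normal_density x * q x) \<partial>lborel)"
      unfolding set_lebesgue_integral_def by (rule integral_cong_AE[OF mf _ fq]) auto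
    also have "\<dots> = complex_of_real (sqrt (2 * pi)) * complex_of_real (\<integral>x. std_normal_density x * q x \<partial>lborel)"
      by (simp only: integral_mult_right_zero integral_complex_of_real)
    finally show ?thesis by (simp add: integral_std_normal)
  qed
  define E where "E = {z \<in> space (gauss_space (insert i0 J)). 0 \<le> z i0 \<and> (\<forall>j\<in>J. z j \<le> b j * z i0)}"
  have [measurable]: "E \<in> sets (gauss_space (insert i0 J))"
  proof -
    have comp: "(\<lambda>z. z j) \<in> borel_measurable (gauss_space (insert i0 J))" if "j \<in> insert i0 J" for j
      using that by measurable
    have [measurable]: "(\<lambda>z. z j \<le> b j * z i0) \<in> measurable (gauss_space (insert i0 J)) (count_space UNIV)" if "j \<in> J" for j
      unfolding pred_def using that by (intro borel_measurable_le borel_measurable_times measurable_const comp) auto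
    then show ?thesis unfolding E_def using J by measurable
  qed
  have "emeasure (gauss_space (insert i0 J)) E = (\<integral>\<^sup>+ z. indicator E z \<partial>gauss_space (insert i0 J))" by simp
  also have "\<dots> = (\<integral>\<^sup>+ y. (\<integral>\<^sup>+ x. indicator E (x(i0 := y)) \<partial>gauss_space J) \<partial>std_normal_distribution)"
    by (rule std_normal_product.product_nn_integral_insert_rev[OF J]) measurable
  also have "\<dots> = (\<integral>\<^sup>+ y. ennreal (q y) \<partial>std_normal_distribution)"
  proof (intro nn_integral_cong)
    fix y
    have "(\<integral>\<^sup>+ x. indicator E (x(i0 := y)) \<partial>gauss_space J) = (\<integral>\<^sup>+ x. indicator {0..} y * indicator (\<Pi>\<^sub>E j\<in>J. {..b j * y}) x \<partial>gauss_space J)"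
    proof (intro nn_integral_cong)
      fix x assume x: "x \<in> space (gauss_space J)"
      have "x(i0 := y) \<in> space (gauss_space (insert i0 J))"
        using x by (auto simp: space_PiM PiE_iff extensional_def)
      moreover have "(\<forall>j\<in>J. (x(i0 := y)) j \<le> b j * y) \<longleftrightarrow> x \<in> (\<Pi>\<^sub>E j\<in>J. {..b j * y})"
        using J x by (auto simp: space_PiM PiE_iff)
      ultimately have "x(i0 := y) \<in> E \<longleftrightarrow> 0 \<le> y \<and> x \<in> (\<Pi>\<^sub>E j\<in>J. {..b j * y})"
        unfolding E_def mem_Collect_eq fun_upd_same by blast
      then show "indicator E (x(i0 := y)) = (indicator {0..} y * indicator (\<Pi>\<^sub>E j\<in>J. {..b j * y}) x :: ennreal)"
        by (simp add: indicator_def)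
    qed
    also have "\<dots> = indicator {0..} y * emeasure (gauss_space J) (\<Pi>\<^sub>E j\<in>J. {..b j * y})"
      using J by (subst nn_integral_cmult) (auto intro!: sets_PiM_I_finite)
    also have "emeasure (gauss_space J) (\<Pi>\<^sub>E j\<in>J. {..b j * y}) = ennreal (\<Prod>j\<in>J. measure std_normal_distribution {..b j * y})"
      using J by (subst std_normal_product.emeasure_PiM) (auto simp: std_normal.emeasure_eq_measure prod_ennreal)
    also have "indicator {0..} y * \<dots> = ennreal (q y)" by (auto simp: q_def indicator_def)
    finally show "(\<integral>\<^sup>+ x. indicator E (x(i0 := y)) \<partial>gauss_space J) = ennreal (q y)" .
  qed
  also have "\<dots> = ennreal (\<integral>y. q y \<partial>std_normal_distribution)"
    by (rule nn_integral_eq_integral[OF intq]) (use q01 in auto)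
  finally have "measure (gauss_space (insert i0 J)) E = (\<integral>y. q y \<partial>std_normal_distribution)"
    using q01 by (simp add: measure_def integral_nonneg_AE)
  then show "complex_of_real (measure (gauss_space (insert i0 J))
       {z \<in> space (gauss_space (insert i0 J)). 0 \<le> z i0 \<and> (\<forall>j\<in>J. z j \<le> b j * z i0)})
     = 1 / complex_of_real (sqrt (2 * pi)) * (LINT x:{0<..}|lborel. f x)"
    unfolding If E_def by (simp del: of_real_mult)
qed

section \<open>Tangent and normal cones of the simplex\<close>

text \<open>A constraint with slack at p survives a small enough step in any direction, so only the
  active ones restrict v; finiteness of I yields a common step size.\<close>

lemma tangent_directions_polyhedron:
  fixes p :: "'a::euclidean_space"
  assumes I: "finite I" and p: "\<And>i. i \<in> I \<Longrightarrow> p \<bullet> w i \<le> \<beta> i"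
  shows "{v. \<exists>\<epsilon>>0. p + \<epsilon> *\<^sub>R v \<in> {x. \<forall>i\<in>I. x \<bullet> w i \<le> \<beta> i}} = {v. \<forall>i\<in>{i\<in>I. p \<bullet> w i = \<beta> i}. v \<bullet> w i \<le> 0}"
proof (intro set_eqI iffI)
  fix v assume "v \<in> {v. \<exists>\<epsilon>>0. p + \<epsilon> *\<^sub>R v \<in> {x. \<forall>i\<in>I. x \<bullet> w i \<le> \<beta> i}}"
  then obtain \<epsilon> where \<epsilon>: "\<epsilon> > 0" "\<And>i. i \<in> I \<Longrightarrow> p \<bullet> w i + \<epsilon> * (v \<bullet> w i) \<le> \<beta> i"
    by (auto simp: inner_add_left)
  have "v \<bullet> w i \<le> 0" if "i \<in> I" "p \<bullet> w i = \<beta> i" for i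
  proof -
    have "\<epsilon> * (v \<bullet> w i) \<le> 0" using \<epsilon>(2)[of i] that by simp
    then show ?thesis using \<epsilon>(1) by (simp add: mult_le_0_iff)
  qed
  then show "v \<in> {v. \<forall>i\<in>{i\<in>I. p \<bullet> w i = \<beta> i}. v \<bullet> w i \<le> 0}" by auto
next
  fix v assume v: "v \<in> {v. \<forall>i\<in>{i\<in>I. p \<bullet> w i = \<beta> i}. v \<bullet> w i \<le> 0}"
  have "\<exists>\<epsilon>>0. \<forall>i\<in>I. p \<bullet> w i + \<epsilon> * (v \<bullet> w i) \<le> \<beta> i"
  proof -
    have "\<forall>\<^sub>F \<epsilon> in at_right 0. p \<bullet> w i + \<epsilon> * (v \<bullet> w i) \<le> \<beta> i" if i: "i \<in> I" for i
    proof (cases "p \<bullet> w i = \<beta> i")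
      case True
      have "\<epsilon> > 0 \<Longrightarrow> \<epsilon> * (v \<bullet> w i) \<le> 0" for \<epsilon> using v i True by (simp add: mult_nonneg_nonpos)
      then show ?thesis using True eventually_at_right_less[of "0::real"] by (auto elim!: eventually_mono)
    next
      case False
      have "((\<lambda>\<epsilon>. p \<bullet> w i + \<epsilon> * (v \<bullet> w i)) \<longlongrightarrow> p \<bullet> w i + 0 * (v \<bullet> w i)) (at_right 0)"
        by (intro tendsto_intros)
      then have "\<forall>\<^sub>F \<epsilon> in at_right 0. p \<bullet> w i + \<epsilon> * (v \<bullet> w i) < \<beta> i"
        by (rule order_tendstoD) (use False p[OF i] in auto)
      then show ?thesis by (auto elim!: eventually_mono)
    qed
    then have "\<forall>\<^sub>F \<epsilon> in at_right 0. \<forall>i\<in>I. p \<bullet> w i + \<epsilon> * (v \<bullet> w i) \<le> \<beta> i"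
      using I by (simp add: eventually_ball_finite)
    with eventually_at_right_less[of "0::real"] have "\<forall>\<^sub>F \<epsilon> in at_right 0. \<epsilon> > 0 \<and> (\<forall>i\<in>I. p \<bullet> w i + \<epsilon> * (v \<bullet> w i) \<le> \<beta> i)"
      by eventually_elim auto
    then show ?thesis using eventually_happens'[OF trivial_limit_at_right_real] by blast
  qed
  then show "v \<in> {v. \<exists>\<epsilon>>0. p + \<epsilon> *\<^sub>R v \<in> {x. \<forall>i\<in>I. x \<bullet> w i \<le> \<beta> i}}"
    by (auto simp: inner_add_left)
qed

lemma normal_cone_convex_hull:
  "normal_cone F (convex hull V) = {v. \<forall>z\<in>V. v \<bullet> z \<le> v \<bullet> face_point F}"
proof -
  have "(\<forall>z\<in>convex hull V. v \<bullet> z \<le> v \<bullet> face_point F) \<longleftrightarrow> (\<forall>z\<in>V. v \<bullet> z \<le> v \<bullet> face_point F)" for v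
  proof
    assume "\<forall>z\<in>V. v \<bullet> z \<le> v \<bullet> face_point F"
    then have "convex hull V \<subseteq> {z. v \<bullet> z \<le> v \<bullet> face_point F}"
      by (intro hull_minimal) (auto simp: convex_halfspace_le)
    then show "\<forall>z\<in>convex hull V. v \<bullet> z \<le> v \<bullet> face_point F" by auto
  qed (auto intro: hull_inc)
  then show ?thesis by (simp add: normal_cone_def inner_diff_right)
qed

text \<open>The gaps v.p - v.g are nonnegative and their mean with positive weights is 0, so each of
  them is 0. This yields the equations of a normal cone.\<close>

lemma inner_eq_of_convex_combination_maximal:
  fixes v :: "'a::real_inner"
  assumes G: "finite G" and u: "\<And>g. g \<in> G \<Longrightarrow> u g > 0" "sum u G = 1" and p: "p = (\<Sum>g\<in>G. u g *\<^sub>R g)"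
    and le: "\<And>g. g \<in> G \<Longrightarrow> v \<bullet> g \<le> v \<bullet> p" and g: "g \<in> G"
  shows "v \<bullet> g = v \<bullet> p"
proof -
  have "(\<Sum>g\<in>G. u g * (v \<bullet> p - v \<bullet> g)) = sum u G * (v \<bullet> p) - v \<bullet> (\<Sum>g\<in>G. u g *\<^sub>R g)"
    by (simp add: right_diff_distrib sum_subtractf inner_sum_right sum_distrib_right)
  also have "\<dots> = 0" by (simp add: u flip: p)
  finally have "\<forall>g\<in>G. u g * (v \<bullet> p - v \<bullet> g) = 0"
    using G le u by (subst (asm) sum_nonneg_eq_0_iff) (auto simp: less_imp_le)
  then show ?thesis using g u(1)[OF g] by auto
qed

lemma face_point_in_rel_interior:
  assumes "convex F" "F \<noteq> {}"
  shows "face_point F \<in> rel_interior F"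
proof -
  have "\<exists>x. x \<in> rel_interior F" using rel_interior_eq_empty[OF assms(1)] assms(2) by blast
  then show ?thesis unfolding face_point_def by (rule someI_ex)
qed

text \<open>The arbitrary choice in \<open>face_point\<close> is used only through this: its
  barycentric coordinates are all positive.\<close>

lemma face_point_convex_hull:
  fixes G :: "'a::euclidean_space set"
  assumes "\<not> affine_dependent G" "G \<noteq> {}"
  shows "\<exists>u. (\<forall>g\<in>G. u g > 0) \<and> sum u G = 1 \<and> (\<Sum>g\<in>G. u g *\<^sub>R g) = face_point (convex hull G)"
proof -
  have "face_point (convex hull G) \<in> rel_interior (convex hull G)"
    using assms(2) by (intro face_point_in_rel_interior convex_convex_hull) simp
  then show ?thesis unfolding rel_interior_convex_hull_explicit[OF assms(1)] by simp
qed

lemma orthant_prob_identity: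
  assumes "finite I"
  shows "orthant_prob I I (\<lambda>i m. if i = m then 1 else 0) = 1 / 2 ^ card I"
proof -
  have half: "measure std_normal_distribution {..0} = 1 / 2"
    by (rule measure_std_normal_nonpos)
  have "{z \<in> space (gauss_space I). \<forall>i\<in>I. (\<Sum>m\<in>I. (if i = m then 1 else 0) * z m) \<le> 0} = (\<Pi>\<^sub>E i\<in>I. {..0})"
    using assms by (auto simp: space_PiM PiE_iff extensional_def if_distrib[of "\<lambda>x. x * _"] sum.delta' cong: if_cong)
  then have orth: "orthant_prob I I (\<lambda>i m. if i = m then 1 else 0) = measure (gauss_space I) (\<Pi>\<^sub>E i\<in>I. {..0})"
    by (simp add: orthant_prob_def)
  have "emeasure (gauss_space I) (\<Pi>\<^sub>E i\<in>I. {..0}) = (\<Prod>i\<in>I. ennreal (1 / 2))"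
    using assms by (subst std_normal_product.emeasure_PiM) (auto simp: std_normal.emeasure_eq_measure half)
  also have "\<dots> = ennreal (\<Prod>i\<in>I. 1 / 2)" by (rule prod_ennreal) simp
  also have "\<dots> = ennreal ((1 / 2) ^ card I)" by simp
  finally have "measure (gauss_space I) (\<Pi>\<^sub>E i\<in>I. {..0}) = (1 / 2) ^ card I"
    unfolding measure_def by (subst enn2real_ennreal[symmetric]) simp_all
  with orth show ?thesis by (simp add: power_one_over)
qed

section \<open>The orthogonal simplex, its facets and its face points\<close>

locale orthogonal_simplex =
  fixes e :: "nat \<Rightarrow> 'a::euclidean_space" and \<tau> :: "nat \<Rightarrow> real" and d :: nat
  assumes e: "bij_betw e {1..d} (Basis :: 'a set)"
    and \<tau>: "\<And>j. j \<in> {1..d} \<Longrightarrow> \<tau> j > 0"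
begin

definition vertex :: "nat \<Rightarrow> 'a" where "vertex j = (1 / \<tau> j) *\<^sub>R e j"

definition vec :: "(nat \<Rightarrow> real) \<Rightarrow> 'a" where "vec f = (\<Sum>j=1..d. f j *\<^sub>R e j)"

lemma e_inner: "i \<in> {1..d} \<Longrightarrow> j \<in> {1..d} \<Longrightarrow> e i \<bullet> e j = (if i = j then 1 else 0)"
  using bij_betwE[OF e] inj_on_eq_iff[OF bij_betw_imp_inj_on[OF e]] by (simp add: inner_Basis)

lemma inner_vec: "v \<bullet> vec f = (\<Sum>j=1..d. f j * (v \<bullet> e j))"
  by (simp add: vec_def inner_sum_right)

lemma vec_inner_e: "j \<in> {1..d} \<Longrightarrow> vec f \<bullet> e j = f j"
  by (simp add: vec_def inner_sum_left e_inner if_distrib[of "\<lambda>x. _ * x"] sum.delta cong: if_cong)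

lemma vec_inner_vec: "vec f \<bullet> vec g = (\<Sum>j=1..d. f j * g j)"
  by (simp add: inner_vec vec_inner_e mult.commute)

lemma vec_coords: "vec (\<lambda>j. v \<bullet> e j) = v"
proof -
  have "vec (\<lambda>j. v \<bullet> e j) = (\<Sum>b\<in>Basis. (v \<bullet> b) *\<^sub>R b)"
    unfolding vec_def by (rule sum.reindex_bij_betw[OF e])
  also have "\<dots> = v" by (rule euclidean_representation)
  finally show ?thesis .
qed

lemma vertex_inner_e: "i \<in> {1..d} \<Longrightarrow> j \<in> {1..d} \<Longrightarrow> vertex i \<bullet> e j = (if i = j then 1 / \<tau> i else 0)"
  by (simp add: vertex_def e_inner)

lemma vertex_neq_0: "i \<in> {1..d} \<Longrightarrow> vertex i \<noteq> 0"
  using vertex_inner_e[of i i] \<tau>[of i] by auto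

lemma inj_on_vertex: "inj_on vertex {1..d}"
proof (rule inj_onI)
  fix i j assume ij: "i \<in> {1..d}" "j \<in> {1..d}" "vertex i = vertex j"
  show "i = j"
  proof (rule ccontr)
    assume "i \<noteq> j"
    then show False using vertex_inner_e[of i i] vertex_inner_e[of j i] \<tau>[of i] ij by simp
  qed
qed

lemma simplex_not_affine_dependent: "\<not> affine_dependent (insert 0 (vertex ` {1..d}))"
proof -
  have "0 \<notin> vertex ` {1..d}" using vertex_neq_0 by auto
  moreover have "pairwise orthogonal (vertex ` {1..d})"
    by (auto simp: pairwise_def orthogonal_def vertex_def e_inner)
  ultimately have "independent (vertex ` {1..d})" by (intro pairwise_orthogonal_independent)
  then show ?thesis using \<open>0 \<notin> _\<close> by (simp add: affine_dependent_iff_dependent)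
qed

abbreviation "S \<equiv> convex hull (insert 0 (vertex ` {1..d}))"

lemma face:
  assumes "G \<subseteq> insert 0 (vertex ` {1..d})"
  shows "convex hull G face_of S" "aff_dim (convex hull G) = int (card G) - 1"
proof -
  show "convex hull G face_of S"
    using face_of_convex_hull_affine_independent[OF simplex_not_affine_dependent] assms by blast
  have "\<not> affine_dependent G" using simplex_not_affine_dependent affine_dependent_subset assms by blast
  then show "aff_dim (convex hull G) = int (card G) - 1"
    by (simp add: aff_dim_convex_hull affine_independent_iff_card)
qed

text \<open>Facet description: index 0 is the facet opposite to the origin, index i \<ge> 1 the
  coordinate facet x_i = 0.\<close>

lemma S_eq: "S = {x. \<forall>i\<in>{0..d}. x \<bullet> (if i = 0 then vec \<tau> else - e i) \<le> (if i = 0 then 1 else 0)}"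
  (is "_ = ?P")
proof -
  have mem: "x \<in> ?P \<longleftrightarrow> (\<Sum>j=1..d. \<tau> j * (x \<bullet> e j)) \<le> 1 \<and> (\<forall>j\<in>{1..d}. x \<bullet> e j \<ge> 0)" for x
  proof -
    have "{0..d} = insert 0 {1..d}" by auto
    then have "x \<in> ?P \<longleftrightarrow> x \<bullet> vec \<tau> \<le> 1 \<and> (\<forall>i\<in>{1..d}. x \<bullet> (if i = 0 then vec \<tau> else - e i) \<le> (if i = 0 then 1 else 0))"
      by simp
    also have "(\<forall>i\<in>{1..d}. x \<bullet> (if i = 0 then vec \<tau> else - e i) \<le> (if i = 0 then 1 else 0)) \<longleftrightarrow> (\<forall>j\<in>{1..d}. x \<bullet> e j \<ge> 0)"
      by (intro ball_cong) auto
    finally show ?thesis by (simp only: inner_vec)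
  qed
  show ?thesis
  proof
    have "?P = (\<Inter>i\<in>{0..d}. {x. (if i = 0 then vec \<tau> else - e i) \<bullet> x \<le> (if i = 0 then 1 else 0)})"
      by (simp add: set_eq_iff inner_commute)
    then have "convex ?P" by (auto intro!: convex_INT convex_halfspace_le simp del: inner_minus_left)
    moreover have "vertex i \<in> ?P" if i: "i \<in> {1..d}" for i
      unfolding mem using i \<tau> by (auto simp: vertex_inner_e less_imp_le if_distrib[of "\<lambda>x. _ * x"] sum.delta' cong: if_cong)
    moreover have "0 \<in> ?P" unfolding mem by simp
    ultimately show "S \<subseteq> ?P" by (intro hull_minimal insert_subsetI image_subsetI)
    show "?P \<subseteq> S"
    proof
      fix x assume "x \<in> ?P"
      then have x: "(\<Sum>j=1..d. \<tau> j * (x \<bullet> e j)) \<le> 1" "\<And>j. j \<in> {1..d} \<Longrightarrow> x \<bullet> e j \<ge> 0" unfolding mem by auto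
      \<comment> \<open>Barycentric coordinates of x: \<tau>_j x_j at vertex j, and the remaining
        weight at the origin.\<close>
      define u where "u j = (if j = 0 then 1 - (\<Sum>j=1..d. \<tau> j * (x \<bullet> e j)) else \<tau> j * (x \<bullet> e j))" for j
      define y where "y j = (if j = 0 then 0 else vertex j)" for j
      have split: "sum f {0..d} = f 0 + sum f {1..d}" for f :: "nat \<Rightarrow> 'b::comm_monoid_add"
        by (simp add: sum.atLeast_Suc_atMost)
      have "(\<Sum>j\<in>{0..d}. u j *\<^sub>R y j) \<in> S"
      proof (rule convex_sum)
        show "sum u {0..d} = 1" unfolding split by (simp add: u_def)
        show "\<And>i. i \<in> {0..d} \<Longrightarrow> u i \<ge> 0" using x \<tau> by (auto simp: u_def less_imp_le)
        show "\<And>i. i \<in> {0..d} \<Longrightarrow> y i \<in> S" by (auto simp: y_def intro!: hull_inc)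
      qed (auto simp: convex_convex_hull)
      also have "(\<Sum>j\<in>{0..d}. u j *\<^sub>R y j) = vec (\<lambda>j. x \<bullet> e j)"
        unfolding split vec_def using \<tau> by (force simp: u_def y_def vertex_def intro!: sum.cong)
      finally show "x \<in> S" by (simp add: vec_coords)
    qed
  qed
qed

lemma tangent_cone_eq:
  assumes p: "face_point F \<in> S"
  shows "tangent_cone F S = {v. \<forall>i\<in>{i\<in>{0..d}. if i = 0 then face_point F \<bullet> vec \<tau> = 1 else face_point F \<bullet> e i = 0}.
      v \<bullet> (if i = 0 then vec \<tau> else - e i) \<le> 0}"
proof -
  let ?w = "\<lambda>i. if i = 0 then vec \<tau> else - e i" and ?\<beta> = "\<lambda>i::nat. if i = 0 then 1 else 0::real"
  have "tangent_cone F S = {v. \<exists>\<epsilon>>0. face_point F + \<epsilon> *\<^sub>R v \<in> {x. \<forall>i\<in>{0..d}. x \<bullet> ?w i \<le> ?\<beta> i}}"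
    unfolding tangent_cone_def S_eq ..
  also have "\<dots> = {v. \<forall>i\<in>{i\<in>{0..d}. face_point F \<bullet> ?w i = ?\<beta> i}. v \<bullet> ?w i \<le> 0}"
    using p unfolding S_eq by (intro tangent_directions_polyhedron) auto
  also have "{i\<in>{0..d}. face_point F \<bullet> ?w i = ?\<beta> i}
    = {i\<in>{0..d}. if i = 0 then face_point F \<bullet> vec \<tau> = 1 else face_point F \<bullet> e i = 0}"
    by auto
  finally show ?thesis .
qed

lemma face_point_in_S:
  assumes "G \<subseteq> insert 0 (vertex ` {1..d})" "G \<noteq> {}"
  shows "face_point (convex hull G) \<in> S"
proof -
  have "face_point (convex hull G) \<in> rel_interior (convex hull G)"
    using assms(2) by (intro face_point_in_rel_interior convex_convex_hull) simp
  then show ?thesis using rel_interior_subset hull_mono[OF assms(1)] by blast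
qed

text \<open>These facts determine both cones: the active facets at p are exactly x_j = 0 with j > n,
  and the last claim is the normal cone.\<close>

lemma face_point_origin_face:
  assumes n: "n \<le> d"
  defines "p \<equiv> face_point (convex hull (insert 0 (vertex ` {1..n})))"
  shows "p \<in> S" "p \<bullet> vec \<tau> < 1" "\<And>j. j \<in> {1..n} \<Longrightarrow> p \<bullet> e j > 0" "\<And>j. j \<in> {n+1..d} \<Longrightarrow> p \<bullet> e j = 0"
    and "{v. \<forall>z\<in>insert 0 (vertex ` {1..d}). v \<bullet> z \<le> v \<bullet> p}
       = {v. (\<forall>j\<in>{1..n}. v \<bullet> e j = 0) \<and> (\<forall>j\<in>{n+1..d}. v \<bullet> e j \<le> 0)}"
proof -
  let ?G = "insert 0 (vertex ` {1..n})"
  have sub: "?G \<subseteq> insert 0 (vertex ` {1..d})" using n by auto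
  have G: "\<not> affine_dependent ?G" using simplex_not_affine_dependent affine_dependent_subset sub by blast
  obtain u where u0: "\<forall>g\<in>?G. u g > 0" "sum u ?G = 1" "(\<Sum>g\<in>?G. u g *\<^sub>R g) = face_point (convex hull ?G)"
    using face_point_convex_hull[OF G insert_not_empty] by blast
  have u: "\<And>g. g \<in> ?G \<Longrightarrow> u g > 0" "sum u ?G = 1" using u0 by blast+
  have p: "p = (\<Sum>g\<in>?G. u g *\<^sub>R g)" using u0(3) by (simp only: p_def)
  have inj: "inj_on vertex {1..n}" by (rule inj_on_subset[OF inj_on_vertex]) (use n in auto)
  have 0: "0 \<notin> vertex ` {1..n}" using vertex_neq_0 n by fastforce
  have usum: "u 0 + (\<Sum>i=1..n. u (vertex i)) = 1" using u(2) 0 inj by (simp add: sum.reindex)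
  have psum: "p = (\<Sum>i=1..n. u (vertex i) *\<^sub>R vertex i)" using p 0 inj by (simp add: sum.reindex)
  have pe: "p \<bullet> e j = (if j \<le> n then u (vertex j) / \<tau> j else 0)" if j: "j \<in> {1..d}" for j
  proof -
    have "p \<bullet> e j = (\<Sum>i=1..n. if i = j then u (vertex j) / \<tau> j else 0)"
      unfolding psum inner_sum_left using n j by (intro sum.cong) (auto simp: vertex_inner_e)
    then show ?thesis using j by (simp add: sum.delta)
  qed
  show "p \<in> S" unfolding p_def by (rule face_point_in_S[OF sub]) simp
  show "\<And>j. j \<in> {1..n} \<Longrightarrow> p \<bullet> e j > 0" using pe n u \<tau> by (auto intro!: divide_pos_pos)
  show "\<And>j. j \<in> {n+1..d} \<Longrightarrow> p \<bullet> e j = 0" using pe by auto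
  have "p \<bullet> vec \<tau> = (\<Sum>j=1..d. if j \<in> {1..n} then u (vertex j) else 0)"
    unfolding inner_vec using pe \<tau> by (intro sum.cong) (auto simp: less_imp_neq[THEN not_sym])
  also have "\<dots> = (\<Sum>j\<in>{1..d} \<inter> {1..n}. u (vertex j))" by (rule sum.inter_restrict[symmetric]) simp
  also have "{1..d} \<inter> {1..n} = {1..n}" using n by auto
  finally show "p \<bullet> vec \<tau> < 1" using usum u(1)[of 0] by simp
  show "{v. \<forall>z\<in>insert 0 (vertex ` {1..d}). v \<bullet> z \<le> v \<bullet> p}
     = {v. (\<forall>j\<in>{1..n}. v \<bullet> e j = 0) \<and> (\<forall>j\<in>{n+1..d}. v \<bullet> e j \<le> 0)}"
  proof (intro set_eqI iffI)
    fix v assume v: "v \<in> {v. \<forall>z\<in>insert 0 (vertex ` {1..d}). v \<bullet> z \<le> v \<bullet> p}"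
    have eq: "v \<bullet> g = v \<bullet> p" if "g \<in> ?G" for g
      by (rule inner_eq_of_convex_combination_maximal[OF _ u p]) (use v sub that in auto)
    \<comment> \<open>The origin is a vertex of this face, so the common value of v on the face is
      0.\<close>
    have vp: "v \<bullet> p = 0" using eq[of 0] by simp
    have vj: "v \<bullet> e j = \<tau> j * (v \<bullet> vertex j)" if "j \<in> {1..d}" for j using \<tau>[OF that] by (simp add: vertex_def)
    show "v \<in> {v. (\<forall>j\<in>{1..n}. v \<bullet> e j = 0) \<and> (\<forall>j\<in>{n+1..d}. v \<bullet> e j \<le> 0)}"
      using vj eq vp v n \<tau> by (auto simp: mult_le_0_iff less_imp_le)
  next
    fix v assume v: "v \<in> {v. (\<forall>j\<in>{1..n}. v \<bullet> e j = 0) \<and> (\<forall>j\<in>{n+1..d}. v \<bullet> e j \<le> 0)}"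
    then have "v \<bullet> p = 0" unfolding psum by (simp add: inner_sum_right vertex_def)
    moreover have "v \<bullet> e j \<le> 0" if "j \<in> {1..d}" for j using v that by (cases "j \<le> n") auto
    then have "v \<bullet> vertex j \<le> 0" if "j \<in> {1..d}" for j using \<tau>[OF that] that by (simp add: vertex_def divide_nonpos_pos)
    ultimately show "v \<in> {v. \<forall>z\<in>insert 0 (vertex ` {1..d}). v \<bullet> z \<le> v \<bullet> p}" by auto
  qed
qed

text \<open>Here the facet opposite to the origin is active too. In the normal cone, c is the common
  value of v on the vertices of the face.\<close>

lemma face_point_opposite_face:
  assumes n: "n \<le> d" "n \<ge> 1"
  defines "p \<equiv> face_point (convex hull (vertex ` {1..n}))"
  shows "p \<in> S" "p \<bullet> vec \<tau> = 1" "\<And>j. j \<in> {1..n} \<Longrightarrow> p \<bullet> e j > 0" "\<And>j. j \<in> {n+1..d} \<Longrightarrow> p \<bullet> e j = 0"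
    and "{v. \<forall>z\<in>insert 0 (vertex ` {1..d}). v \<bullet> z \<le> v \<bullet> p}
       = {v. \<exists>c\<ge>0. (\<forall>j\<in>{1..n}. v \<bullet> e j = c * \<tau> j) \<and> (\<forall>j\<in>{n+1..d}. v \<bullet> e j \<le> c * \<tau> j)}"
proof -
  let ?G = "vertex ` {1..n}"
  have sub: "?G \<subseteq> insert 0 (vertex ` {1..d})" using n by auto
  have ne: "?G \<noteq> {}" using n by auto
  have G: "\<not> affine_dependent ?G" using simplex_not_affine_dependent affine_dependent_subset sub by blast
  obtain u where u0: "\<forall>g\<in>?G. u g > 0" "sum u ?G = 1" "(\<Sum>g\<in>?G. u g *\<^sub>R g) = face_point (convex hull ?G)"
    using face_point_convex_hull[OF G ne] by blast
  have u: "\<And>g. g \<in> ?G \<Longrightarrow> u g > 0" "sum u ?G = 1" using u0 by blast+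
  have p: "p = (\<Sum>g\<in>?G. u g *\<^sub>R g)" using u0(3) by (simp only: p_def)
  have inj: "inj_on vertex {1..n}" by (rule inj_on_subset[OF inj_on_vertex]) (use n in auto)
  have usum: "(\<Sum>i=1..n. u (vertex i)) = 1" using u(2) inj by (simp add: sum.reindex)
  have psum: "p = (\<Sum>i=1..n. u (vertex i) *\<^sub>R vertex i)" using p inj by (simp add: sum.reindex)
  have pe: "p \<bullet> e j = (if j \<le> n then u (vertex j) / \<tau> j else 0)" if j: "j \<in> {1..d}" for j
  proof -
    have "p \<bullet> e j = (\<Sum>i=1..n. if i = j then u (vertex j) / \<tau> j else 0)"
      unfolding psum inner_sum_left using n j by (intro sum.cong) (auto simp: vertex_inner_e)
    then show ?thesis using j by (simp add: sum.delta)
  qed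
  show "p \<in> S" unfolding p_def by (rule face_point_in_S[OF sub ne])
  show "\<And>j. j \<in> {1..n} \<Longrightarrow> p \<bullet> e j > 0" using pe n u \<tau> by (auto intro!: divide_pos_pos)
  show "\<And>j. j \<in> {n+1..d} \<Longrightarrow> p \<bullet> e j = 0" using pe by auto
  have "p \<bullet> vec \<tau> = (\<Sum>j=1..d. if j \<in> {1..n} then u (vertex j) else 0)"
    unfolding inner_vec using pe \<tau> by (intro sum.cong) (auto simp: less_imp_neq[THEN not_sym])
  also have "\<dots> = (\<Sum>j\<in>{1..d} \<inter> {1..n}. u (vertex j))" by (rule sum.inter_restrict[symmetric]) simp
  also have "{1..d} \<inter> {1..n} = {1..n}" using n by auto
  finally show "p \<bullet> vec \<tau> = 1" using usum by simp
  have vj: "v \<bullet> e j = (v \<bullet> vertex j) * \<tau> j" if "j \<in> {1..d}" for v j using \<tau>[OF that] by (simp add: vertex_def)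
  show "{v. \<forall>z\<in>insert 0 (vertex ` {1..d}). v \<bullet> z \<le> v \<bullet> p}
     = {v. \<exists>c\<ge>0. (\<forall>j\<in>{1..n}. v \<bullet> e j = c * \<tau> j) \<and> (\<forall>j\<in>{n+1..d}. v \<bullet> e j \<le> c * \<tau> j)}"
  proof (intro set_eqI iffI)
    fix v assume v: "v \<in> {v. \<forall>z\<in>insert 0 (vertex ` {1..d}). v \<bullet> z \<le> v \<bullet> p}"
    have eq: "v \<bullet> g = v \<bullet> p" if "g \<in> ?G" for g
      by (rule inner_eq_of_convex_combination_maximal[OF _ u p]) (use v sub that in auto)
    show "v \<in> {v. \<exists>c\<ge>0. (\<forall>j\<in>{1..n}. v \<bullet> e j = c * \<tau> j) \<and> (\<forall>j\<in>{n+1..d}. v \<bullet> e j \<le> c * \<tau> j)}"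
    proof (intro CollectI exI[of _ "v \<bullet> p"] conjI ballI)
      \<comment> \<open>The vertex 0 lies outside the face and contributes the inequality c \<ge>
        0.\<close>
      show "0 \<le> v \<bullet> p" using v by auto
      show "v \<bullet> e j = (v \<bullet> p) * \<tau> j" if "j \<in> {1..n}" for j
        using vj[of j v] eq[of "vertex j"] that n by simp
      show "v \<bullet> e j \<le> (v \<bullet> p) * \<tau> j" if "j \<in> {n+1..d}" for j
      proof -
        have j: "j \<in> {1..d}" using that by auto
        then have "v \<bullet> vertex j \<le> v \<bullet> p" using v by blast
        then show ?thesis unfolding vj[OF j] using \<tau>[OF j] by simp
      qed
    qed
  next
    fix v assume "v \<in> {v. \<exists>c\<ge>0. (\<forall>j\<in>{1..n}. v \<bullet> e j = c * \<tau> j) \<and> (\<forall>j\<in>{n+1..d}. v \<bullet> e j \<le> c * \<tau> j)}"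
    then obtain c where c: "c \<ge> 0" "\<And>j. j \<in> {1..n} \<Longrightarrow> v \<bullet> e j = c * \<tau> j" "\<And>j. j \<in> {n+1..d} \<Longrightarrow> v \<bullet> e j \<le> c * \<tau> j"
      by blast
    have vG: "v \<bullet> vertex j = c" if "j \<in> {1..n}" for j using c(2)[OF that] \<tau>[of j] n that by (simp add: vertex_def)
    then have "v \<bullet> p = (\<Sum>j=1..n. u (vertex j) * c)" unfolding psum by (simp add: inner_sum_right)
    then have vp: "v \<bullet> p = c" using usum by (simp add: sum_distrib_right[symmetric])
    have "v \<bullet> vertex j \<le> c" if j: "j \<in> {1..d}" for j
    proof (cases "j \<le> n")
      case False
      then have "(v \<bullet> vertex j) * \<tau> j \<le> c * \<tau> j" using c(3)[of j] vj[OF j, of v] j by simp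
      then show ?thesis using \<tau>[OF j] by simp
    qed (use vG j in auto)
    then show "v \<in> {v. \<forall>z\<in>insert 0 (vertex ` {1..d}). v \<bullet> z \<le> v \<bullet> p}" using vp c by auto
  qed
qed

text \<open>Both cones are cut out by d - k orthonormal constraints: the tangent cone in the whole
  space, the normal cone in the subspace where the first k coordinates vanish.\<close>

lemma origin_face_angles:
  assumes k: "k < d"
  defines "F \<equiv> convex hull (insert 0 (vertex ` {1..k}))"
  shows "internal_angle F S = 1 / 2 ^ (d - k)" "external_angle F S = 1 / 2 ^ (d - k)"
proof -
  note p = face_point_origin_face[of k, folded F_def]
  let ?I = "{k+1..d}"
  let ?A = "\<lambda>i m::nat. if i = m then 1 else 0 :: real"
  have orth: "orthant_prob ?I ?I ?A = 1 / 2 ^ (d - k)" by (simp add: orthant_prob_identity)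
  have gram: "(\<Sum>m\<in>?I. ?A i m * ?A j m) = e i \<bullet> e j" if "i \<in> ?I" "j \<in> ?I" for i j
    using that by (auto simp: e_inner if_distrib[of "\<lambda>x. x * _"] sum.delta' cong: if_cong)
  have gram': "(\<Sum>m\<in>?I. ?A i m * ?A j m) = (- e i) \<bullet> (- e j)" if "i \<in> ?I" "j \<in> ?I" for i j
    unfolding gram[OF that] by simp
  have "{i\<in>{0..d}. if i = 0 then face_point F \<bullet> vec \<tau> = 1 else face_point F \<bullet> e i = 0} = ?I"
  proof -
    have "face_point F \<bullet> e i = 0 \<longleftrightarrow> i \<in> {k+1..d}" if "i \<in> {1..d}" for i
      using p(3)[of i] p(4)[of i] that k by (cases "i \<le> k") auto
    moreover have "face_point F \<bullet> vec \<tau> \<noteq> 1" using p(2) k by simp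
    ultimately show ?thesis by (auto split: if_splits)
  qed
  then have "tangent_cone F S = {v \<in> UNIV. \<forall>i\<in>?I. v \<bullet> - e i \<le> 0}"
    using k p(1) by (subst tangent_cone_eq) auto
  moreover have "solid_angle {v \<in> UNIV. \<forall>i\<in>?I. v \<bullet> - e i \<le> 0} = orthant_prob ?I ?I ?A"
    by (rule solid_angle_polyhedral_cone[where r="vec (\<lambda>_. 1)", OF _ _ _ _ _ _ gram']) (auto simp: vec_inner_e)
  ultimately show "internal_angle F S = 1 / 2 ^ (d - k)" using orth by (simp add: internal_angle_def)
  define L where "L = {v::'a. \<forall>j\<in>{1..k}. v \<bullet> e j = 0}"
  have L: "subspace L" unfolding L_def subspace_def by (auto simp: inner_add_left)
  have "normal_cone F S = {v \<in> L. \<forall>i\<in>?I. v \<bullet> e i \<le> 0}"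
    unfolding normal_cone_convex_hull using p(5) k by (auto simp: L_def)
  moreover have "solid_angle {v \<in> L. \<forall>i\<in>?I. v \<bullet> e i \<le> 0} = orthant_prob ?I ?I ?A"
    by (rule solid_angle_polyhedral_cone[where r="vec (\<lambda>j. if j \<le> k then 0 else -1)", OF L _ _ _ _ _ gram])
       (use k in \<open>auto simp: vec_inner_e L_def e_inner\<close>)
  ultimately show "external_angle F S = 1 / 2 ^ (d - k)" using orth by (simp add: external_angle_def)
qed

end

section \<open>Gram matrices of the cones at the face opposite to the origin\<close>

context orthogonal_simplex
begin

text \<open>Translates between the numbering 1, ..., d - k of \<open>gfun\<close> and coordinates:
  row 1 is the exceptional constraint involving \<tau>, row i \<ge> 2 belongs to coordinate k +
  i.\<close>

lemma ball_split_shift: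
  assumes "k < d"
  shows "(\<forall>i\<in>{1..d-k}. P i) \<longleftrightarrow> P 1 \<and> (\<forall>j\<in>{k+2..d}. P (j - k))"
proof (intro iffI conjI ballI)
  assume P: "P 1 \<and> (\<forall>j\<in>{k+2..d}. P (j - k))"
  fix i assume i: "i \<in> {1..d-k}"
  show "P i"
  proof (cases "i = 1")
    case False
    then have "k + i \<in> {k+2..d}" using i by auto
    then have "P (k + i - k)" using P by blast
    then show ?thesis by simp
  qed (use P in simp)
next
  assume P: "\<forall>i\<in>{1..d-k}. P i"
  show "P 1" using P assms by simp
  fix j assume "j \<in> {k+2..d}"
  then have "j - k \<in> {1..d-k}" by auto
  then show "P (j - k)" using P by blast
qed

lemma sum_truncate:
  assumes "n \<le> d"
  shows "(\<Sum>j=1..d. if j \<le> n then f j else (0::real)) = (\<Sum>j=1..n. f j)"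
proof -
  have "(\<Sum>j=1..d. if j \<le> n then f j else 0) = (\<Sum>j\<in>{1..d} \<inter> {j. j \<le> n}. f j)"
    by (simp add: sum.inter_restrict)
  also have "{1..d} \<inter> {j. j \<le> n} = {1..n}" using assms by auto
  finally show ?thesis .
qed

text \<open>The matrix prescribed for A is the Gram matrix of the outer facet normals
  \<tau>/\<sigma> and -e_{k+i}/\<tau>_{k+i}. Their lengths are immaterial for the cone; they are
  chosen to match the parameters \<tau>_{k+i}^2 of \<open>gfun\<close> and its rescaled first
  row.\<close>

lemma internal_angle_opposite_face:
  assumes k: "k < d" and M: "finite M"
    and \<sigma>: "\<sigma> > 0" "\<sigma>\<^sup>2 = (\<Sum>j=1..d. (\<tau> j)\<^sup>2)"
    and A: "\<And>i j. i \<in> {1..d-k} \<Longrightarrow> j \<in> {1..d-k} \<Longrightarrow> (\<Sum>m\<in>M. A i m * A j m) =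
      (if i = 1 then (if j = 1 then 1 else -1 / \<sigma>) else if j = 1 then -1 / \<sigma>
       else if i = j then 1 / (\<tau> (k + i))\<^sup>2 else 0)"
  shows "internal_angle (convex hull (vertex ` {1..k+1})) S = orthant_prob {1..d-k} M A"
proof -
  define F where "F = convex hull (vertex ` {1..k+1})"
  have k1: "k + 1 \<le> d" "k + 1 \<ge> 1" using k by auto
  note p = face_point_opposite_face[OF k1, folded F_def]
  define w where "w i = (if i = 1 then (1 / \<sigma>) *\<^sub>R vec \<tau> else - ((1 / \<tau> (k + i)) *\<^sub>R e (k + i)))" for i
  have idx: "{i\<in>{0..d}. if i = 0 then face_point F \<bullet> vec \<tau> = 1 else face_point F \<bullet> e i = 0} = insert 0 {k+2..d}"
  proof -
    have "face_point F \<bullet> e i = 0 \<longleftrightarrow> i \<in> {k+2..d}" if "i \<in> {1..d}" for i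
      using p(3)[of i] p(4)[of i] that k by (cases "i \<le> k + 1") auto
    note iff = this
    show ?thesis
    proof (rule set_eqI)
      fix i
      show "i \<in> {i\<in>{0..d}. if i = 0 then face_point F \<bullet> vec \<tau> = 1 else face_point F \<bullet> e i = 0} \<longleftrightarrow> i \<in> insert 0 {k+2..d}"
        using iff[of i] p(2) by (cases "i = 0") auto
    qed
  qed
  have w1: "v \<bullet> w 1 \<le> 0 \<longleftrightarrow> v \<bullet> vec \<tau> \<le> 0" for v
    using \<sigma> by (simp add: w_def divide_le_0_iff)
  have w2: "v \<bullet> w (j - k) \<le> 0 \<longleftrightarrow> v \<bullet> e j \<ge> 0" if "j \<in> {k+2..d}" for v j
    using \<tau>[of j] that by (auto simp: w_def zero_le_divide_iff)
  have cone: "tangent_cone F S = {v \<in> UNIV. \<forall>i\<in>{1..d-k}. v \<bullet> w i \<le> 0}"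
    unfolding tangent_cone_eq[OF p(1)] idx ball_split_shift[OF k] using w1 w2 by auto
  \<comment> \<open>A strictly feasible direction: positive in the constrained coordinates, with the
    unconstrained coordinate 1 taken so negative that
    \<open>r \<bullet> vec \<tau> = -1\<close>.\<close>
  define r where "r = vec (\<lambda>j. if j = 1 then - ((\<Sum>j=k+2..d. \<tau> j) + 1) / \<tau> 1 else if j \<le> k + 1 then 0 else 1)"
  have split: "{1..d} = {1..k+1} \<union> {k+2..d}" "{1..k+1} \<inter> {k+2..d} = {}" using k by auto
  have d1: "1 \<in> {1..d}" using k by auto
  let ?f = "\<lambda>j. if j = 1 then - ((\<Sum>j=k+2..d. \<tau> j) + 1) / \<tau> 1 else if j \<le> k + 1 then 0 else 1"
  have "(\<Sum>j=1..k+1. ?f j * \<tau> j) = (\<Sum>j=1..k+1. if j = 1 then - ((\<Sum>j=k+2..d. \<tau> j) + 1) else 0)"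
    using \<tau>[OF d1] by (intro sum.cong) auto
  also have "\<dots> = - ((\<Sum>j=k+2..d. \<tau> j) + 1)" by (simp add: sum.delta)
  moreover have "(\<Sum>j=k+2..d. ?f j * \<tau> j) = (\<Sum>j=k+2..d. \<tau> j)" by (intro sum.cong) auto
  ultimately have "(\<Sum>j\<in>{1..d}. ?f j * \<tau> j) = -1"
    unfolding split(1) using split(2) by (subst sum.union_disjoint) auto
  then have r1: "r \<bullet> vec \<tau> = -1" unfolding r_def vec_inner_vec .
  have r2: "r \<bullet> e j = 1" if "j \<in> {k+2..d}" for j
    using that by (auto simp: r_def vec_inner_e)
  have "solid_angle {v \<in> UNIV. \<forall>i\<in>{1..d-k}. v \<bullet> w i \<le> 0} = orthant_prob {1..d-k} M A"
  proof (rule solid_angle_polyhedral_cone[where r=r])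
    have "\<forall>i\<in>{1..d-k}. r \<bullet> w i < 0"
      unfolding ball_split_shift[OF k] using r1 r2 \<sigma> \<tau> by (auto simp: w_def divide_less_0_iff)
    then show "\<And>i. i \<in> {1..d-k} \<Longrightarrow> r \<bullet> w i < 0" by blast
    fix i j assume ij: "i \<in> {1..d-k}" "j \<in> {1..d-k}"
    have v1: "vec \<tau> \<bullet> vec \<tau> = \<sigma>\<^sup>2" unfolding \<sigma>(2) vec_inner_vec by (simp add: power2_eq_square)
    have v2: "vec \<tau> \<bullet> e (k + i) = \<tau> (k + i)" "\<tau> (k + i) > 0" if "i \<in> {1..d-k}" for i
      using that k \<tau>[of "k + i"] by (auto intro: vec_inner_e)
    have v3: "e (k + i) \<bullet> e (k + j) = (if i = j then 1 else 0)"
      using ij k by (subst e_inner) auto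
    show "(\<Sum>m\<in>M. A i m * A j m) = w i \<bullet> w j"
      unfolding A[OF ij] using v2(1)[OF ij(1)] v2(1)[OF ij(2)] v2(2)[OF ij(1)] v2(2)[OF ij(2)] v3 \<sigma>(1) v1
      by (auto simp: w_def inner_commute[of "e _" "vec _"] power2_eq_square)
  qed (use M in auto)
  then show ?thesis unfolding internal_angle_def F_def[symmetric] cone .
qed

text \<open>In the subspace L where the first k + 1 coordinates are c times those of \<tau>, the
  factor c is the linear functional v.u0 / s^2, with u0 the truncation of \<tau>. This removes the
  existential quantifier over c and leaves linear constraints.\<close>

lemma external_angle_opposite_face:
  assumes k: "k < d" and M: "finite M"
    and s: "s > 0" "s\<^sup>2 = (\<Sum>j=1..k+1. (\<tau> j)\<^sup>2)"
    and A: "\<And>i j. i \<in> {1..d-k} \<Longrightarrow> j \<in> {1..d-k} \<Longrightarrow> (\<Sum>m\<in>M. A i m * A j m) =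
      (if i = 1 then (if j = 1 then 1 else 1 / s) else if j = 1 then 1 / s
       else 1 / s\<^sup>2 + (if i = j then 1 / (\<tau> (k + i))\<^sup>2 else 0))"
  shows "external_angle (convex hull (vertex ` {1..k+1})) S = orthant_prob {1..d-k} M A"
proof -
  define F where "F = convex hull (vertex ` {1..k+1})"
  have k1: "k + 1 \<le> d" "k + 1 \<ge> 1" using k by auto
  note p = face_point_opposite_face[OF k1, folded F_def]
  define L where "L = {v::'a. \<exists>c. \<forall>j\<in>{1..k+1}. v \<bullet> e j = c * \<tau> j}"
  define u0 where "u0 = vec (\<lambda>j. if j \<le> k + 1 then \<tau> j else 0)"
  \<comment> \<open>Row 1 expresses c \<ge> 0 and row i expresses v.e_j / \<tau>_j \<le> c for j = k
    + i. Subtracting multiples of u0 keeps these vectors in L, as their inner products must be taken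
    there.\<close>
  define w where "w i = (if i = 1 then - ((1 / s) *\<^sub>R u0) else (1 / \<tau> (k + i)) *\<^sub>R e (k + i) - (1 / s\<^sup>2) *\<^sub>R u0)" for i
  have L: "subspace L"
  proof (rule subspaceI)
    show "0 \<in> L" by (auto simp: L_def intro: exI[of _ 0])
    fix x y :: 'a assume "x \<in> L" "y \<in> L"
    then obtain a b where "\<forall>j\<in>{1..k+1}. x \<bullet> e j = a * \<tau> j" "\<forall>j\<in>{1..k+1}. y \<bullet> e j = b * \<tau> j"
      by (auto simp: L_def)
    then show "x + y \<in> L" unfolding L_def by (auto simp: inner_add_left algebra_simps intro!: exI[of _ "a + b"])
  next
    fix c and x :: 'a assume "x \<in> L"
    then obtain a where "\<forall>j\<in>{1..k+1}. x \<bullet> e j = a * \<tau> j" by (auto simp: L_def)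
    then show "c *\<^sub>R x \<in> L" unfolding L_def by (auto intro!: exI[of _ "c * a"])
  qed
  have vu: "v \<bullet> u0 = c * s\<^sup>2" if "\<forall>j\<in>{1..k+1}. v \<bullet> e j = c * \<tau> j" for v c
  proof -
    have "v \<bullet> u0 = (\<Sum>j=1..d. if j \<le> k + 1 then c * (\<tau> j)\<^sup>2 else 0)"
      unfolding u0_def inner_vec using that by (intro sum.cong) (auto simp: power2_eq_square)
    then show ?thesis using k1 by (simp only: sum_truncate[OF k1(1)] s(2) sum_distrib_left)
  qed
  have u0e: "u0 \<bullet> e j = (if j \<le> k + 1 then \<tau> j else 0)" if "j \<in> {1..d}" for j
    using that by (simp add: u0_def vec_inner_e)
  have u0L: "\<forall>j\<in>{1..k+1}. u0 \<bullet> e j = 1 * \<tau> j" using u0e k by auto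
  have uu: "u0 \<bullet> u0 = s\<^sup>2" using vu[OF u0L] by simp
  have \<tau>k: "\<tau> (k + i) > 0" if "i \<in> {1..d-k}" for i using \<tau>[of "k + i"] that by auto
  have eu: "e (k + i) \<bullet> u0 = 0" if "i \<in> {1..d-k}" "i \<noteq> 1" for i
    using u0e[of "k + i"] that k by (auto simp: inner_commute)
  have eL: "e (k + i) \<in> L" if "i \<in> {1..d-k}" "i \<noteq> 1" for i
    using that k by (auto simp: L_def e_inner intro!: exI[of _ 0])
  have wi: "v \<bullet> w 1 \<le> 0 \<longleftrightarrow> c \<ge> 0" "j \<in> {k+2..d} \<Longrightarrow> v \<bullet> w (j - k) \<le> 0 \<longleftrightarrow> v \<bullet> e j \<le> c * \<tau> j"
    if c: "\<forall>j\<in>{1..k+1}. v \<bullet> e j = c * \<tau> j" for v c j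
  proof -
    have "v \<bullet> w 1 = - (c * s)" using vu[OF c] s(1) by (simp add: w_def power2_eq_square)
    then show "v \<bullet> w 1 \<le> 0 \<longleftrightarrow> c \<ge> 0" using s(1) by (simp add: zero_le_mult_iff)
    assume j: "j \<in> {k+2..d}"
    then have "j - k \<noteq> 1" by auto
    with j have "v \<bullet> w (j - k) = v \<bullet> e j / \<tau> j - c" using vu[OF c] s(1) by (simp add: w_def inner_diff_right)
    then show "v \<bullet> w (j - k) \<le> 0 \<longleftrightarrow> v \<bullet> e j \<le> c * \<tau> j" using \<tau>[of j] j by (simp add: pos_divide_le_eq)
  qed
  have cone: "normal_cone F S = {v \<in> L. \<forall>i\<in>{1..d-k}. v \<bullet> w i \<le> 0}"
  proof (intro set_eqI)
    fix v
    have "v \<in> normal_cone F S \<longleftrightarrow> (\<exists>c\<ge>0. (\<forall>j\<in>{1..k+1}. v \<bullet> e j = c * \<tau> j) \<and> (\<forall>j\<in>{k+2..d}. v \<bullet> e j \<le> c * \<tau> j))"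
      unfolding normal_cone_convex_hull using p(5) by (auto simp: set_eq_iff)
    also have "\<dots> \<longleftrightarrow> (\<exists>c. (\<forall>j\<in>{1..k+1}. v \<bullet> e j = c * \<tau> j) \<and> (\<forall>i\<in>{1..d-k}. v \<bullet> w i \<le> 0))"
      unfolding ball_split_shift[OF k] using wi by blast
    also have "\<dots> \<longleftrightarrow> v \<in> {v \<in> L. \<forall>i\<in>{1..d-k}. v \<bullet> w i \<le> 0}" by (auto simp: L_def)
    finally show "v \<in> normal_cone F S \<longleftrightarrow> v \<in> {v \<in> L. \<forall>i\<in>{1..d-k}. v \<bullet> w i \<le> 0}" .
  qed
  \<comment> \<open>Strictly feasible with c = 1: the remaining coordinates are -1, below c
    \<tau>_j.\<close>
  define r where "r = vec (\<lambda>j. if j \<le> k + 1 then \<tau> j else - 1)"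
  have re: "r \<bullet> e j = (if j \<le> k + 1 then \<tau> j else - 1)" if "j \<in> {1..d}" for j
    using that by (simp add: r_def vec_inner_e)
  have rc: "\<forall>j\<in>{1..k+1}. r \<bullet> e j = 1 * \<tau> j" using re k by auto
  have "solid_angle {v \<in> L. \<forall>i\<in>{1..d-k}. v \<bullet> w i \<le> 0} = orthant_prob {1..d-k} M A"
  proof (rule solid_angle_polyhedral_cone[OF L, where r=r])
    show "r \<in> L" unfolding L_def using rc by blast
    have "r \<bullet> w i < 0" if i: "i \<in> {1..d-k}" for i
    proof (cases "i = 1")
      case True
      then show ?thesis using vu[OF rc] s(1) by (simp add: w_def power2_eq_square)
    next
      case False
      then have "r \<bullet> w i = - (1 / \<tau> (k + i)) - 1"
        using vu[OF rc] s(1) i re[of "k + i"] by (auto simp: w_def inner_diff_right)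
      moreover have "1 / \<tau> (k + i) > 0" using \<tau>k[OF i] by simp
      ultimately show ?thesis by linarith
    qed
    then show "\<And>i. i \<in> {1..d-k} \<Longrightarrow> r \<bullet> w i < 0" .
    show "w i \<in> L" if i: "i \<in> {1..d-k}" for i
    proof -
      have "u0 \<in> L" unfolding L_def using u0L by blast
      then show ?thesis using eL[OF i] L by (auto simp: w_def intro!: subspace_diff subspace_mul subspace_neg)
    qed
    fix i j assume ij: "i \<in> {1..d-k}" "j \<in> {1..d-k}"
    have v3: "e (k + i) \<bullet> e (k + j) = (if i = j then 1 else 0)"
      using ij k by (subst e_inner) auto
    show "(\<Sum>m\<in>M. A i m * A j m) = w i \<bullet> w j"
      unfolding A[OF ij] using eu[OF ij(1)] eu[OF ij(2)] \<tau>k[OF ij(1)] \<tau>k[OF ij(2)] v3 s(1) uu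
      by (auto simp: w_def inner_diff_left inner_diff_right inner_commute[of u0 "e _"] power2_eq_square)
  qed (use M in auto)
  then show ?thesis unfolding external_angle_def F_def[symmetric] cone .
qed

end

lemma filterlim_ident_at_infinity:
  assumes "L \<in> {at_top, at_bot}"
  shows "filterlim (\<lambda>x::real. x) at_infinity L"
  using assms filterlim_ident[of at_top] filterlim_ident[of at_bot]
  by (auto intro: filterlim_at_top_imp_at_infinity filterlim_at_bot_imp_at_infinity)

lemma eventually_abs_gt:
  assumes "L \<in> {at_top, at_bot}"
  shows "\<forall>\<^sub>F x::real in L. \<bar>x\<bar> > R"
proof -
  have "\<forall>\<^sub>F x::real in at_top. \<bar>x\<bar> > R" using eventually_gt_at_top[of "\<bar>R\<bar>"] by eventually_elim auto
  moreover have "\<forall>\<^sub>F x::real in at_bot. \<bar>x\<bar> > R" using eventually_gt_at_bot[of "- \<bar>R\<bar>"] by eventually_elim auto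
  ultimately show ?thesis using assms by auto
qed

lemma sum_split_first_two:
  fixes f :: "nat \<Rightarrow> 'a::comm_monoid_add"
  assumes "n \<ge> 1"
  shows "(\<Sum>j=0..n. f j) = f 0 + (f 1 + (\<Sum>j=2..n. f j))"
  using assms sum.atLeast_Suc_atMost[of 0 n f] sum.atLeast_Suc_atMost[of 1 n f] by (simp add: numeral_2_eq_2)

section \<open>Integrals and limits at the face opposite to the origin\<close>

context orthogonal_simplex
begin

context
  fixes k :: nat
  assumes k: "k < d"
begin

lemma sum_shift: "(\<Sum>m=2..d-k. f (k + m)) = (\<Sum>j=k+2..d. f j :: real)"
proof -
  have "(\<Sum>j=2+k..(d-k)+k. f j) = (\<Sum>m=2..d-k. f (m + k))" by (rule sum.shift_bounds_cl_nat_ivl)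
  then show ?thesis using k by (simp add: add.commute)
qed

lemma sum_split: "(\<Sum>j=1..d. f j) = (\<Sum>j=1..k+1. f j) + (\<Sum>j=k+2..d. f j :: real)"
proof -
  have "{1..d} = {1..k+1} \<union> {k+2..d}" using k by auto
  then show ?thesis by (subst sum.union_disjoint[symmetric]) auto
qed

lemma tau_shift: "i \<in> {2..d-k} \<Longrightarrow> \<tau> (k + i) > 0"
  using \<tau>[of "k + i"] by auto

lemma sum_squares_pos: "(\<Sum>j=1..k+1. (\<tau> j)\<^sup>2) > 0"
proof (rule sum_pos)
  fix j assume "j \<in> {1..k+1}"
  then show "(\<tau> j)\<^sup>2 > 0" using \<tau>[of j] k by auto
qed auto

lemma tail_squares_nonneg: "(\<Sum>j=k+2..d. (\<tau> j)\<^sup>2) \<ge> 0"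
  by (intro sum_nonneg) auto

lemma internal_angle_integral:
  defines "f \<equiv> \<lambda>y. exp (- (\<Sum>j=1..d. (\<tau> j)\<^sup>2) * y\<^sup>2 / 2) / y * Im (\<Prod>j=k+2..d. Phi (- \<i> * complex_of_real (\<tau> j * y)))"
  shows "set_integrable lborel {0<..} f"
    and "internal_angle (convex hull (vertex ` {1..k+1})) S = 1 / 2 ^ (d - k) + 1 / pi * (LINT y:{0<..}|lborel. f y)"
proof -
  define s where "s = sqrt (\<Sum>j=1..k+1. (\<tau> j)\<^sup>2)"
  define \<sigma> where "\<sigma> = sqrt (\<Sum>j=1..d. (\<tau> j)\<^sup>2)"
  have s: "s > 0" "s\<^sup>2 = (\<Sum>j=1..k+1. (\<tau> j)\<^sup>2)" using sum_squares_pos by (auto simp: s_def)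
  have Spos: "(\<Sum>j=1..d. (\<tau> j)\<^sup>2) > 0" unfolding sum_split using sum_squares_pos tail_squares_nonneg by linarith
  have \<sigma>: "\<sigma> > 0" "\<sigma>\<^sup>2 = (\<Sum>j=1..d. (\<tau> j)\<^sup>2)" using Spos by (auto simp: \<sigma>_def)
  have S: "(\<Sum>j=1..d. (\<tau> j)\<^sup>2) = s\<^sup>2 + (\<Sum>j=k+2..d. (\<tau> j)\<^sup>2)" unfolding s(2) by (rule sum_split)
  have J: "finite {k+2..d}" "k + 1 \<notin> {k+2..d}" "\<And>j. j \<in> {k+2..d} \<Longrightarrow> \<tau> j > 0" using \<tau> by auto
  note gauss = gauss_negative_orthant_halfspace[where J="{k+2..d}" and ?i0.0="k+1" and a=\<tau>, OF J(1,2) s(1) J(3) S, folded f_def]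
  show "set_integrable lborel {0<..} f" using gauss(1) .
  \<comment> \<open>Coordinate k + 1 is the component of the Gaussian vector along (\<tau>_1, ...,
    \<tau>_{k+1}), of length s, and coordinate m \<ge> k + 2 is minus its m-th coordinate. The
    constraints become those of \<open>gauss_negative_orthant_halfspace\<close>.\<close>
  define A where "A i m = (if i = 1 then (if m = k + 1 then s else - \<tau> m) / \<sigma> else if m = k + i then 1 / \<tau> m else 0)" for i m
  let ?M = "insert (k + 1) {k+2..d}"
  have "internal_angle (convex hull (vertex ` {1..k+1})) S = orthant_prob {1..d-k} ?M A"
  proof (rule internal_angle_opposite_face[OF k _ \<sigma>])
    fix i j assume ij: "i \<in> {1..d-k}" "j \<in> {1..d-k}"
    have split: "(\<Sum>m\<in>?M. g m) = g (k + 1) + (\<Sum>m=k+2..d. g m)" for g :: "nat \<Rightarrow> real" by simp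
    consider "i = 1" "j = 1" | "i = 1" "j \<noteq> 1" | "i \<noteq> 1" "j = 1" | "i \<noteq> 1" "j \<noteq> 1" by blast
    then show "(\<Sum>m\<in>?M. A i m * A j m) =
      (if i = 1 then (if j = 1 then 1 else -1 / \<sigma>) else if j = 1 then -1 / \<sigma> else if i = j then 1 / (\<tau> (k + i))\<^sup>2 else 0)"
    proof cases
      case 1
      have "(\<Sum>m\<in>?M. A 1 m * A 1 m) = s\<^sup>2 / \<sigma>\<^sup>2 + (\<Sum>m=k+2..d. (\<tau> m)\<^sup>2 / \<sigma>\<^sup>2)"
        unfolding split by (auto simp: A_def power2_eq_square intro!: sum.cong)
      also have "\<dots> = (s\<^sup>2 + (\<Sum>m=k+2..d. (\<tau> m)\<^sup>2)) / \<sigma>\<^sup>2" by (simp add: add_divide_distrib sum_divide_distrib)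
      also have "\<dots> = \<sigma>\<^sup>2 / \<sigma>\<^sup>2" by (simp only: S \<sigma>(2))
      also have "\<dots> = 1" using \<sigma>(1) by simp
      finally show ?thesis using 1 by simp
    next
      case 2
      then have "(\<Sum>m=k+2..d. A i m * A j m) = (\<Sum>m=k+2..d. if m = k + j then -1 / \<sigma> else 0)"
        using J(3)[of "k + j"] by (intro sum.cong) (auto simp: A_def)
      also have "\<dots> = -1 / \<sigma>" using 2 ij by (auto simp: sum.delta)
      finally show ?thesis unfolding split using 2 ij by (simp add: A_def)
    next
      case 3
      then have "(\<Sum>m=k+2..d. A i m * A j m) = (\<Sum>m=k+2..d. if m = k + i then -1 / \<sigma> else 0)"
        using J(3)[of "k + i"] by (intro sum.cong) (auto simp: A_def)
      also have "\<dots> = -1 / \<sigma>" using 3 ij by (auto simp: sum.delta)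
      finally show ?thesis unfolding split using 3 ij by (simp add: A_def)
    next
      case 4
      then have "(\<Sum>m=k+2..d. A i m * A j m) = (\<Sum>m=k+2..d. if m = k + i then (if i = j then 1 / (\<tau> (k + i))\<^sup>2 else 0) else 0)"
        by (intro sum.cong) (auto simp: A_def power2_eq_square)
      also have "\<dots> = (if i = j then 1 / (\<tau> (k + i))\<^sup>2 else 0)" using 4 ij by (auto simp: sum.delta)
      finally show ?thesis unfolding split using 4 ij by (simp add: A_def)
    qed
  qed simp
  also have "\<dots> = measure (gauss_space ?M) {z \<in> space (gauss_space ?M). s * z (k + 1) - (\<Sum>j=k+2..d. \<tau> j * z j) \<le> 0 \<and> (\<forall>j\<in>{k+2..d}. z j \<le> 0)}"
  proof -
    have 1: "(\<Sum>m\<in>?M. A 1 m * z m) \<le> 0 \<longleftrightarrow> s * z (k + 1) - (\<Sum>j=k+2..d. \<tau> j * z j) \<le> 0" for z :: "nat \<Rightarrow> real"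
    proof -
      have "(\<Sum>m\<in>?M. A 1 m * z m) = s * z (k + 1) / \<sigma> + (\<Sum>m=k+2..d. - (\<tau> m * z m / \<sigma>))"
        by (auto simp: A_def intro!: sum.cong)
      also have "\<dots> = (s * z (k + 1) - (\<Sum>j=k+2..d. \<tau> j * z j)) / \<sigma>"
        by (simp add: sum_negf diff_divide_distrib sum_divide_distrib)
      finally show ?thesis using \<sigma>(1) by (simp add: divide_le_0_iff)
    qed
    have 2: "(\<Sum>m\<in>?M. A (j - k) m * z m) \<le> 0 \<longleftrightarrow> z j \<le> 0" if j: "j \<in> {k+2..d}" for j and z :: "nat \<Rightarrow> real"
    proof -
      have "j - k \<noteq> 1" using j by auto
      then have "(\<Sum>m\<in>?M. A (j - k) m * z m) = (\<Sum>m\<in>?M. if m = j then z j / \<tau> j else 0)"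
        using j by (intro sum.cong) (auto simp: A_def)
      also have "\<dots> = z j / \<tau> j" using j by (subst sum.delta) auto
      finally show ?thesis using J(3)[OF j] by (simp add: divide_le_0_iff)
    qed
    show ?thesis unfolding orthant_prob_def ball_split_shift[OF k] using 1 2 by (intro arg_cong[where f="measure _"]) auto
  qed
  also have "\<dots> = 1 / 2 ^ (card {k+2..d} + 1) + 1 / pi * (LINT y:{0<..}|lborel. f y)" by (rule gauss(2))
  also have "card {k+2..d} + 1 = d - k" using k by simp
  finally show "internal_angle (convex hull (vertex ` {1..k+1})) S = 1 / 2 ^ (d - k) + 1 / pi * (LINT y:{0<..}|lborel. f y)" .
qed

lemma external_angle_integral:
  defines "f \<equiv> \<lambda>x. (\<Prod>j=k+2..d. Phi (complex_of_real (\<tau> j / sqrt (\<Sum>m=1..k+1. (\<tau> m)\<^sup>2) * x))) * complex_of_real (exp (- (x\<^sup>2) / 2))"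
  shows "set_integrable lborel {0<..} f"
    and "complex_of_real (external_angle (convex hull (vertex ` {1..k+1})) S) =
       1 / complex_of_real (sqrt (2 * pi)) * (LINT x:{0<..}|lborel. f x)"
proof -
  define s where "s = sqrt (\<Sum>j=1..k+1. (\<tau> j)\<^sup>2)"
  have s: "s > 0" "s\<^sup>2 = (\<Sum>j=1..k+1. (\<tau> j)\<^sup>2)" using sum_squares_pos by (auto simp: s_def)
  have J: "finite {k+2..d}" "k + 1 \<notin> {k+2..d}" "\<And>j. j \<in> {k+2..d} \<Longrightarrow> \<tau> j > 0" using \<tau> by auto
  note gauss = gauss_wedge[where J="{k+2..d}" and ?i0.0="k+1" and b="\<lambda>j. \<tau> j / s", OF J(1,2), unfolded s_def, folded f_def]
  show "set_integrable lborel {0<..} f" using gauss(1) .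
  \<comment> \<open>Coordinates of the Gaussian vector on L in the orthonormal basis u0/s, e_{k+2},
    ..., e_d, with u0 the truncation of \<tau> to its first k + 1 entries; the constraints become a
    wedge.\<close>
  define A where "A i m = (if i = 1 then (if m = k + 1 then - 1 else 0) else if m = k + 1 then - 1 / s else if m = k + i then 1 / \<tau> m else 0)" for i m
  let ?M = "insert (k + 1) {k+2..d}"
  have "external_angle (convex hull (vertex ` {1..k+1})) S = orthant_prob {1..d-k} ?M A"
  proof (rule external_angle_opposite_face[OF k _ s])
    fix i j assume ij: "i \<in> {1..d-k}" "j \<in> {1..d-k}"
    have split: "(\<Sum>m\<in>?M. g m) = g (k + 1) + (\<Sum>m=k+2..d. g m)" for g :: "nat \<Rightarrow> real" by simp
    consider "i = 1" | "i \<noteq> 1" "j = 1" | "i \<noteq> 1" "j \<noteq> 1" by blast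
    then show "(\<Sum>m\<in>?M. A i m * A j m) =
      (if i = 1 then (if j = 1 then 1 else 1 / s) else if j = 1 then 1 / s else 1 / s\<^sup>2 + (if i = j then 1 / (\<tau> (k + i))\<^sup>2 else 0))"
    proof cases
      case 3
      then have "(\<Sum>m=k+2..d. A i m * A j m) = (\<Sum>m=k+2..d. if m = k + i then (if i = j then 1 / (\<tau> (k + i))\<^sup>2 else 0) else 0)"
        by (intro sum.cong) (auto simp: A_def power2_eq_square)
      also have "\<dots> = (if i = j then 1 / (\<tau> (k + i))\<^sup>2 else 0)" using 3 ij by (auto simp: sum.delta)
      finally show ?thesis unfolding split using 3 by (simp add: A_def power2_eq_square)
    qed (auto simp: split A_def intro!: sum.neutral)
  qed simp
  also have "\<dots> = measure (gauss_space ?M) {z \<in> space (gauss_space ?M). 0 \<le> z (k + 1) \<and> (\<forall>j\<in>{k+2..d}. z j \<le> \<tau> j / s * z (k + 1))}"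
  proof -
    have 1: "(\<Sum>m\<in>?M. A 1 m * z m) \<le> 0 \<longleftrightarrow> 0 \<le> z (k + 1)" for z :: "nat \<Rightarrow> real"
    proof -
      have "(\<Sum>m\<in>?M. A 1 m * z m) = - z (k + 1)" by (auto simp: A_def intro!: sum.neutral)
      then show ?thesis by simp
    qed
    have 2: "(\<Sum>m\<in>?M. A (j - k) m * z m) \<le> 0 \<longleftrightarrow> z j \<le> \<tau> j / s * z (k + 1)" if j: "j \<in> {k+2..d}" for j and z :: "nat \<Rightarrow> real"
    proof -
      have "j - k \<noteq> 1" using j by auto
      then have "(\<Sum>m=k+2..d. A (j - k) m * z m) = (\<Sum>m=k+2..d. if m = j then z j / \<tau> j else 0)"
        using j by (intro sum.cong) (auto simp: A_def)
      also have "\<dots> = z j / \<tau> j" using j by (subst sum.delta) auto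
      finally have "(\<Sum>m\<in>?M. A (j - k) m * z m) = z j / \<tau> j - z (k + 1) / s"
        using \<open>j - k \<noteq> 1\<close> by (simp add: A_def)
      then show ?thesis using J(3)[OF j] by (simp add: pos_divide_le_eq mult.commute)
    qed
    show ?thesis unfolding orthant_prob_def ball_split_shift[OF k] using 1 2 by (intro arg_cong[where f="measure _"]) auto
  qed
  finally show "complex_of_real (external_angle (convex hull (vertex ` {1..k+1})) S) =
       1 / complex_of_real (sqrt (2 * pi)) * (LINT x:{0<..}|lborel. f x)"
    using gauss(2) by (simp only: s_def)
qed

text \<open>Since lambda_0 + lambda_1 = -Q, the coefficient c does not depend on lambda_1, and only
  b = -1 / sqrt (Q (1 + Q/lambda_1)) moves.\<close>

lemma internal_angle_limit:
  assumes L: "L \<in> {at_top, at_bot}"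
  shows "((\<lambda>l1. gfun (d - k) ((\<lambda>j. (\<tau> (k + j))\<^sup>2)(0 := - (\<Sum>j=1..d. (\<tau> j)\<^sup>2) - l1, 1 := l1)) ((\<lambda>j. 1)(1 := sgn l1)))
     \<longlongrightarrow> internal_angle (convex hull (vertex ` {1..k+1})) S) L"
proof -
  define Q where "Q = (\<Sum>j=1..d. (\<tau> j)\<^sup>2)"
  define U where "U = (\<Sum>m=2..d-k. (\<tau> (k + m))\<^sup>2)"
  have U: "U = (\<Sum>j=k+2..d. (\<tau> j)\<^sup>2)" unfolding U_def by (rule sum_shift)
  have QU: "Q > U" "U \<ge> 0" unfolding Q_def sum_split U using sum_squares_pos tail_squares_nonneg by auto
  have Q: "sqrt Q > 0" "(sqrt Q)\<^sup>2 = Q" using QU by auto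
  let ?lam = "\<lambda>l1. (\<lambda>j. (\<tau> (k + j))\<^sup>2)(0 := - Q - l1, 1 := l1)"
  let ?eps = "\<lambda>l1. (\<lambda>j. 1)(1 := sgn l1) :: nat \<Rightarrow> real"
  define c where "c = 1 / (- Q) / (1 + sqrt (1 + U / (- Q)))"
  have c0: "1 + U / (- Q) \<ge> 0" using QU by (simp add: field_simps)
  have c: "2 * c + c\<^sup>2 * U = - (1 / Q)" unfolding c_def using rank_one_coefficient[OF c0] by simp
  have angle: "internal_angle (convex hull (vertex ` {1..k+1})) S = orthant_prob {1..d-k} {1..d-k} (rank_one_root (\<lambda>i. \<tau> (k + i)) (- 1 / sqrt Q) c)"
  proof (rule internal_angle_opposite_face[OF k _ Q(1)])
    show "(sqrt Q)\<^sup>2 = (\<Sum>j=1..d. (\<tau> j)\<^sup>2)" using Q by (simp add: Q_def)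
    fix i j assume ij: "i \<in> {1..d-k}" "j \<in> {1..d-k}"
    \<comment> \<open>In the limit b^2 = 1/Q cancels the rank-one term -1/Q exactly, which is the
      orthogonality of the coordinate facets.\<close>
    have "(- 1 / sqrt Q)\<^sup>2 + (2 * c + c\<^sup>2 * U) = 0" unfolding c using Q by (simp add: power_divide)
    moreover have "\<tau> (k + i) \<noteq> 0" if "i \<in> {2..d-k}" for i using tau_shift[OF that] by simp
    ultimately show "(\<Sum>m=1..d-k. rank_one_root (\<lambda>i. \<tau> (k + i)) (- 1 / sqrt Q) c i m * rank_one_root (\<lambda>i. \<tau> (k + i)) (- 1 / sqrt Q) c j m)
      = (if i = 1 then (if j = 1 then 1 else -1 / sqrt Q) else if j = 1 then -1 / sqrt Q else if i = j then 1 / (\<tau> (k + i))\<^sup>2 else 0)"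
      by (subst rank_one_root_gram[OF _ ij]) (simp_all flip: U_def)
  qed simp
  \<comment> \<open>|x| > Q excludes -Q \<le> x \<le> 0, where neither of the first two parameters
    is positive.\<close>
  have ev: "\<forall>\<^sub>F x in L. gfun (d - k) (?lam x) (?eps x)
     = orthant_prob {1..d-k} {1..d-k} (rank_one_root (\<lambda>i. \<tau> (k + i)) (- 1 / sqrt (Q * (1 + Q / x))) c)"
    using eventually_abs_gt[OF L, of Q]
  proof eventually_elim
    case (elim x)
    then have x: "x \<noteq> 0" "x > 0 \<or> x < - Q" using QU by auto
    have prod: "(- Q - x) * x < 0" using x QU by (auto simp: mult_less_0_iff)
    have nz: "- Q - x \<noteq> 0" using x QU by auto
    have g: "g_params (d - k) (?lam x) (?eps x)"
    proof -
      have "(\<Sum>j=0..d-k. ?lam x j) = ?lam x 0 + (?lam x 1 + (\<Sum>j=2..d-k. ?lam x j))"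
        using k by (intro sum_split_first_two) simp
      also have "(\<Sum>j=2..d-k. ?lam x j) = U" unfolding U_def by (intro sum.cong) auto
      finally have eq: "(\<Sum>j=0..d-k. ?lam x j) = ?lam x 0 + (?lam x 1 + U)" .
      have sum: "(\<Sum>j=0..d-k. ?lam x j) < 0" unfolding eq using QU by simp
      have pos: "?lam x j > 0" if "j \<in> {0..d-k}" "j \<noteq> 0" "j \<noteq> 1" for j
        using that tau_shift[of j] by auto
      \<comment> \<open>Case (B) at both ends, but the negative parameter is lambda_0 for x > 0 and
        lambda_1 for x < -Q.\<close>
      have "\<exists>m\<in>{0..d-k}. ?lam x m < 0 \<and> (\<forall>j\<in>{0..d-k} - {m}. ?lam x j > 0)"
      proof (cases "x > 0")
        case True
        then show ?thesis using pos QU by (intro bexI[of _ 0]) auto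
      next
        case False
        then show ?thesis using pos x k by (intro bexI[of _ 1]) auto
      qed
      then show ?thesis unfolding g_params_def using sum x by (auto simp: sgn_if)
    qed
    have "gfun (d - k) (?lam x) (?eps x) = orthant_prob {1..d-k} {1..d-k}
       (rank_one_root (\<lambda>i. \<tau> (k + i)) (?eps x 1 / (?lam x 0 * sqrt ((?lam x 0 + ?lam x 1) / (?lam x 0 * ?lam x 1))))
        (1 / (?lam x 0 + ?lam x 1) / (1 + sqrt (1 + (\<Sum>m=2..d-k. (\<tau> (k + m))\<^sup>2) / (?lam x 0 + ?lam x 1)))))"
    proof (rule gfun_eq_rank_one_root[OF g])
      show "(?lam x 0 + ?lam x 1) / (?lam x 0 * ?lam x 1) > 0" using divide_pos_neg[OF _ prod, of Q] QU by simp
      show "0 \<le> 1 + (\<Sum>m=2..d-k. (\<tau> (k + m))\<^sup>2) / (?lam x 0 + ?lam x 1)" using c0 by (simp add: U_def)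
    qed (use x nz k tau_shift in auto)
    also have "?eps x 1 / (?lam x 0 * sqrt ((?lam x 0 + ?lam x 1) / (?lam x 0 * ?lam x 1))) = - 1 / sqrt (Q * (1 + Q / x))"
    proof -
      \<comment> \<open>lambda_0 has the sign opposite to x, so the factor \<open>sgn x\<close>
        makes b negative on both sides.\<close>
      have "- Q - x = - (sgn x * \<bar>Q + x\<bar>)"
      proof (cases "x > 0")
        case False
        then have "sgn x = -1" "\<bar>Q + x\<bar> = - (Q + x)" using x by auto
        then show ?thesis by simp
      qed (use QU in simp)
      moreover have "\<bar>Q + x\<bar> * sqrt (- Q / ((- Q - x) * x)) = sqrt ((Q + x)\<^sup>2 * (- Q / ((- Q - x) * x)))"
        by (simp only: real_sqrt_mult real_sqrt_abs)
      moreover have "(Q + x)\<^sup>2 * (- Q / ((- Q - x) * x)) = Q * (1 + Q / x)"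
      proof -
        have "(- Q - x) * x = - ((Q + x) * x)" by (simp add: algebra_simps)
        then have "(Q + x)\<^sup>2 * (- Q / ((- Q - x) * x)) = (Q + x) * (Q + x) * Q / ((Q + x) * x)" by (simp add: power2_eq_square)
        also have "\<dots> = (Q + x) * Q / x" using nz by simp
        also have "\<dots> = Q * (1 + Q / x)" using x by (simp add: field_simps)
        finally show ?thesis .
      qed
      ultimately have "(- Q - x) * sqrt (- Q / ((- Q - x) * x)) = - (sgn x * sqrt (Q * (1 + Q / x)))"
        by (metis mult.assoc mult_minus_left)
      then show ?thesis using x by (auto simp: sgn_if split: if_splits)
    qed
    also have "1 / (?lam x 0 + ?lam x 1) / (1 + sqrt (1 + (\<Sum>m=2..d-k. (\<tau> (k + m))\<^sup>2) / (?lam x 0 + ?lam x 1))) = c"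
      by (simp add: c_def U_def)
    finally show ?case .
  qed
  have "((\<lambda>x. - 1 / sqrt (Q * (1 + Q / x))) \<longlongrightarrow> - 1 / sqrt (Q * (1 + 0))) L"
    by (intro tendsto_intros tendsto_divide_0 filterlim_ident_at_infinity[OF L]) (use QU in auto)
  then have "((\<lambda>x. orthant_prob {1..d-k} {1..d-k} (rank_one_root (\<lambda>i. \<tau> (k + i)) (- 1 / sqrt (Q * (1 + Q / x))) c))
      \<longlongrightarrow> internal_angle (convex hull (vertex ` {1..k+1})) S) L"
    unfolding angle by (intro rank_one_root_tendsto tendsto_const) (use QU k in auto)
  then show ?thesis unfolding Q_def[symmetric] tendsto_cong[OF ev] .
qed

text \<open>Here lambda_0 is fixed and |lambda_0 + lambda_1| tends to infinity, so c tends to 0,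
  while b tends to 1 / sqrt Q; the limit is the Gram matrix of the normal cone.\<close>

lemma external_angle_limit:
  assumes L: "L \<in> {at_top, at_bot}"
  shows "((\<lambda>l1. gfun (d - k) ((\<lambda>j. (\<tau> (k + j))\<^sup>2)(0 := (\<Sum>j=1..k+1. (\<tau> j)\<^sup>2), 1 := l1)) (\<lambda>j. 1))
     \<longlongrightarrow> external_angle (convex hull (vertex ` {1..k+1})) S) L"
proof -
  define Q where "Q = (\<Sum>j=1..k+1. (\<tau> j)\<^sup>2)"
  define U where "U = (\<Sum>m=2..d-k. (\<tau> (k + m))\<^sup>2)"
  have QU: "Q > 0" "U \<ge> 0" unfolding Q_def U_def using sum_squares_pos by (auto intro: sum_nonneg)
  have Q: "sqrt Q > 0" "(sqrt Q)\<^sup>2 = Q" using QU by auto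
  let ?lam = "\<lambda>l1. (\<lambda>j. (\<tau> (k + j))\<^sup>2)(0 := Q, 1 := l1)"
  define c where "c x = 1 / (Q + x) / (1 + sqrt (1 + U / (Q + x)))" for x
  have angle: "external_angle (convex hull (vertex ` {1..k+1})) S = orthant_prob {1..d-k} {1..d-k} (rank_one_root (\<lambda>i. \<tau> (k + i)) (1 / sqrt Q) 0)"
  proof (rule external_angle_opposite_face[OF k _ Q(1)])
    show "(sqrt Q)\<^sup>2 = (\<Sum>j=1..k+1. (\<tau> j)\<^sup>2)" using Q by (simp add: Q_def)
    fix i j assume ij: "i \<in> {1..d-k}" "j \<in> {1..d-k}"
    have "\<tau> (k + i) \<noteq> 0" if "i \<in> {2..d-k}" for i using tau_shift[OF that] by simp
    then show "(\<Sum>m=1..d-k. rank_one_root (\<lambda>i. \<tau> (k + i)) (1 / sqrt Q) 0 i m * rank_one_root (\<lambda>i. \<tau> (k + i)) (1 / sqrt Q) 0 j m)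
      = (if i = 1 then (if j = 1 then 1 else 1 / sqrt Q) else if j = 1 then 1 / sqrt Q else 1 / (sqrt Q)\<^sup>2 + (if i = j then 1 / (\<tau> (k + i))\<^sup>2 else 0))"
      by (subst rank_one_root_gram[OF _ ij]) (simp_all add: power_divide)
  qed simp
  \<comment> \<open>For negative x the bound Q + U makes the sum of all parameters negative, as case
    (B) demands, and also ensures 1 + U/(Q + x) \<ge> 0.\<close>
  have ev: "\<forall>\<^sub>F x in L. gfun (d - k) (?lam x) (\<lambda>j. 1)
     = orthant_prob {1..d-k} {1..d-k} (rank_one_root (\<lambda>i. \<tau> (k + i)) (1 / sqrt (Q * (1 + Q / x))) (c x))"
    using eventually_abs_gt[OF L, of "Q + U"]
  proof eventually_elim
    case (elim x)
    then have x: "x \<noteq> 0" "x > 0 \<or> x < - (Q + U)" using QU by auto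
    have v: "(Q + x) / (Q * x) > 0" using x QU by (auto simp: zero_less_divide_iff zero_less_mult_iff mult_less_0_iff)
    have pos: "?lam x j > 0" if "j \<in> {0..d-k}" "j \<noteq> 1" for j
      using that tau_shift[of j] QU by (cases "j = 0") auto
    have g: "g_params (d - k) (?lam x) (\<lambda>j. 1)"
    proof (cases "x > 0")
      case True
      have "?lam x j > 0" if "j \<in> {0..d-k}" for j using pos[OF that] True by (cases "j = 1") auto
      then show ?thesis unfolding g_params_def by blast
    next
      case False
      have "(\<Sum>j=0..d-k. ?lam x j) = ?lam x 0 + (?lam x 1 + (\<Sum>j=2..d-k. ?lam x j))"
        using k by (intro sum_split_first_two) simp
      also have "(\<Sum>j=2..d-k. ?lam x j) = U" unfolding U_def by (intro sum.cong) auto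
      finally have eq: "(\<Sum>j=0..d-k. ?lam x j) = ?lam x 0 + (?lam x 1 + U)" .
      have sum: "(\<Sum>j=0..d-k. ?lam x j) < 0" unfolding eq using x False by simp
      have "\<exists>m\<in>{0..d-k}. ?lam x m < 0 \<and> (\<forall>j\<in>{0..d-k} - {m}. ?lam x j > 0)"
        using pos x False k by (intro bexI[of _ 1]) auto
      then show ?thesis unfolding g_params_def using sum by blast
    qed
    have "gfun (d - k) (?lam x) (\<lambda>j. 1) = orthant_prob {1..d-k} {1..d-k}
       (rank_one_root (\<lambda>i. \<tau> (k + i)) (1 / (?lam x 0 * sqrt ((?lam x 0 + ?lam x 1) / (?lam x 0 * ?lam x 1))))
        (1 / (?lam x 0 + ?lam x 1) / (1 + sqrt (1 + (\<Sum>m=2..d-k. (\<tau> (k + m))\<^sup>2) / (?lam x 0 + ?lam x 1)))))"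
    proof (rule gfun_eq_rank_one_root[OF g])
      show "(?lam x 0 + ?lam x 1) / (?lam x 0 * ?lam x 1) > 0" using v by simp
      have "1 + U / (Q + x) \<ge> 0"
      proof (cases "x > 0")
        case False
        then have "U / (Q + x) \<ge> -1" using x QU by (subst neg_le_divide_eq) auto
        then show ?thesis by simp
      qed (use QU in \<open>simp add: add_nonneg_nonneg\<close>)
      then show "0 \<le> 1 + (\<Sum>m=2..d-k. (\<tau> (k + m))\<^sup>2) / (?lam x 0 + ?lam x 1)" by (simp add: U_def)
    qed (use x QU k tau_shift in auto)
    also have "1 / (?lam x 0 * sqrt ((?lam x 0 + ?lam x 1) / (?lam x 0 * ?lam x 1))) = 1 / sqrt (Q * (1 + Q / x))"
    proof -
      have "Q * sqrt ((Q + x) / (Q * x)) = sqrt (Q\<^sup>2 * ((Q + x) / (Q * x)))"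
        using QU by (simp only: real_sqrt_mult real_sqrt_abs abs_of_pos)
      also have "Q\<^sup>2 * ((Q + x) / (Q * x)) = Q * (1 + Q / x)"
        using x QU by (simp add: field_simps power2_eq_square)
      finally show ?thesis by simp
    qed
    also have "1 / (?lam x 0 + ?lam x 1) / (1 + sqrt (1 + (\<Sum>m=2..d-k. (\<tau> (k + m))\<^sup>2) / (?lam x 0 + ?lam x 1))) = c x"
      by (simp add: c_def U_def)
    finally show ?case .
  qed
  have b: "((\<lambda>x. 1 / sqrt (Q * (1 + Q / x))) \<longlongrightarrow> 1 / sqrt (Q * (1 + 0))) L"
    by (intro tendsto_intros tendsto_divide_0 filterlim_ident_at_infinity[OF L]) (use QU in auto)
  have inf: "filterlim (\<lambda>x. Q + x) at_infinity L"
    by (rule tendsto_add_filterlim_at_infinity[OF tendsto_const filterlim_ident_at_infinity[OF L]])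
  have "(c \<longlongrightarrow> 0 / (1 + sqrt (1 + 0))) L"
    unfolding c_def[abs_def] by (intro tendsto_intros tendsto_divide_0 inf) auto
  then have "((\<lambda>x. orthant_prob {1..d-k} {1..d-k} (rank_one_root (\<lambda>i. \<tau> (k + i)) (1 / sqrt (Q * (1 + Q / x))) (c x)))
      \<longlongrightarrow> external_angle (convex hull (vertex ` {1..k+1})) S) L"
    unfolding angle using b QU k by (intro rank_one_root_tendsto) auto
  then show ?thesis unfolding Q_def[symmetric] tendsto_cong[OF ev] .
qed

end

end

theorem theorem1p8:
  fixes e :: "nat \<Rightarrow> 'a::euclidean_space"
    and \<tau> :: "nat \<Rightarrow> real"
    and d k :: nat
    and S F1 F2 :: "'a set"
  assumes e: "bij_betw e {1..d} (Basis :: 'a set)"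
    and d: "d \<ge> 2"
    and \<tau>: "\<And>j. j \<in> {1..d} \<Longrightarrow> \<tau> j > 0"
    and k: "k \<in> {0..d - 1}"
    and S: "S = convex hull (insert 0 ((\<lambda>j. (1 / \<tau> j) *\<^sub>R e j) ` {1..d}))"
    and F1: "F1 = convex hull (insert 0 ((\<lambda>j. (1 / \<tau> j) *\<^sub>R e j) ` {1..k}))"
    and F2: "F2 = convex hull ((\<lambda>j. (1 / \<tau> j) *\<^sub>R e j) ` {1..k + 1})"
  shows
    "(F1 face_of S \<and> aff_dim F1 = int k \<and>
      internal_angle F1 S = 1 / 2 ^ (d - k) \<and>
      external_angle F1 S = 1 / 2 ^ (d - k)) \<and>
     (F2 face_of S \<and> aff_dim F2 = int k \<and>
      (\<forall>L\<in>{at_top, at_bot}.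
         ((\<lambda>l1. gfun (d - k)
                  ((\<lambda>j. (\<tau> (k + j))\<^sup>2)(0 := - (\<Sum>j=1..d. (\<tau> j)\<^sup>2) - l1, 1 := l1))
                  ((\<lambda>j. 1)(1 := sgn l1)))
            \<longlongrightarrow> internal_angle F2 S) L) \<and>
      set_integrable lborel {0<..}
        (\<lambda>y. exp (- (\<Sum>j=1..d. (\<tau> j)\<^sup>2) * y\<^sup>2 / 2) / y *
              Im (\<Prod>j=k+2..d. Phi (- \<i> * complex_of_real (\<tau> j * y)))) \<and>
      internal_angle F2 S =
        1 / 2 ^ (d - k) + 1 / pi *
          (LINT y:{0<..}|lborel.
             exp (- (\<Sum>j=1..d. (\<tau> j)\<^sup>2) * y\<^sup>2 / 2) / y *
             Im (\<Prod>j=k+2..d. Phi (- \<i> * complex_of_real (\<tau> j * y)))) \<and>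
      (\<forall>L\<in>{at_top, at_bot}.
         ((\<lambda>l1. gfun (d - k)
                  ((\<lambda>j. (\<tau> (k + j))\<^sup>2)(0 := (\<Sum>j=1..k+1. (\<tau> j)\<^sup>2), 1 := l1))
                  (\<lambda>j. 1))
            \<longlongrightarrow> external_angle F2 S) L) \<and>
      set_integrable lborel {0<..}
        (\<lambda>x. (\<Prod>j=k+2..d. Phi (complex_of_real (\<tau> j / sqrt (\<Sum>m=1..k+1. (\<tau> m)\<^sup>2) * x))) *
              complex_of_real (exp (- (x\<^sup>2) / 2))) \<and>
      complex_of_real (external_angle F2 S) =
        1 / complex_of_real (sqrt (2 * pi)) *
          (LINT x:{0<..}|lborel.
             (\<Prod>j=k+2..d. Phi (complex_of_real (\<tau> j / sqrt (\<Sum>m=1..k+1. (\<tau> m)\<^sup>2) * x))) *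
             complex_of_real (exp (- (x\<^sup>2) / 2))))"
proof -
  interpret orthogonal_simplex e \<tau> d by standard (use e \<tau> in auto)
  have kd: "k < d" using k d by auto
  have v: "(\<lambda>j. (1 / \<tau> j) *\<^sub>R e j) = vertex" by (simp add: vertex_def fun_eq_iff)
  note eqs = S[unfolded v] F1[unfolded v] F2[unfolded v]
  have inj: "inj_on vertex {1..n}" if "n \<le> d" for n
    by (rule inj_on_subset[OF inj_on_vertex]) (use that in auto)
  \<comment> \<open>The dimension of a face is one less than its number of vertices, so the listed
    vertices have to be distinct.\<close>
  have "0 \<notin> vertex ` {1..k}" using vertex_neq_0 kd by fastforce
  then have "card (insert 0 (vertex ` {1..k})) = k + 1" using inj[of k] kd by (simp add: card_image)
  moreover have "card (vertex ` {1..k+1}) = k + 1" using inj[of "k+1"] kd by (simp add: card_image)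
  moreover have "insert 0 (vertex ` {1..k}) \<subseteq> insert 0 (vertex ` {1..d})" "vertex ` {1..k+1} \<subseteq> insert 0 (vertex ` {1..d})"
    using kd by auto
  ultimately have faces: "F1 face_of S" "aff_dim F1 = int k" "F2 face_of S" "aff_dim F2 = int k"
    unfolding eqs using face by (simp_all del: image_insert)
  show ?thesis
    unfolding eqs
    using faces[unfolded eqs] origin_face_angles[OF kd] internal_angle_integral[OF kd] external_angle_integral[OF kd]
      internal_angle_limit[OF kd] external_angle_limit[OF kd]
    by blast
qed

end
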